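(* Let $(M,g)$ be a semi-Riemannian manifold of dimension $n$ and $\gamma:[a,b]\to M$ a geodesic. Let $\ell:[a,b]\to\Lambda$ be the curve of Lagrangians associated with $\gamma$ and $L_0=\ell(a)$ (see context). Let $\varepsilon>0$ be a small number such that there are no conjugate instants in $\left]a,a+\varepsilon\right]$. Suppose $t_0\in\left]a,b\right]$ is a conjugate instant such that either $$\mathrm{mul}(t_0)>n_-(g)-\mu_{L_0}\big(\ell|_{[a+\varepsilon,t_0]}\big)\qquad\text{or}\qquad \mu_{L_0}\big(\ell|_{[a+\varepsilon,t_0]}\big)<-n_+(g).$$ Then for every $a'<a$ such that $\gamma$ extends to a geodesic on $[a',b]$ (still denoted $\gamma$), there is an instant $t'\in[a,t_0]$ such that $\gamma(t')$ is conjugate to $\gamma(a')$ along $\gamma$.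
   Context: Maslov index. Let $(V,\omega)$ be a $2n$-dimensional real symplectic space and $\Lambda$ the set of its Lagrangian subspaces. For $L_1\in\Lambda$, $\Lambda^0(L_1)$ is the set of Lagrangians transverse to $L_1$. If $L_0,L_1$ are transverse Lagrangians, $\varphi_{L_0,L_1}:\Lambda^0(L_1)\to\mathrm{B}_{\mathrm{sym}}(L_0)$ (symmetric bilinear forms on $L_0$) is $\varphi_{L_0,L_1}(L)=\omega(T\cdot,\cdot)|_{L_0\times L_0}$, where $T:L_0\to L_1$ is the linear map whose graph is $L$. For a symmetric bilinear form $B$, $n_-(B)$ is the maximal dimension of a subspace on which $B$ is negative definite (index) and $n_+(B)=n_-(-B)$ (coindex). For a continuous path $\ell:[a,b]\to\Lambda$ and $L_0\in\Lambda$, $\mu_{L_0}(\ell)\in\mathbb Z$ is characterized by: fixed-endpoint homotopy invariance; additivity under concatenation; and, if $\ell([a,b])\subset\Lambda^0(L_1)$ for some $L_1$ transverse to $L_0$, $\mu_{L_0}(\ell)=n_+[\varphi_{L_0,L_1}(\ell(b))]-n_+[\varphi_{L_0,L_1}(\ell(a))]$. Geometric setting. Jacobi fields along $\gamma$ are solutions of $\frac{\mathrm D^2}{\mathrm dt^2}J-R(\dot\gamma,J)\dot\gamma=0$, with $R(X,Y)=[\nabla_X,\nabla_Y]-\nabla_{[X,Y]}$. Let $V=T_{\gamma(a)}M\oplus T_{\gamma(a)}M$ with symplectic form $\omega\big((v_1,w_1),(v_2,w_2)\big)=g(v_2,w_1)-g(v_1,w_2)$. For $(v,w)\in V$ let $J_{v,w}$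 be the Jacobi field along $\gamma$ with $J(a)=v$, $\frac{\mathrm D}{\mathrm dt}J(a)=w$. The smooth curve $\ell:[a,b]\to\Lambda$ is $\ell(t)=\{(v,w)\in V: J_{v,w}(t)=0\}$, and $L_0=\{0\}\oplus T_{\gamma(a)}M=\ell(a)$. An instant $t\in\left]a,b\right]$ is conjugate if $\ell(t)\cap L_0\neq\{0\}$, i.e. if there is a nonzero Jacobi field $J$ along $\gamma$ with $J(a)=0$, $J(t)=0$. (Such an $\varepsilon$ always exists, since the initial instant $a$ is isolated.) $\mathrm{mul}(t_0)=\dim A_0[t_0]$, where $A_0[t]=\{\frac{\mathrm D}{\mathrm dt}J(t): J \text{ Jacobi field along }\gamma,\ J(a)=0,\ J(t)=0\}$. $n_-(g)$ and $n_+(g)$ are the index and coindex of the metric $g$. For $a'<a\leq t'$, $\gamma(t')$ is conjugate to $\gamma(a')$ along $\gamma$ if there is a nonzero Jacobi field along $\gamma$ vanishing at $a'$ and at $t'$. *)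

theory Defs
  imports "HOL-Analysis.Analysis"
begin

section \<open>Symmetric bilinear forms\<close>

definition neg_index :: "'v::euclidean_space set \<Rightarrow> ('v \<Rightarrow> 'v \<Rightarrow> real) \<Rightarrow> nat" where
  "neg_index S B = Max {dim W |W. subspace W \<and> W \<subseteq> S \<and> (\<forall>w\<in>W. w \<noteq> 0 \<longrightarrow> B w w < 0)}"

definition pos_index :: "'v::euclidean_space set \<Rightarrow> ('v \<Rightarrow> 'v \<Rightarrow> real) \<Rightarrow> nat" where
  "pos_index S B = neg_index S (\<lambda>x y. - B x y)"

section \<open>The Lagrangian Grassmannian and the Maslov index\<close>

definition lagrangian :: "('v::euclidean_space \<Rightarrow> 'v \<Rightarrow> real) \<Rightarrow> 'v set \<Rightarrow> bool" where
  "lagrangian \<omega> L \<longleftrightarrow> subspace L \<and> (\<forall>u\<in>L. \<forall>v\<in>L. \<omega> u v = 0) \<and> 2 * dim L = DIM('v)"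

text \<open>For a subspace \<open>L\<close>, \<open>closest_point L\<close> is the orthogonal projection onto \<open>L\<close>. So this is the
  usual topology of the Grassmannian, identifying a subspace with its orthogonal projection
  (in finite dimension pointwise and norm convergence of projections agree, and the
  topology does not depend on the auxiliary inner product).\<close>

definition lag_top :: "('v::euclidean_space \<Rightarrow> 'v \<Rightarrow> real) \<Rightarrow> 'v set topology" where
  "lag_top \<omega> = pullback_topology {L. lagrangian \<omega> L} closest_point (euclidean :: ('v \<Rightarrow> 'v) topology)"

definition lag_path :: "('v::euclidean_space \<Rightarrow> 'v \<Rightarrow> real) \<Rightarrow> real \<Rightarrow> real \<Rightarrow> (real \<Rightarrow> 'v set) \<Rightarrow> bool" where
  "lag_path \<omega> a b ell \<longleftrightarrow> continuous_map (top_of_set {a..b}) (lag_top \<omega>) ell"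

definition transverse :: "'v::euclidean_space set \<Rightarrow> 'v set \<Rightarrow> bool" where
  "transverse L L' \<longleftrightarrow> L \<inter> L' = {0}"

text \<open>\<open>graph_map L0 L1 L\<close> is the linear map \<open>T\<close> from \<open>L0\<close> to \<open>L1\<close> with graph
  \<open>L = {x + T x | x. x \<in> L0}\<close>; it is meaningful on \<open>L0\<close>, for \<open>L0\<close> and \<open>L\<close> both transverse to \<open>L1\<close>.\<close>

definition graph_map :: "'v::euclidean_space set \<Rightarrow> 'v set \<Rightarrow> 'v set \<Rightarrow> 'v \<Rightarrow> 'v" where
  "graph_map L0 L1 L x = (THE y. y \<in> L1 \<and> x + y \<in> L)"

definition lag_chart ::
    "('v::euclidean_space \<Rightarrow> 'v \<Rightarrow> real) \<Rightarrow> 'v set \<Rightarrow> 'v set \<Rightarrow> 'v set \<Rightarrow> 'v \<Rightarrow> 'v \<Rightarrow> real" where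
  "lag_chart \<omega> L0 L1 L x y = \<omega> (graph_map L0 L1 L x) y"

text \<open>The three properties that characterize the Maslov index relative to \<open>L0\<close>. The value
  \<open>\<mu> a b ell\<close> is the index of the restriction of \<open>ell\<close> to \<open>{a..b}\<close>; independence of the values of
  \<open>ell\<close> outside \<open>{a..b}\<close> is part of the homotopy invariance.\<close>

definition is_maslov_index ::
    "('v::euclidean_space \<Rightarrow> 'v \<Rightarrow> real) \<Rightarrow> 'v set \<Rightarrow> (real \<Rightarrow> real \<Rightarrow> (real \<Rightarrow> 'v set) \<Rightarrow> int) \<Rightarrow> bool" where
  "is_maslov_index \<omega> L0 \<mu> \<longleftrightarrow>
     (\<forall>a b ell ell'. a < b \<longrightarrow>
        homotopic_with (\<lambda>h. h a = ell a \<and> h b = ell b) (top_of_set {a..b}) (lag_top \<omega>) ell ell' \<longrightarrow>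
        \<mu> a b ell = \<mu> a b ell') \<and>
     (\<forall>a c b ell. a < c \<longrightarrow> c < b \<longrightarrow> lag_path \<omega> a b ell \<longrightarrow> \<mu> a b ell = \<mu> a c ell + \<mu> c b ell) \<and>
     (\<forall>a b ell L1. a < b \<longrightarrow> lag_path \<omega> a b ell \<longrightarrow> lagrangian \<omega> L1 \<longrightarrow> transverse L0 L1 \<longrightarrow>
        (\<forall>t\<in>{a..b}. transverse (ell t) L1) \<longrightarrow>
        \<mu> a b ell = int (pos_index L0 (lag_chart \<omega> L0 L1 (ell b)))
                 - int (pos_index L0 (lag_chart \<omega> L0 L1 (ell a))))"

section \<open>Semi-Riemannian manifolds\<close>

text \<open>Meant for open \<open>S\<close>, where all iterated directional derivatives exist and are continuous.\<close>

primrec Ck_on :: "nat \<Rightarrow> ('a::euclidean_space \<Rightarrow> 'b::euclidean_space) \<Rightarrow> 'a set \<Rightarrow> bool" where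
  "Ck_on 0 f S \<longleftrightarrow> continuous_on S f"
| "Ck_on (Suc k) f S \<longleftrightarrow>
     f differentiable_on S \<and> (\<forall>v. Ck_on k (\<lambda>x. frechet_derivative f (at x) v) S)"

definition smooth_on :: "('a::euclidean_space \<Rightarrow> 'b::euclidean_space) \<Rightarrow> 'a set \<Rightarrow> bool" where
  "smooth_on f S \<longleftrightarrow> (\<forall>k. Ck_on k f S)"

text \<open>A chart is its domain together with its coordinate map (arbitrary off the domain). The
  manifold is the whole type \<open>'m\<close>, its dimension is \<open>CARD('n)\<close>.\<close>

type_synonym ('m, 'n) chart = "'m set \<times> ('m \<Rightarrow> real ^ 'n)"

definition chart_inv :: "('m, 'n::finite) chart \<Rightarrow> real ^ 'n \<Rightarrow> 'm" where
  "chart_inv c = inv_into (fst c) (snd c)"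

definition is_chart :: "('m::topological_space, 'n::finite) chart \<Rightarrow> bool" where
  "is_chart c \<longleftrightarrow> open (fst c) \<and> open (snd c ` fst c) \<and>
     homeomorphism (fst c) (snd c ` fst c) (snd c) (chart_inv c)"

definition transition :: "('m, 'n::finite) chart \<Rightarrow> ('m, 'n) chart \<Rightarrow> real ^ 'n \<Rightarrow> real ^ 'n" where
  "transition c d = snd d \<circ> chart_inv c"

definition overlap :: "('m, 'n::finite) chart \<Rightarrow> ('m, 'n) chart \<Rightarrow> (real ^ 'n) set" where
  "overlap c d = snd c ` (fst c \<inter> fst d)"

definition smooth_atlas :: "('m::topological_space, 'n::finite) chart set \<Rightarrow> bool" where
  "smooth_atlas A \<longleftrightarrow> (\<forall>c\<in>A. is_chart c) \<and> (\<Union>c\<in>A. fst c) = UNIV \<and>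
     (\<forall>c\<in>A. \<forall>d\<in>A. smooth_on (transition c d) (overlap c d))"

text \<open>A tensor field is given by its components in every chart of the atlas: \<open>g c x\<close> is the Gram
  matrix of the metric with respect to the coordinate frame of \<open>c\<close>, at the point with
  coordinates \<open>x\<close>.\<close>

type_synonym ('m, 'n) metric = "('m, 'n) chart \<Rightarrow> real ^ 'n \<Rightarrow> real ^ 'n ^ 'n"

definition gform :: "('m, 'n::finite) metric \<Rightarrow> ('m, 'n) chart \<Rightarrow> real ^ 'n \<Rightarrow> real ^ 'n \<Rightarrow> real ^ 'n \<Rightarrow> real" where
  "gform g c x u v = u \<bullet> (g c x *v v)"

text \<open>The last conjunct says that the metric has constant index.\<close>

definition semi_riemannian :: "('m, 'n::finite) chart set \<Rightarrow> ('m, 'n) metric \<Rightarrow> bool" where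
  "semi_riemannian A g \<longleftrightarrow>
     (\<forall>c\<in>A. smooth_on (g c) (snd c ` fst c)) \<and>
     (\<forall>c\<in>A. \<forall>x\<in>snd c ` fst c.
        (\<forall>u v. gform g c x u v = gform g c x v u) \<and>
        (\<forall>u. (\<forall>v. gform g c x u v = 0) \<longrightarrow> u = 0)) \<and>
     (\<forall>c\<in>A. \<forall>d\<in>A. \<forall>x\<in>overlap c d. \<forall>u v.
        gform g c x u v =
        gform g d (transition c d x)
          (frechet_derivative (transition c d) (at x) u)
          (frechet_derivative (transition c d) (at x) v)) \<and>
     (\<exists>k. \<forall>c\<in>A. \<forall>x\<in>snd c ` fst c. neg_index UNIV (gform g c x) = k)"

definition metric_index :: "('m, 'n::finite) chart set \<Rightarrow> ('m, 'n) metric \<Rightarrow> nat" where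
  "metric_index A g = (THE k. \<forall>c\<in>A. \<forall>x\<in>snd c ` fst c. neg_index UNIV (gform g c x) = k)"

definition metric_coindex :: "('m, 'n::finite) chart set \<Rightarrow> ('m, 'n) metric \<Rightarrow> nat" where
  "metric_coindex A g = (THE k. \<forall>c\<in>A. \<forall>x\<in>snd c ` fst c. pos_index UNIV (gform g c x) = k)"

definition dgform :: "('m, 'n::finite) metric \<Rightarrow> ('m, 'n) chart \<Rightarrow> real ^ 'n \<Rightarrow>
    real ^ 'n \<Rightarrow> real ^ 'n \<Rightarrow> real ^ 'n \<Rightarrow> real" where
  "dgform g c x w u v = frechet_derivative (\<lambda>y. gform g c y u v) (at x) w"

text \<open>The vector with \<open>k\<close>-th component \<open>\<Sum>i j. \<Gamma>\<^sup>k\<^sub>i\<^sub>j u\<^sub>i v\<^sub>j\<close>, where \<open>\<Gamma>\<close> are the Christoffel symbols of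
  the Levi-Civita connection of \<open>g\<close>.\<close>

definition christoffel :: "('m, 'n::finite) metric \<Rightarrow> ('m, 'n) chart \<Rightarrow> real ^ 'n \<Rightarrow>
    real ^ 'n \<Rightarrow> real ^ 'n \<Rightarrow> real ^ 'n" where
  "christoffel g c x u v = matrix_inv (g c x) *v
     (\<chi> l. (dgform g c x u v (axis l 1) + dgform g c x v u (axis l 1) - dgform g c x (axis l 1) u v) / 2)"

definition dchristoffel :: "('m, 'n::finite) metric \<Rightarrow> ('m, 'n) chart \<Rightarrow> real ^ 'n \<Rightarrow>
    real ^ 'n \<Rightarrow> real ^ 'n \<Rightarrow> real ^ 'n \<Rightarrow> real ^ 'n" where
  "dchristoffel g c x w u v = frechet_derivative (\<lambda>y. christoffel g c y u v) (at x) w"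

text \<open>\<open>curvature g c x u v w\<close> is \<open>R(u,v)w\<close> for \<open>R(X,Y) = [\<nabla>\<^sub>X,\<nabla>\<^sub>Y] - \<nabla>\<^bsub>[X,Y]\<^esub>\<close>, computed with the
  (commuting) vector fields that have constant components \<open>u\<close>, \<open>v\<close>, \<open>w\<close> in the chart \<open>c\<close>.\<close>

definition curvature :: "('m, 'n::finite) metric \<Rightarrow> ('m, 'n) chart \<Rightarrow> real ^ 'n \<Rightarrow>
    real ^ 'n \<Rightarrow> real ^ 'n \<Rightarrow> real ^ 'n \<Rightarrow> real ^ 'n" where
  "curvature g c x u v w =
     dchristoffel g c x u v w + christoffel g c x u (christoffel g c x v w)
     - dchristoffel g c x v u w - christoffel g c x v (christoffel g c x u w)"

section \<open>Geodesics and Jacobi fields\<close>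

text \<open>A vector field \<open>V\<close> along a curve \<open>\<gamma>\<close> is given by its components \<open>V c t\<close> in every chart \<open>c\<close> of the
  atlas with \<open>\<gamma> t\<close> in its domain; all other values of \<open>V\<close> are irrelevant. Derivatives at \<open>t\<close> are
  taken within the parameter interval \<open>I\<close>, hence are one-sided at its end points.\<close>

type_synonym ('m, 'n) field = "('m, 'n) chart \<Rightarrow> real \<Rightarrow> real ^ 'n"

definition vector_field_along :: "('m, 'n::finite) chart set \<Rightarrow> (real \<Rightarrow> 'm) \<Rightarrow> real set \<Rightarrow> ('m, 'n) field \<Rightarrow> bool" where
  "vector_field_along A \<gamma> I V \<longleftrightarrow> (\<forall>c\<in>A. \<forall>d\<in>A. \<forall>t\<in>I. \<gamma> t \<in> fst c \<inter> fst d \<longrightarrow>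
     V d t = frechet_derivative (transition c d) (at (snd c (\<gamma> t))) (V c t))"

definition differentiable_along :: "('m, 'n::finite) chart set \<Rightarrow> (real \<Rightarrow> 'm) \<Rightarrow> real set \<Rightarrow> ('m, 'n) field \<Rightarrow> bool" where
  "differentiable_along A \<gamma> I V \<longleftrightarrow>
     (\<forall>c\<in>A. \<forall>t\<in>I. \<gamma> t \<in> fst c \<longrightarrow> V c differentiable (at t within I))"

definition velocity :: "(real \<Rightarrow> 'm) \<Rightarrow> real set \<Rightarrow> ('m, 'n::finite) field" where
  "velocity \<gamma> I c t = vector_derivative (snd c \<circ> \<gamma>) (at t within I)"

definition cov_deriv :: "('m, 'n::finite) metric \<Rightarrow> (real \<Rightarrow> 'm) \<Rightarrow> real set \<Rightarrow> ('m, 'n) field \<Rightarrow> ('m, 'n) field" where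
  "cov_deriv g \<gamma> I V c t = vector_derivative (V c) (at t within I)
     + christoffel g c (snd c (\<gamma> t)) (velocity \<gamma> I c t) (V c t)"

definition geodesic :: "('m::topological_space, 'n::finite) chart set \<Rightarrow> ('m, 'n) metric \<Rightarrow>
    (real \<Rightarrow> 'm) \<Rightarrow> real set \<Rightarrow> bool" where
  "geodesic A g \<gamma> I \<longleftrightarrow> continuous_on I \<gamma> \<and>
     differentiable_along A \<gamma> I (\<lambda>c. snd c \<circ> \<gamma>) \<and>
     differentiable_along A \<gamma> I (velocity \<gamma> I) \<and>
     (\<forall>c\<in>A. \<forall>t\<in>I. \<gamma> t \<in> fst c \<longrightarrow> cov_deriv g \<gamma> I (velocity \<gamma> I) c t = 0)"

definition jacobi_field :: "('m::topological_space, 'n::finite) chart set \<Rightarrow> ('m, 'n) metric \<Rightarrow>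
    (real \<Rightarrow> 'm) \<Rightarrow> real set \<Rightarrow> ('m, 'n) field \<Rightarrow> bool" where
  "jacobi_field A g \<gamma> I J \<longleftrightarrow> vector_field_along A \<gamma> I J \<and>
     differentiable_along A \<gamma> I J \<and> differentiable_along A \<gamma> I (cov_deriv g \<gamma> I J) \<and>
     (\<forall>c\<in>A. \<forall>t\<in>I. \<gamma> t \<in> fst c \<longrightarrow>
        cov_deriv g \<gamma> I (cov_deriv g \<gamma> I J) c t
        - curvature g c (snd c (\<gamma> t)) (velocity \<gamma> I c t) (J c t) (velocity \<gamma> I c t) = 0)"

text \<open>The tangent space at \<open>p\<close> is identified with \<open>real ^ 'n\<close> by means of an arbitrary chart of the
  atlas at \<open>p\<close>.\<close>

definition chart_at :: "('m, 'n::finite) chart set \<Rightarrow> 'm \<Rightarrow> ('m, 'n) chart" where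
  "chart_at A p = (SOME c. c \<in> A \<and> p \<in> fst c)"

definition value_at :: "('m, 'n::finite) chart set \<Rightarrow> (real \<Rightarrow> 'm) \<Rightarrow> ('m, 'n) field \<Rightarrow> real \<Rightarrow> real ^ 'n" where
  "value_at A \<gamma> V t = V (chart_at A (\<gamma> t)) t"

definition metric_at :: "('m, 'n::finite) chart set \<Rightarrow> ('m, 'n) metric \<Rightarrow> 'm \<Rightarrow> real ^ 'n \<Rightarrow> real ^ 'n \<Rightarrow> real" where
  "metric_at A g p = gform g (chart_at A p) (snd (chart_at A p) p)"

definition symp_form :: "('m, 'n::finite) chart set \<Rightarrow> ('m, 'n) metric \<Rightarrow> 'm \<Rightarrow>
    (real ^ 'n) \<times> (real ^ 'n) \<Rightarrow> (real ^ 'n) \<times> (real ^ 'n) \<Rightarrow> real" where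
  "symp_form A g p = (\<lambda>(v1, w1) (v2, w2). metric_at A g p v2 w1 - metric_at A g p v1 w2)"

definition lag_curve :: "('m::topological_space, 'n::finite) chart set \<Rightarrow> ('m, 'n) metric \<Rightarrow>
    (real \<Rightarrow> 'm) \<Rightarrow> real \<Rightarrow> real \<Rightarrow> real \<Rightarrow> ((real ^ 'n) \<times> (real ^ 'n)) set" where
  "lag_curve A g \<gamma> a b t = {(v, w). \<exists>J. jacobi_field A g \<gamma> {a..b} J \<and>
     value_at A \<gamma> J a = v \<and> value_at A \<gamma> (cov_deriv g \<gamma> {a..b} J) a = w \<and> value_at A \<gamma> J t = 0}"

definition conjugate_instant :: "('m::topological_space, 'n::finite) chart set \<Rightarrow> ('m, 'n) metric \<Rightarrow>
    (real \<Rightarrow> 'm) \<Rightarrow> real \<Rightarrow> real \<Rightarrow> real \<Rightarrow> bool" where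
  "conjugate_instant A g \<gamma> a b t \<longleftrightarrow>
     t \<in> {a<..b} \<and> lag_curve A g \<gamma> a b t \<inter> lag_curve A g \<gamma> a b a \<noteq> {0}"

definition mul :: "('m::topological_space, 'n::finite) chart set \<Rightarrow> ('m, 'n) metric \<Rightarrow>
    (real \<Rightarrow> 'm) \<Rightarrow> real \<Rightarrow> real \<Rightarrow> real \<Rightarrow> nat" where
  "mul A g \<gamma> a b t = dim {value_at A \<gamma> (cov_deriv g \<gamma> {a..b} J) t |J.
     jacobi_field A g \<gamma> {a..b} J \<and> value_at A \<gamma> J a = 0 \<and> value_at A \<gamma> J t = 0}"

definition conjugate_along :: "('m::topological_space, 'n::finite) chart set \<Rightarrow> ('m, 'n) metric \<Rightarrow>
    (real \<Rightarrow> 'm) \<Rightarrow> real set \<Rightarrow> real \<Rightarrow> real \<Rightarrow> bool" where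
  "conjugate_along A g \<gamma> I s t \<longleftrightarrow> (\<exists>J. jacobi_field A g \<gamma> I J \<and>
     (\<exists>r\<in>I. value_at A \<gamma> J r \<noteq> 0) \<and> value_at A \<gamma> J s = 0 \<and> value_at A \<gamma> J t = 0)"

end

theory Submission
  imports Defs
begin

text \<open>Suppose that no instant of \<open>[a, t0]\<close> is conjugate to \<open>a'\<close>. The Jacobi fields vanishing at \<open>a'\<close>
  form a Lagrangian \<open>L1\<close>, which is then transverse to \<open>\<ell>(t)\<close> for all \<open>t\<close> in \<open>[a, t0]\<close>. So the whole curve
  lies in one chart of the Lagrangian Grassmannian, and its Maslov index on \<open>[a + \<epsilon>, t0]\<close> is the
  difference of the coindices of the chart images \<open>\<phi>(t0)\<close> and \<open>\<phi>(a + \<epsilon>)\<close>. The kernel of \<open>\<phi>(t0)\<close> has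
  dimension \<open>mul(t0)\<close>. Since \<open>\<phi>(t) / (t - a)\<close> is nondegenerate on \<open>]a, a + \<epsilon>]\<close> and tends to the metric as
  \<open>t\<close> tends to \<open>a\<close>, the coindex of \<open>\<phi>(a + \<epsilon>)\<close> is that of the metric. Hence the Maslov index is at
  least \<open>- n\<^sub>+(g)\<close> and \<open>mul(t0)\<close> is at most \<open>n\<^sub>-(g)\<close> minus the Maslov index.

  The curve \<open>\<ell>\<close> is made accessible by a parallel frame along the geodesic: it turns Jacobi fields into
  solutions of \<open>j'' = R(t) j\<close> in \<open>real ^ 'n\<close>, with a constant metric for which \<open>R(t)\<close> is symmetric.\<close>

section \<open>Calculus\<close>

text \<open>As \<open>L0\<close> is the value of the curve at \<open>a\<close>, its chart image is
  zero there, and the coindex just after \<open>a\<close> cannot be read off at \<open>a\<close>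
  itself; dividing by \<open>t - a\<close> removes exactly this degeneracy. At the other end it is
  enough that the coindex \<open>k\<close> of the chart image satisfies \<open>0 \<le> k\<close> and
  \<open>k + mul \<le> n\<close>: the former gives the estimate with the coindex of the metric, the
  latter that with its index, because index and coindex of the metric add up to \<open>n\<close>. A
  geodesic need not stay in one chart, derivatives are one-sided at the ends of the parameter
  interval, and Jacobi fields on \<open>[a, b]\<close> have to be compared with those on
  \<open>[a', b]\<close>. One parallel frame along the extended geodesic, normalised at
  \<open>a\<close>, settles this: all fields become restrictions of solutions given by one flow, and
  initial data at \<open>a\<close> keep their coordinates, so that neither the symplectic form nor
  the curve of Lagrangians has to be converted. Inverse maps depending on a parameter are never
  differentiated. Unknowns are characterised by a linear equation, or by pairings under a
  nondegenerate form, and their regularity is drawn from that.\<close>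

lemma Ck_on_cong:
  assumes "open S" "\<And>x. x \<in> S \<Longrightarrow> f x = f' x" "Ck_on k f S"
  shows "Ck_on k f' S"
  using assms(2,3)
proof (induction k arbitrary: f f')
  case 0
  then show ?case by (auto cong: continuous_on_cong)
next
  case (Suc k)
  have fd: "f differentiable (at x)" if "x \<in> S" for x
    using Suc.prems(2) that differentiable_on_eq_differentiable_at[OF assms(1)] by auto
  have ev: "\<forall>\<^sub>F y in at x. f y = f' y" if "x \<in> S" for x
    using that assms(1) Suc.prems(1) eventually_at_topological by blast
  have d: "(f' has_derivative frechet_derivative f (at x)) (at x)" if x: "x \<in> S" for x
    using has_derivative_transform_eventually[OF fd[OF x, unfolded frechet_derivative_works] ev[OF x]]
      Suc.prems(1)[OF x] by auto
  have e: "frechet_derivative f' (at x) = frechet_derivative f (at x)" if x: "x \<in> S" for x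
    using d[OF x] frechet_derivative_at by metis
  have "f' differentiable_on S"
    using d assms(1) unfolding differentiable_on_def differentiable_def
    by (metis has_derivative_at_withinI)
  moreover have "Ck_on k (\<lambda>x. frechet_derivative f' (at x) v) S" for v
    by (rule Suc.IH[of "\<lambda>x. frechet_derivative f (at x) v"]) (use e Suc.prems(2) in auto)
  ultimately show ?case by simp
qed

text \<open>Lets inductions on \<open>k\<close> work with any family of derivatives in place of the
  specific \<open>frechet_derivative\<close>; derivatives on an open set are unique, so nothing is
  lost.\<close>

lemma Ck_on_Suc_iff:
  assumes "open S"
  shows "Ck_on (Suc k) f S \<longleftrightarrow>
    (\<exists>f'. (\<forall>x\<in>S. (f has_derivative f' x) (at x)) \<and> (\<forall>v. Ck_on k (\<lambda>x. f' x v) S))"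
proof
  assume L: "Ck_on (Suc k) f S"
  then have "(f has_derivative frechet_derivative f (at x)) (at x)" if "x \<in> S" for x
    using that by (simp add: differentiable_on_eq_differentiable_at[OF assms] frechet_derivative_works)
  then show "\<exists>f'. (\<forall>x\<in>S. (f has_derivative f' x) (at x)) \<and> (\<forall>v. Ck_on k (\<lambda>x. f' x v) S)"
    using L by (intro exI[of _ "\<lambda>x. frechet_derivative f (at x)"]) auto
next
  assume "\<exists>f'. (\<forall>x\<in>S. (f has_derivative f' x) (at x)) \<and> (\<forall>v. Ck_on k (\<lambda>x. f' x v) S)"
  then obtain f' where f': "\<And>x. x \<in> S \<Longrightarrow> (f has_derivative f' x) (at x)" "\<And>v. Ck_on k (\<lambda>x. f' x v) S"
    by blast
  have "f differentiable_on S"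
    using f'(1) unfolding differentiable_on_def differentiable_def
    by (metis has_derivative_at_withinI)
  moreover have "Ck_on k (\<lambda>x. frechet_derivative f (at x) v) S" for v
    by (rule Ck_on_cong[OF assms _ f'(2)[of v]]) (metis f'(1) frechet_derivative_at)
  ultimately show "Ck_on (Suc k) f S" by simp
qed

lemma Ck_on_imp_continuous_on: "Ck_on k f S \<Longrightarrow> continuous_on S f"
  by (cases k) (auto intro: differentiable_imp_continuous_on)

lemma Ck_on_SucD: "Ck_on (Suc k) f S \<Longrightarrow> Ck_on k f S"
proof (induction k arbitrary: f)
  case 0
  then show ?case using differentiable_imp_continuous_on by auto
next
  case (Suc k)
  then show ?case by (metis Ck_on.simps(2))
qed

lemma smooth_onD:
  assumes "smooth_on f S" "open S" "x \<in> S"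
  shows "(f has_derivative frechet_derivative f (at x)) (at x)"
  using assms(1)[unfolded smooth_on_def, rule_format, of 1] assms(3)
  by (simp add: differentiable_on_eq_differentiable_at[OF assms(2)] frechet_derivative_works)

lemma smooth_on_frechet:
  assumes "smooth_on f S"
  shows "smooth_on (\<lambda>x. frechet_derivative f (at x) v) S"
  using assms unfolding smooth_on_def by (metis Ck_on.simps(2))

lemma smooth_on_continuous: "smooth_on f S \<Longrightarrow> continuous_on S f"
  unfolding smooth_on_def using Ck_on_imp_continuous_on by blast

section \<open>Closure of the classes C^k under linear and bilinear operations\<close>

lemma Ck_on_const: "open S \<Longrightarrow> Ck_on k (\<lambda>x. c) S"
proof (induction k arbitrary: c)
  case 0
  then show ?case by simp
next
  case (Suc k)
  show ?case unfolding Ck_on_Suc_iff[OF Suc.prems]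
    by (rule exI[of _ "\<lambda>x v. 0"]) (use Suc in auto)
qed

lemma Ck_on_add:
  assumes "open S" "Ck_on k f S" "Ck_on k f2 S"
  shows "Ck_on k (\<lambda>x. f x + f2 x) S"
  using assms(2,3)
proof (induction k arbitrary: f f2)
  case 0
  then show ?case by (auto intro: continuous_intros)
next
  case (Suc k)
  obtain f' where f': "\<And>x. x \<in> S \<Longrightarrow> (f has_derivative f' x) (at x)" "\<And>v. Ck_on k (\<lambda>x. f' x v) S"
    using Suc.prems(1) unfolding Ck_on_Suc_iff[OF assms(1)] by blast
  obtain g' where g': "\<And>x. x \<in> S \<Longrightarrow> (f2 has_derivative g' x) (at x)" "\<And>v. Ck_on k (\<lambda>x. g' x v) S"
    using Suc.prems(2) unfolding Ck_on_Suc_iff[OF assms(1)] by blast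
  show ?case unfolding Ck_on_Suc_iff[OF assms(1)]
    by (rule exI[of _ "\<lambda>x v. f' x v + g' x v"]) (auto intro: has_derivative_add f' g' Suc.IH)
qed

lemma Ck_on_linear:
  assumes "open S" "bounded_linear h" "Ck_on k f S"
  shows "Ck_on k (\<lambda>x. h (f x)) S"
  using assms(3)
proof (induction k arbitrary: f)
  case 0
  then show ?case using bounded_linear.continuous_on[OF assms(2)] by auto
next
  case (Suc k)
  obtain f' where f': "\<And>x. x \<in> S \<Longrightarrow> (f has_derivative f' x) (at x)" "\<And>v. Ck_on k (\<lambda>x. f' x v) S"
    using Suc.prems(1) unfolding Ck_on_Suc_iff[OF assms(1)] by blast
  show ?case unfolding Ck_on_Suc_iff[OF assms(1)]
    by (rule exI[of _ "\<lambda>x v. h (f' x v)"]) (auto intro: bounded_linear.has_derivative[OF assms(2)] f' Suc.IH)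
qed

lemma Ck_on_bilinear:
  assumes "open S" "bounded_bilinear h" "Ck_on k f S" "Ck_on k f2 S"
  shows "Ck_on k (\<lambda>x. h (f x) (f2 x)) S"
  using assms(3,4)
proof (induction k arbitrary: f f2)
  case 0
  then show ?case using bounded_bilinear.continuous_on[OF assms(2)] by auto
next
  case (Suc k)
  obtain f' where f': "\<And>x. x \<in> S \<Longrightarrow> (f has_derivative f' x) (at x)" "\<And>v. Ck_on k (\<lambda>x. f' x v) S"
    using Suc.prems(1) unfolding Ck_on_Suc_iff[OF assms(1)] by blast
  obtain g' where g': "\<And>x. x \<in> S \<Longrightarrow> (f2 has_derivative g' x) (at x)" "\<And>v. Ck_on k (\<lambda>x. g' x v) S"
    using Suc.prems(2) unfolding Ck_on_Suc_iff[OF assms(1)] by blast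
  show ?case unfolding Ck_on_Suc_iff[OF assms(1)]
    by (rule exI[of _ "\<lambda>x v. h (f x) (g' x v) + h (f' x v) (f2 x)"])
      (auto intro!: bounded_bilinear.FDERIV[OF assms(2)] f' g' Suc.IH Ck_on_add assms
         Ck_on_SucD[OF Suc.prems(1)] Ck_on_SucD[OF Suc.prems(2)])
qed

lemma smooth_on_add: "open S \<Longrightarrow> smooth_on f S \<Longrightarrow> smooth_on f2 S \<Longrightarrow> smooth_on (\<lambda>x. f x + f2 x) S"
  and smooth_on_linear: "open S \<Longrightarrow> bounded_linear h \<Longrightarrow> smooth_on f S \<Longrightarrow> smooth_on (\<lambda>x. h (f x)) S"
  unfolding smooth_on_def by (auto intro: Ck_on_add Ck_on_linear)

section \<open>Linear equations with C^k coefficients\<close>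

lemma matrix_vector_mult_bounded_bilinear:
  "bounded_bilinear ((*v) :: real^'n^'m \<Rightarrow> real^'n \<Rightarrow> real^'m)"
  by (simp add: bilinear_conv_bounded_bilinear[symmetric] bilinear_def linear_iff
      matrix_vector_right_distrib matrix_vector_mult_add_rdistrib matrix_vector_mult_scaleR
      scaleR_matrix_vector_assoc)

lemma
  assumes "invertible M"
  shows matrix_inv_right: "M ** matrix_inv M = mat 1" and matrix_inv_left: "matrix_inv M ** M = mat 1"
proof -
  have "M ** matrix_inv M = mat 1 \<and> matrix_inv M ** M = mat 1"
    using assms unfolding invertible_def matrix_inv_def by (rule someI_ex)
  then show "M ** matrix_inv M = mat 1" "matrix_inv M ** M = mat 1" by auto
qed

lemma matrix_bounded_below:
  fixes M :: "real^'n^'n"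
  assumes "invertible M"
  obtains m where "m > 0" "\<And>x. m * norm x \<le> norm (M *v x)"
proof -
  have "inj ((*v) M)" using assms by (metis inj_matrix_vector_mult)
  then obtain m where "m > 0" "\<And>x. norm (M *v x) \<ge> m * norm x"
    using linear_inj_bounded_below_pos[OF matrix_vector_mul_linear] by metis
  then show ?thesis using that by metis
qed

text \<open>\<open>M x0 (y x - y x0)\<close> is \<open>(b x - b x0) - (M x - M x0) y x0\<close> up to \<open>(M x - M x0) (y x - y x0)\<close>, which
  the lower bound of \<open>M x0\<close> absorbs.\<close>

lemma continuous_on_solve:
  fixes M :: "'a::metric_space \<Rightarrow> real^'n^'n"
  assumes M: "continuous_on S M" and b: "continuous_on S b"
    and inv: "\<And>x. x \<in> S \<Longrightarrow> invertible (M x)" and eq: "\<And>x. x \<in> S \<Longrightarrow> M x *v y x = b x"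
  shows "continuous_on S y"
  unfolding continuous_on_def
proof
  fix x0 assume x0: "x0 \<in> S"
  obtain m where m: "m > 0" "\<And>z. m * norm z \<le> norm (M x0 *v z)"
    using matrix_bounded_below[OF inv[OF x0]] by blast
  interpret mv: bounded_bilinear "(*v) :: real^'n^'n \<Rightarrow> real^'n \<Rightarrow> real^'n"
    by (rule matrix_vector_mult_bounded_bilinear)
  obtain K where K: "K > 0" "\<And>P z. norm ((P::real^'n^'n) *v (z::real^'n)) \<le> norm P * norm z * K"
    using mv.pos_bounded by metis
  have Mt: "(M \<longlongrightarrow> M x0) (at x0 within S)" and bt: "(b \<longlongrightarrow> b x0) (at x0 within S)"
    using M b x0 by (auto simp: continuous_on_def)
  have "((\<lambda>x. (norm (b x - b x0) + norm (M x - M x0) * norm (y x0) * K) / (m/2)) \<longlongrightarrow>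
      (norm (b x0 - b x0) + norm (M x0 - M x0) * norm (y x0) * K) / (m/2)) (at x0 within S)"
    by (intro tendsto_intros Mt bt) (use m in auto)
  then have z: "((\<lambda>x. (norm (b x - b x0) + norm (M x - M x0) * norm (y x0) * K) / (m/2)) \<longlongrightarrow> 0) (at x0 within S)"
    by simp
  have "\<forall>\<^sub>F x in at x0 within S. dist (M x) (M x0) < m / (2*K)"
    using Mt m K by (intro tendstoD) auto
  moreover have "\<forall>\<^sub>F x in at x0 within S. x \<in> S" by (simp add: eventually_at_filter)
  ultimately have "\<forall>\<^sub>F x in at x0 within S. norm (y x - y x0) \<le>
      (norm (b x - b x0) + norm (M x - M x0) * norm (y x0) * K) / (m/2)"
  proof eventually_elim
    case (elim x)
    have e: "M x0 *v (y x - y x0) = (b x - b x0) - (M x - M x0) *v y x0 - (M x - M x0) *v (y x - y x0)"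
      using eq[OF elim(2)] eq[OF x0]
      by (simp add: mv.diff_left mv.diff_right)
    have "norm (M x - M x0) * K \<le> m/2"
      using elim(1) K(1) by (simp add: dist_norm field_simps)
    then have s: "norm (M x - M x0) * norm (y x - y x0) * K \<le> m/2 * norm (y x - y x0)"
      using mult_right_mono[of "norm (M x - M x0) * K" "m/2" "norm (y x - y x0)"] by (simp add: mult_ac)
    have "m * norm (y x - y x0) \<le> norm (b x - b x0) + norm ((M x - M x0) *v y x0) + norm ((M x - M x0) *v (y x - y x0))"
      using m(2)[of "y x - y x0"] unfolding e
      using norm_triangle_ineq4[of "b x - b x0 - (M x - M x0) *v y x0" "(M x - M x0) *v (y x - y x0)"]
        norm_triangle_ineq4[of "b x - b x0" "(M x - M x0) *v y x0"] by linarith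
    then have "m/2 * norm (y x - y x0) \<le> norm (b x - b x0) + norm (M x - M x0) * norm (y x0) * K"
      using K(2)[of "M x - M x0" "y x0"] K(2)[of "M x - M x0" "y x - y x0"] s by linarith
    then show ?case using m(1) by (simp add: field_simps)
  qed
  then have "((\<lambda>x. y x - y x0) \<longlongrightarrow> 0) (at x0 within S)"
    by (rule Lim_null_comparison[OF _ z])
  then show "(y \<longlongrightarrow> y x0) (at x0 within S)" by (simp add: LIM_zero_iff)
qed

text \<open>Formally differentiating the equation gives
  \<open>M x *v y' x v = b' x v - M' x v *v y x\<close>, an equation with the same matrix, whose
  right-hand side is C^k once \<open>y\<close> is. So the induction hypothesis is used twice, for
  \<open>y\<close> and for \<open>y'\<close>, and the inverse matrix is never
  differentiated.\<close>

lemma Ck_on_solve: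
  fixes M :: "'a::euclidean_space \<Rightarrow> real^'n^'n"
  assumes S: "open S" and M: "Ck_on k M S" and b: "Ck_on k b S"
    and inv: "\<And>x. x \<in> S \<Longrightarrow> invertible (M x)" and eq: "\<And>x. x \<in> S \<Longrightarrow> M x *v y x = b x"
  shows "Ck_on k y S"
  using M b eq
proof (induction k arbitrary: b y)
  case 0
  then show ?case using continuous_on_solve[of S M b y] inv by auto
next
  case (Suc k)
  interpret mv: bounded_bilinear "(*v) :: real^'n^'n \<Rightarrow> real^'n \<Rightarrow> real^'n"
    by (rule matrix_vector_mult_bounded_bilinear)
  obtain M' where M': "\<And>x. x \<in> S \<Longrightarrow> (M has_derivative M' x) (at x)" "\<And>v. Ck_on k (\<lambda>x. M' x v) S"
    using Suc.prems(1) unfolding Ck_on_Suc_iff[OF assms(1)] by blast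
  obtain b' where b': "\<And>x. x \<in> S \<Longrightarrow> (b has_derivative b' x) (at x)" "\<And>v. Ck_on k (\<lambda>x. b' x v) S"
    using Suc.prems(2) unfolding Ck_on_Suc_iff[OF assms(1)] by blast
  have yk: "Ck_on k y S" by (rule Suc.IH) (use Suc.prems Ck_on_SucD in auto)
  define y' where "y' x v = matrix_inv (M x) *v (b' x v - M' x v *v y x)" for x v
  have y'eq: "M x *v y' x v = b' x v - M' x v *v y x" if "x \<in> S" for x v
    using inv[OF that] by (simp add: y'_def matrix_vector_mul_assoc matrix_inv_right)
  have yd: "(y has_derivative y' x0) (at x0)" if x0: "x0 \<in> S" for x0
  proof -
    let ?N = "matrix_inv (M x0)"
    have bl: "bounded_linear ((*v) ?N)" by (rule mv.bounded_linear_right)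
    have yc: "(y \<longlongrightarrow> y x0) (at x0)"
      using Ck_on_imp_continuous_on[OF yk] x0 S by (simp add: continuous_on_eq_continuous_at continuous_at)
    \<comment> \<open>\<open>(M x - M x0) (y x - y x0)\<close> has derivative zero, being \<open>O(\<bar>x - x0\<bar>) o(1)\<close>.\<close>
    have r: "((\<lambda>x. (M x - M x0) *v (y x - y x0)) has_derivative (\<lambda>v. 0)) (at x0)"
    proof -
      obtain K where K: "K > 0" "\<And>P z. norm ((P::real^'n^'n) *v (z::real^'n)) \<le> norm P * norm z * K"
        using mv.pos_bounded by metis
      obtain B where B: "B > 0" "\<And>v. norm (M' x0 v) \<le> norm v * B"
        using bounded_linear.pos_bounded[OF has_derivative_bounded_linear[OF M'(1)[OF x0]]] by metis
      have "((\<lambda>x. norm (M x - M x0 - M' x0 (x - x0)) / norm (x - x0)) \<longlongrightarrow> 0) (at x0)"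
        using M'(1)[OF x0] by (simp add: has_derivative_iff_norm)
      then have "((\<lambda>x. (norm (M x - M x0 - M' x0 (x - x0)) / norm (x - x0) + B) * norm (y x - y x0) * K) \<longlongrightarrow>
          (0 + B) * norm (y x0 - y x0) * K) (at x0)"
        by (intro tendsto_intros yc)
      then have l: "((\<lambda>x. (norm (M x - M x0 - M' x0 (x - x0)) / norm (x - x0) + B) * norm (y x - y x0) * K) \<longlongrightarrow> 0) (at x0)"
        by simp
      have "((\<lambda>x. norm ((M x - M x0) *v (y x - y x0)) / norm (x - x0)) \<longlongrightarrow> 0) (at x0)"
      proof (rule Lim_null_comparison[OF _ l])
        show "\<forall>\<^sub>F x in at x0. norm (norm ((M x - M x0) *v (y x - y x0)) / norm (x - x0))
          \<le> (norm (M x - M x0 - M' x0 (x - x0)) / norm (x - x0) + B) * norm (y x - y x0) * K"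
          unfolding eventually_at_filter
        proof (rule always_eventually, intro allI impI)
          fix x assume x: "x \<noteq> x0" 
          have "norm (M x - M x0) \<le> norm (M x - M x0 - M' x0 (x - x0)) + norm (M' x0 (x - x0))"
            by (metis diff_add_cancel norm_triangle_ineq)
          also have "\<dots> \<le> norm (M x - M x0 - M' x0 (x - x0)) + norm (x - x0) * B" using B by auto
          also have "\<dots> = (norm (M x - M x0 - M' x0 (x - x0)) / norm (x - x0) + B) * norm (x - x0)"
            using x by (simp add: field_simps)
          finally have 1: "norm (M x - M x0) \<le> (norm (M x - M x0 - M' x0 (x - x0)) / norm (x - x0) + B) * norm (x - x0)" .
          have "norm ((M x - M x0) *v (y x - y x0)) \<le> norm (M x - M x0) * (norm (y x - y x0) * K)"
            using K(2) by (metis mult.assoc)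
          also have "\<dots> \<le> (norm (M x - M x0 - M' x0 (x - x0)) / norm (x - x0) + B) * norm (x - x0) * (norm (y x - y x0) * K)"
            by (rule mult_right_mono[OF 1]) (use K in auto)
          finally show "norm (norm ((M x - M x0) *v (y x - y x0)) / norm (x - x0))
            \<le> (norm (M x - M x0 - M' x0 (x - x0)) / norm (x - x0) + B) * norm (y x - y x0) * K"
            using x by (simp add: divide_le_eq mult_ac)
        qed
      qed
      then show ?thesis by (simp add: has_derivative_iff_norm)
    qed
    \<comment> \<open>On \<open>S\<close> this expression is \<open>y x\<close> itself; only
      \<open>M\<close> and \<open>b\<close>, whose derivatives are known, contribute first-order
      terms to it.\<close>
    have "((\<lambda>x. y x0 + ?N *v ((b x - b x0) - (M x - M x0) *v y x0 - (M x - M x0) *v (y x - y x0)))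
        has_derivative (\<lambda>v. 0 + ?N *v ((b' x0 v - 0) - ((M x0 - M x0) *v 0 + (M' x0 v - 0) *v y x0) - 0))) (at x0)"
      by (intro has_derivative_add has_derivative_const has_derivative_diff r
          bounded_linear.has_derivative[OF bl] mv.FDERIV b'(1)[OF x0] M'(1)[OF x0])
    then have d: "((\<lambda>x. y x0 + ?N *v ((b x - b x0) - (M x - M x0) *v y x0 - (M x - M x0) *v (y x - y x0)))
        has_derivative y' x0) (at x0)"
      by (simp add: y'_def[abs_def])
    have e: "y x0 + ?N *v ((b x - b x0) - (M x - M x0) *v y x0 - (M x - M x0) *v (y x - y x0)) = y x"
      if "x \<in> S" for x
    proof -
      have "(b x - b x0) - (M x - M x0) *v y x0 - (M x - M x0) *v (y x - y x0) = M x0 *v (y x - y x0)"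
        using Suc.prems(3)[OF that] Suc.prems(3)[OF x0] by (simp add: mv.diff_left mv.diff_right)
      then show ?thesis using inv[OF x0] by (simp add: matrix_vector_mul_assoc matrix_inv_left)
    qed
    show ?thesis by (rule has_derivative_transform_within_open[OF d S x0 e])
  qed
  have "Ck_on k (\<lambda>x. y' x v) S" for v
  proof (rule Suc.IH[OF Ck_on_SucD[OF Suc.prems(1)] _ y'eq])
    have "Ck_on k (\<lambda>x. M' x v *v y x) S"
      by (rule Ck_on_bilinear[OF S matrix_vector_mult_bounded_bilinear M'(2) yk])
    from Ck_on_linear[OF S bounded_linear_minus[OF bounded_linear_ident] this]
    show "Ck_on k (\<lambda>x. b' x v - M' x v *v y x) S"
      using Ck_on_add[OF S b'(2)] by fastforce
  qed
  with yd show ?case unfolding Ck_on_Suc_iff[OF assms(1)] by blast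
qed

text \<open>The mean value theorem is used twice on a parallelogram: along \<open>v\<close> for the
  increment of \<open>f\<close> in the direction \<open>w\<close>, then along \<open>w\<close> for
  the derivative in the direction \<open>v\<close>.\<close>

lemma second_difference_mvt:
  fixes f :: "'a::real_normed_vector \<Rightarrow> real"
  assumes h: "h > 0" and S: "\<And>s t. 0 \<le> s \<Longrightarrow> s \<le> h \<Longrightarrow> 0 \<le> t \<Longrightarrow> t \<le> h \<Longrightarrow> x + s *\<^sub>R v + t *\<^sub>R w \<in> S"
    and f: "\<And>y. y \<in> S \<Longrightarrow> (f has_derivative D y) (at y)"
    and Dv: "\<And>y. y \<in> S \<Longrightarrow> ((\<lambda>y. D y v) has_derivative Dv y) (at y)"
  obtains s t where "0 < s" "s < h" "0 < t" "t < h"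
    "f (x + h *\<^sub>R v + h *\<^sub>R w) - f (x + h *\<^sub>R v) - f (x + h *\<^sub>R w) + f x = h * h * Dv (x + s *\<^sub>R v + t *\<^sub>R w) w"
proof -
  have line: "((\<lambda>s. k (p + s *\<^sub>R u)) has_real_derivative k' u) (at s)"
    if "(k has_derivative k') (at (p + s *\<^sub>R u))" for k :: "'a \<Rightarrow> real" and k' p u s
  proof -
    have g: "((\<lambda>s. p + s *\<^sub>R u) has_derivative (\<lambda>r. r *\<^sub>R u)) (at s)"
      by (auto intro!: derivative_eq_intros)
    have "((\<lambda>s. k (p + s *\<^sub>R u)) has_derivative (\<lambda>r. k' (r *\<^sub>R u))) (at s)"
      using has_derivative_compose[OF g that] by simp
    moreover have "k' (r *\<^sub>R u) = k' u * r" for r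
      using linear_cmul[OF has_derivative_linear[OF that]] by simp
    ultimately show ?thesis by (simp add: has_field_derivative_def)
  qed
  have S0: "x + s *\<^sub>R v \<in> S" if "0 \<le> s" "s \<le> h" for s
    using S[OF that, of 0] h by simp
  have "((\<lambda>s. f ((x + h *\<^sub>R w) + s *\<^sub>R v) - f (x + s *\<^sub>R v)) has_real_derivative
      D ((x + h *\<^sub>R w) + s *\<^sub>R v) v - D (x + s *\<^sub>R v) v) (at s)" if "0 \<le> s" "s \<le> h" for s
    using S[OF that, of h] S0[OF that] h
    by (intro DERIV_diff line f) (auto simp: algebra_simps)
  from MVT2[OF h this] obtain s where s: "0 < s" "s < h"
    "f ((x + h *\<^sub>R w) + h *\<^sub>R v) - f (x + h *\<^sub>R v) - (f (x + h *\<^sub>R w) - f x)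
       = h * (D ((x + h *\<^sub>R w) + s *\<^sub>R v) v - D (x + s *\<^sub>R v) v)"
    by auto
  have "((\<lambda>t. D ((x + s *\<^sub>R v) + t *\<^sub>R w) v) has_real_derivative
      Dv ((x + s *\<^sub>R v) + t *\<^sub>R w) w) (at t)" if "0 \<le> t" "t \<le> h" for t
    by (intro line[of "\<lambda>y. D y v"] Dv S) (use s that in auto)
  from MVT2[OF h this] obtain t where t: "0 < t" "t < h"
    "D ((x + s *\<^sub>R v) + h *\<^sub>R w) v - D (x + s *\<^sub>R v) v = h * Dv ((x + s *\<^sub>R v) + t *\<^sub>R w) w"
    by auto
  show ?thesis
    by (rule that[OF s(1,2) t(1,2)]) (use s(3) t(3) in \<open>simp add: algebra_simps\<close>)
qed

text \<open>Schwarz's theorem. The second difference does not change when \<open>v\<close> and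
  \<open>w\<close> are exchanged, so one mixed derivative at some point near \<open>x\<close> equals
  the other at another such point; continuity carries this over to \<open>x\<close>.\<close>

lemma mixed_derivatives_commute_real:
  fixes f :: "'a::real_normed_vector \<Rightarrow> real"
  assumes S: "open S" "x \<in> S"
    and f: "\<And>y. y \<in> S \<Longrightarrow> (f has_derivative D y) (at y)"
    and Dv: "\<And>y. y \<in> S \<Longrightarrow> ((\<lambda>y. D y v) has_derivative Dv y) (at y)"
    and Dw: "\<And>y. y \<in> S \<Longrightarrow> ((\<lambda>y. D y w) has_derivative Dw y) (at y)"
    and cv: "continuous_on S (\<lambda>y. Dv y w)" and cw: "continuous_on S (\<lambda>y. Dw y v)"
  shows "Dv x w = Dw x v"
proof (rule ccontr)
  assume "Dv x w \<noteq> Dw x v"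
  define e where "e = dist (Dv x w) (Dw x v) / 2"
  have e: "e > 0" using \<open>Dv x w \<noteq> Dw x v\<close> by (simp add: e_def)
  obtain d0 where d0: "d0 > 0" "ball x d0 \<subseteq> S" using S open_contains_ball by blast
  obtain d1 where d1: "d1 > 0" "\<And>y. y \<in> S \<Longrightarrow> dist y x < d1 \<Longrightarrow> dist (Dv y w) (Dv x w) < e"
    using cv S(2) e unfolding continuous_on_iff by metis
  obtain d2 where d2: "d2 > 0" "\<And>y. y \<in> S \<Longrightarrow> dist y x < d2 \<Longrightarrow> dist (Dw y v) (Dw x v) < e"
    using cw S(2) e unfolding continuous_on_iff by metis
  define d where "d = min d0 (min d1 d2)"
  \<comment> \<open>The parallelogram with sides \<open>h *\<^sub>R v\<close> and
    \<open>h *\<^sub>R w\<close> stays within distance \<open>d\<close> of \<open>x\<close>; the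
    summand 1 makes the estimate strict and covers \<open>v = w = 0\<close>.\<close>
  define h where "h = d / (norm v + norm w + 1)"
  have d: "d > 0" using d0 d1 d2 by (simp add: d_def)
  have h: "h > 0" using d by (simp add: h_def add_nonneg_pos)
  \<comment> \<open>Only the sum of the norms of \<open>a\<close> and \<open>b\<close> is
    prescribed, so this serves \<open>v, w\<close> and \<open>w, v\<close> alike.\<close>
  have near: "dist (x + s *\<^sub>R a + t *\<^sub>R b) x < d"
    if "0 \<le> s" "s \<le> h" "0 \<le> t" "t \<le> h" "norm a + norm b = norm v + norm w" for s t a b
  proof -
    have "dist (x + s *\<^sub>R a + t *\<^sub>R b) x \<le> norm (s *\<^sub>R a) + norm (t *\<^sub>R b)"
      using norm_triangle_ineq[of "s *\<^sub>R a" "t *\<^sub>R b"] by (simp add: dist_norm add.assoc)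
    also have "\<dots> \<le> h * norm a + h * norm b"
      using that by (auto intro!: add_mono mult_right_mono)
    also have "\<dots> = h * (norm v + norm w)" using that(5) by (simp add: distrib_left[symmetric])
    also have "\<dots> < h * (norm v + norm w + 1)" using h by simp
    also have "\<dots> = d" unfolding h_def using norm_ge_zero[of v] norm_ge_zero[of w]
      by (simp add: add_nonneg_eq_0_iff)
    finally show ?thesis .
  qed
  have inS: "x + s *\<^sub>R a + t *\<^sub>R b \<in> S"
    if "0 \<le> s" "s \<le> h" "0 \<le> t" "t \<le> h" "norm a + norm b = norm v + norm w" for s t a b
    using near[OF that] d0(2) by (auto simp: d_def dist_commute)
  obtain s t where st: "0 < s" "s < h" "0 < t" "t < h"
    "f (x + h *\<^sub>R v + h *\<^sub>R w) - f (x + h *\<^sub>R v) - f (x + h *\<^sub>R w) + f x = h * h * Dv (x + s *\<^sub>R v + t *\<^sub>R w) w"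
    by (rule second_difference_mvt[OF h inS f Dv]) auto
  obtain s' t' where st': "0 < s'" "s' < h" "0 < t'" "t' < h"
    "f (x + h *\<^sub>R w + h *\<^sub>R v) - f (x + h *\<^sub>R w) - f (x + h *\<^sub>R v) + f x = h * h * Dw (x + s' *\<^sub>R w + t' *\<^sub>R v) v"
    by (rule second_difference_mvt[OF h inS f Dw]) auto
  have "h * h * Dv (x + s *\<^sub>R v + t *\<^sub>R w) w = h * h * Dw (x + s' *\<^sub>R w + t' *\<^sub>R v) v"
    unfolding st(5)[symmetric] st'(5)[symmetric] by (simp add: algebra_simps)
  then have eq: "Dv (x + s *\<^sub>R v + t *\<^sub>R w) w = Dw (x + s' *\<^sub>R w + t' *\<^sub>R v) v"
    using h by simp
  have "dist (Dv (x + s *\<^sub>R v + t *\<^sub>R w) w) (Dv x w) < e"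
    by (rule d1(2)[OF inS]) (use near[of s t v w] st in \<open>auto simp: d_def\<close>)
  moreover have "dist (Dw (x + s' *\<^sub>R w + t' *\<^sub>R v) v) (Dw x v) < e"
    by (rule d2(2)[OF inS]) (use near[of s' t' w v] st' in \<open>auto simp: d_def add.commute\<close>)
  ultimately have "dist (Dv x w) (Dw x v) < e + e"
    unfolding eq by (metis add_strict_mono dist_commute dist_triangle2 order.strict_trans1)
  then show False by (simp add: e_def)
qed

lemma mixed_derivatives_commute:
  fixes f :: "'a::euclidean_space \<Rightarrow> 'b::euclidean_space"
  assumes f: "smooth_on f S" and S: "open S" "x \<in> S"
  shows "frechet_derivative (\<lambda>y. frechet_derivative f (at y) v) (at x) w
    = frechet_derivative (\<lambda>y. frechet_derivative f (at y) w) (at x) v"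
proof (rule euclidean_eqI)
  fix i :: 'b assume "i \<in> Basis"
  let ?D2 = "\<lambda>v y. frechet_derivative (\<lambda>y. frechet_derivative f (at y) v) (at y)"
  have sm: "smooth_on (\<lambda>y. frechet_derivative f (at y) v) S" for v
    by (rule smooth_on_frechet[OF f])
  have d1: "((\<lambda>y. f y \<bullet> i) has_derivative (\<lambda>u. frechet_derivative f (at y) u \<bullet> i)) (at y)" if "y \<in> S" for y
    by (intro has_derivative_inner_left smooth_onD[OF f S(1) that])
  have d2: "((\<lambda>y. frechet_derivative f (at y) v \<bullet> i) has_derivative (\<lambda>u. ?D2 v y u \<bullet> i)) (at y)" if "y \<in> S" for v y
    by (intro has_derivative_inner_left smooth_onD[OF sm S(1) that])
  have c: "continuous_on S (\<lambda>y. ?D2 v y w \<bullet> i)" for v w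
    by (intro continuous_intros smooth_on_continuous smooth_on_frechet f)
  show "?D2 v x w \<bullet> i = ?D2 w x v \<bullet> i"
    by (rule mixed_derivatives_commute_real[OF S d1 d2 d2 c c])
qed

text \<open>Expanding \<open>y\<close> in a basis reduces joint statements about \<open>f s (y s)\<close>, with \<open>f s\<close> linear, to
  statements about \<open>s \<mapsto> f s e\<close> for fixed \<open>e\<close>.\<close>

lemma linear_basis_expansion:
  fixes f :: "'a::euclidean_space \<Rightarrow> 'b::real_vector"
  assumes "linear f"
  shows "f y = (\<Sum>e\<in>Basis. (y \<bullet> e) *\<^sub>R f e)"
proof -
  have "f y = f (\<Sum>e\<in>Basis. (y \<bullet> e) *\<^sub>R e)" by (simp add: euclidean_representation)
  also have "\<dots> = (\<Sum>e\<in>Basis. (y \<bullet> e) *\<^sub>R f e)"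
    by (simp add: linear_sum[OF assms] linear_cmul[OF assms])
  finally show ?thesis .
qed

lemma continuous_on_linear_family:
  fixes f :: "'t::topological_space \<Rightarrow> 'a::euclidean_space \<Rightarrow> 'b::real_normed_vector"
  assumes "\<And>s. s \<in> S \<Longrightarrow> linear (f s)" "\<And>v. continuous_on S (\<lambda>s. f s v)" "continuous_on S y"
  shows "continuous_on S (\<lambda>s. f s (y s))"
proof -
  have "continuous_on S (\<lambda>s. \<Sum>e\<in>Basis. (y s \<bullet> e) *\<^sub>R f s e)"
    by (intro continuous_intros assms)
  then show ?thesis
    by (rule continuous_on_eq) (simp add: linear_basis_expansion[OF assms(1), symmetric])
qed

lemma has_derivative_linear_family:
  fixes f :: "'t::real_normed_vector \<Rightarrow> 'a::euclidean_space \<Rightarrow> 'b::real_normed_vector"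
  assumes lin: "\<forall>\<^sub>F s in at t within S. linear (f s)" "linear (f t)" and t: "t \<in> S"
    and f: "\<And>v. ((\<lambda>s. f s v) has_derivative (\<lambda>h. f' h v)) (at t within S)"
    and y: "(y has_derivative y') (at t within S)"
    and lin': "\<And>h. linear (f' h)"
  shows "((\<lambda>s. f s (y s)) has_derivative (\<lambda>h. f' h (y t) + f t (y' h))) (at t within S)"
proof -
  have "((\<lambda>s. \<Sum>e\<in>Basis. (y s \<bullet> e) *\<^sub>R f s e) has_derivative
      (\<lambda>h. \<Sum>e\<in>Basis. (y t \<bullet> e) *\<^sub>R f' h e + (y' h \<bullet> e) *\<^sub>R f t e)) (at t within S)"
    by (intro has_derivative_sum has_derivative_scaleR f has_derivative_inner_left y)
  then have "((\<lambda>s. \<Sum>e\<in>Basis. (y s \<bullet> e) *\<^sub>R f s e) has_derivative (\<lambda>h. f' h (y t) + f t (y' h))) (at t within S)"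
    by (simp add: linear_basis_expansion[OF lin(2), symmetric] linear_basis_expansion[OF lin', symmetric] sum.distrib)
  moreover have "\<forall>\<^sub>F s in at t within S. (\<Sum>e\<in>Basis. (y s \<bullet> e) *\<^sub>R f s e) = f s (y s)"
    using lin(1) by eventually_elim (simp add: linear_basis_expansion[symmetric])
  ultimately show ?thesis
    by (rule has_derivative_transform_eventually) (use t linear_basis_expansion[OF lin(2), of "y t"] in auto)
qed

section \<open>The Levi-Civita connection in charts\<close>

lemma
  assumes "open S"
  shows smooth_on_const: "smooth_on (\<lambda>x. c) S"
    and smooth_on_minus: "smooth_on f S \<Longrightarrow> smooth_on (\<lambda>x. - f x) S"
    and smooth_on_scale: "smooth_on f S \<Longrightarrow> smooth_on (\<lambda>x. r *\<^sub>R f x) S"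
  using assms unfolding smooth_on_def
  by (auto intro: Ck_on_const Ck_on_linear[OF _ bounded_linear_minus[OF bounded_linear_ident]]
      Ck_on_linear[OF _ bounded_linear_scaleR_right])

lemma smooth_on_sum:
  assumes "open S" "finite I" "\<And>i. i \<in> I \<Longrightarrow> smooth_on (f i) S"
  shows "smooth_on (\<lambda>x. \<Sum>i\<in>I. f i x) S"
  using assms(2,3) by (induction I) (auto intro!: smooth_on_add smooth_on_const assms(1))

lemma smooth_on_cong:
  assumes "open S" "\<And>x. x \<in> S \<Longrightarrow> f x = f' x" "smooth_on f S"
  shows "smooth_on f' S"
  using assms Ck_on_cong unfolding smooth_on_def by blast

lemma smooth_on_vec:
  fixes f :: "'n::finite \<Rightarrow> 'a::euclidean_space \<Rightarrow> real"
  assumes "open S" "\<And>l. smooth_on (f l) S"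
  shows "smooth_on (\<lambda>x. \<chi> l. f l x) S"
proof (rule smooth_on_cong[OF assms(1)])
  show "smooth_on (\<lambda>x. \<Sum>l\<in>UNIV. f l x *\<^sub>R axis l (1::real)) S"
    by (rule smooth_on_sum[OF assms(1) finite smooth_on_linear[OF assms(1) bounded_linear_scaleR_left assms(2)]])
  show "(\<Sum>l\<in>UNIV. f l x *\<^sub>R axis l (1::real)) = (\<chi> l. f l x)" for x
    by (simp add: vec_eq_iff axis_def if_distrib sum.delta cong: if_cong)
qed

lemma has_derivative_form:
  fixes M :: "'a::real_normed_vector \<Rightarrow> real^'n^'m"
  assumes "(M has_derivative M') (at x within S)" "(p has_derivative p') (at x within S)"
    "(q has_derivative q') (at x within S)"
  shows "((\<lambda>y. p y \<bullet> (M y *v q y)) has_derivative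
    (\<lambda>w. p' w \<bullet> (M x *v q x) + p x \<bullet> (M' w *v q x) + p x \<bullet> (M x *v q' w))) (at x within S)"
  by (rule has_derivative_eq_rhs[OF has_derivative_inner[OF assms(2)
        bounded_bilinear.FDERIV[OF matrix_vector_mult_bounded_bilinear assms(1,3)]]])
    (simp add: inner_add_right algebra_simps)

locale semi_riemannian_manifold =
  fixes A :: "('m::topological_space, 'n::finite) chart set" and g :: "('m, 'n) metric"
  assumes atlas: "smooth_atlas A" and metric: "semi_riemannian A g"
begin

abbreviation img :: "('m, 'n) chart \<Rightarrow> (real^'n) set" where
  "img c \<equiv> snd c ` fst c"

lemma chart: "c \<in> A \<Longrightarrow> is_chart c"
  using atlas by (auto simp: smooth_atlas_def)

lemma open_dom: "c \<in> A \<Longrightarrow> open (fst c)"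
  and open_img: "c \<in> A \<Longrightarrow> open (img c)"
  and chart_homeo: "c \<in> A \<Longrightarrow> homeomorphism (fst c) (img c) (snd c) (chart_inv c)"
  using chart by (auto simp: is_chart_def)

lemma chart_inv_chart: "c \<in> A \<Longrightarrow> p \<in> fst c \<Longrightarrow> chart_inv c (snd c p) = p"
  using chart_homeo homeomorphism_apply1 by blast

lemma transition_chart: "c \<in> A \<Longrightarrow> p \<in> fst c \<Longrightarrow> transition c d (snd c p) = snd d p"
  by (simp add: transition_def chart_inv_chart)

lemma overlap_sub: "overlap c d \<subseteq> img c"
  by (auto simp: overlap_def)

lemma overlap_mem: "c \<in> A \<Longrightarrow> x \<in> overlap c d \<Longrightarrow> transition c d x \<in> img d"
  by (auto simp: overlap_def transition_chart)

lemma overlap_memI: "p \<in> fst c \<Longrightarrow> p \<in> fst d \<Longrightarrow> snd c p \<in> overlap c d"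
  by (auto simp: overlap_def)

lemma open_overlap:
  assumes "c \<in> A" "d \<in> A"
  shows "open (overlap c d)"
proof -
  have "openin (top_of_set (fst c)) (fst c \<inter> fst d)"
    using open_dom[OF assms(1)] open_dom[OF assms(2)] by (simp add: openin_open_eq open_Int)
  then have "openin (top_of_set (img c)) (overlap c d)"
    unfolding overlap_def using homeomorphism_imp_open_map[OF chart_homeo[OF assms(1)]] by simp
  then show ?thesis using open_img[OF assms(1)] openin_open_trans by blast
qed

lemma transition_smooth: "c \<in> A \<Longrightarrow> d \<in> A \<Longrightarrow> smooth_on (transition c d) (overlap c d)"
  using atlas by (auto simp: smooth_atlas_def)

lemma g_smooth: "c \<in> A \<Longrightarrow> smooth_on (g c) (img c)"
  using metric by (auto simp: semi_riemannian_def)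

lemma g_sym: "c \<in> A \<Longrightarrow> x \<in> img c \<Longrightarrow> gform g c x u v = gform g c x v u"
  using metric unfolding semi_riemannian_def by blast

lemma g_nondeg: "c \<in> A \<Longrightarrow> x \<in> img c \<Longrightarrow> (\<And>v. gform g c x u v = 0) \<Longrightarrow> u = 0"
  using metric unfolding semi_riemannian_def by blast

lemma g_eqI:
  assumes "c \<in> A" "x \<in> img c" "\<And>w. gform g c x u w = gform g c x v w"
  shows "u = v"
  using g_nondeg[OF assms(1,2), of "u - v"] assms(3) by (simp add: gform_def inner_diff_left)

lemma g_trans: "c \<in> A \<Longrightarrow> d \<in> A \<Longrightarrow> x \<in> overlap c d \<Longrightarrow>
    gform g c x u v = gform g d (transition c d x)
      (frechet_derivative (transition c d) (at x) u) (frechet_derivative (transition c d) (at x) v)"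
  using metric unfolding semi_riemannian_def by blast

lemma g_invertible:
  assumes "c \<in> A" "x \<in> img c"
  shows "invertible (g c x)"
proof -
  have "g c x *v u = 0 \<Longrightarrow> u = 0" for u
    by (rule g_nondeg[OF assms]) (metis g_sym[OF assms] gform_def inner_zero_right)
  then have "inj ((*v) (g c x))" using linear_injective_0[of "(*v) (g c x)"] by auto
  then show ?thesis using invertible_left_inverse matrix_left_invertible_injective by blast
qed

lemma gform_linear:
  "linear (\<lambda>u. gform g c x u v)" "linear (\<lambda>v. gform g c x u v)"
  by (auto simp: gform_def linear_iff inner_add_left inner_add_right matrix_vector_right_distrib
      matrix_vector_mult_scaleR)

lemmas gform_simps =
  linear_add[OF gform_linear(1)] linear_add[OF gform_linear(2)]
  linear_diff[OF gform_linear(1)] linear_diff[OF gform_linear(2)]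
  linear_cmul[OF gform_linear(1)] linear_cmul[OF gform_linear(2)]
  linear_neg[OF gform_linear(1)] linear_neg[OF gform_linear(2)]

lemma g_has_derivative:
  "c \<in> A \<Longrightarrow> x \<in> img c \<Longrightarrow> (g c has_derivative frechet_derivative (g c) (at x)) (at x)"
  by (rule smooth_onD[OF g_smooth open_img])

lemma dgform_eq:
  assumes "c \<in> A" "x \<in> img c"
  shows "dgform g c x w u v = u \<bullet> (frechet_derivative (g c) (at x) w *v v)"
proof -
  have "((\<lambda>y. gform g c y u v) has_derivative (\<lambda>w. u \<bullet> (frechet_derivative (g c) (at x) w *v v))) (at x)"
    unfolding gform_def
    by (rule has_derivative_eq_rhs[OF has_derivative_form[OF g_has_derivative[OF assms]
            has_derivative_const has_derivative_const]]) simp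
  then show ?thesis unfolding dgform_def by (metis frechet_derivative_at)
qed

lemma gform_has_derivative:
  assumes c: "c \<in> A" "y x \<in> img c" and y: "(y has_derivative y') (at x within S)"
    and p: "(p has_derivative p') (at x within S)" and q: "(q has_derivative q') (at x within S)"
  shows "((\<lambda>s. gform g c (y s) (p s) (q s)) has_derivative
    (\<lambda>w. dgform g c (y x) (y' w) (p x) (q x) + gform g c (y x) (p' w) (q x) + gform g c (y x) (p x) (q' w)))
     (at x within S)"
proof -
  have "((\<lambda>s. g c (y s)) has_derivative (\<lambda>w. frechet_derivative (g c) (at (y x)) (y' w))) (at x within S)"
    by (rule has_derivative_compose[OF y g_has_derivative[OF c]])
  then show ?thesis
    unfolding gform_def dgform_eq[OF c]
    by (rule has_derivative_eq_rhs[OF has_derivative_form[OF _ p q]]) auto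
qed

lemma dgform_linear:
  assumes "c \<in> A" "x \<in> img c"
  shows "linear (\<lambda>w. dgform g c x w u v)" "linear (\<lambda>u. dgform g c x w u v)" "linear (\<lambda>v. dgform g c x w u v)"
proof -
  have l: "linear (frechet_derivative (g c) (at x))"
    using g_has_derivative[OF assms] has_derivative_linear by blast
  show "linear (\<lambda>w. dgform g c x w u v)" "linear (\<lambda>u. dgform g c x w u v)" "linear (\<lambda>v. dgform g c x w u v)"
    unfolding dgform_eq[OF assms]
    by (auto simp: linear_iff inner_add_left inner_add_right matrix_vector_right_distrib
      matrix_vector_mult_scaleR matrix_vector_mult_add_rdistrib linear_add[OF l] linear_cmul[OF l]
      scaleR_matrix_vector_assoc[symmetric])
qed

lemma dgform_sym:
  assumes "c \<in> A" "x \<in> img c"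
  shows "dgform g c x w u v = dgform g c x w v u"
proof -
  have d: "((\<lambda>y. gform g c y u v) has_derivative (\<lambda>w. dgform g c x w u v)) (at x)" for u v
    by (rule has_derivative_eq_rhs[OF gform_has_derivative[where y="\<lambda>y. y",
      OF assms has_derivative_ident has_derivative_const has_derivative_const]])
     (simp add: linear_0[OF gform_linear(1)] linear_0[OF gform_linear(2)])
  have "((\<lambda>y. gform g c y u v) has_derivative (\<lambda>w. dgform g c x w v u)) (at x)"
    by (rule has_derivative_transform_within_open[OF d open_img[OF assms(1)] assms(2)])
      (rule g_sym[OF assms(1)])
  from has_derivative_unique[OF d this] show ?thesis by metis
qed

text \<open>The shape that \<open>Ck_on_solve\<close> expects: smoothness of the symbols and the
  Koszul formula are drawn from this equation, not from the inverse matrix.\<close>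

lemma christoffel_solve:
  assumes "c \<in> A" "x \<in> img c"
  shows "g c x *v christoffel g c x u v =
    (\<chi> l. (dgform g c x u v (axis l 1) + dgform g c x v u (axis l 1) - dgform g c x (axis l 1) u v) / 2)"
  unfolding christoffel_def
  by (simp add: matrix_vector_mul_assoc matrix_inv_right[OF g_invertible[OF assms]])

text \<open>\<open>christoffel_solve\<close> is this formula for coordinate vectors
  \<open>w\<close>, and both sides are linear in \<open>w\<close>. Together with nondegeneracy it
  serves as the working definition of the connection.\<close>

lemma koszul:
  assumes "c \<in> A" "x \<in> img c"
  shows "gform g c x (christoffel g c x u v) w =
    (dgform g c x u v w + dgform g c x v u w - dgform g c x w u v) / 2"
proof -
  have l: "linear (\<lambda>w. (dgform g c x u v w + dgform g c x v u w - dgform g c x w u v) / 2)"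
    using linear_add[OF dgform_linear(1)[OF assms]] linear_add[OF dgform_linear(3)[OF assms]]
      linear_cmul[OF dgform_linear(1)[OF assms]] linear_cmul[OF dgform_linear(3)[OF assms]]
    by (simp add: linear_iff field_simps)
  have w: "w = (\<Sum>l\<in>UNIV. (w $ l) *\<^sub>R axis l 1)"
    using basis_expansion[of w] by (simp add: scalar_mult_eq_scaleR)
  have "gform g c x (christoffel g c x u v) w = w \<bullet> (g c x *v christoffel g c x u v)"
    using g_sym[OF assms] by (simp add: gform_def)
  also have "\<dots> = (\<Sum>l\<in>UNIV. (w $ l) * ((dgform g c x u v (axis l 1) + dgform g c x v u (axis l 1) - dgform g c x (axis l 1) u v) / 2))"
    unfolding christoffel_solve[OF assms] by (simp add: inner_vec_def)
  also have "\<dots> = (dgform g c x u v w + dgform g c x v u w - dgform g c x w u v) / 2"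
    using linear_sum[OF l, of "\<lambda>l. (w $ l) *\<^sub>R axis l 1" UNIV] linear_cmul[OF l]
    unfolding w[symmetric] by simp
  finally show ?thesis .
qed

lemma christoffel_sym:
  assumes "c \<in> A" "x \<in> img c"
  shows "christoffel g c x u v = christoffel g c x v u"
  by (rule g_eqI[OF assms]) (simp add: koszul[OF assms] dgform_sym[OF assms, of _ u v])

lemma christoffel_linear:
  assumes "c \<in> A" "x \<in> img c"
  shows "linear (\<lambda>u. christoffel g c x u v)" "linear (christoffel g c x u)"
proof -
  note d = linear_add[OF dgform_linear(1)[OF assms]] linear_add[OF dgform_linear(2)[OF assms]]
    linear_add[OF dgform_linear(3)[OF assms]] linear_cmul[OF dgform_linear(1)[OF assms]]
    linear_cmul[OF dgform_linear(2)[OF assms]] linear_cmul[OF dgform_linear(3)[OF assms]]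
  show 1: "linear (\<lambda>u. christoffel g c x u v)" for v
    by (rule linearI; rule g_eqI[OF assms]) (simp_all add: gform_simps koszul[OF assms] d field_simps)
  show "linear (christoffel g c x u)"
    using 1[of u] christoffel_sym[OF assms, of _ u] by simp
qed

lemma metric_compatible:
  assumes "c \<in> A" "x \<in> img c"
  shows "dgform g c x w u v = gform g c x (christoffel g c x w u) v + gform g c x u (christoffel g c x w v)"
  unfolding g_sym[OF assms, of u] koszul[OF assms]
  using dgform_sym[OF assms, of w u v] dgform_sym[OF assms, of u v w] dgform_sym[OF assms, of v u w]
  by (simp add: field_simps)

lemma gform_smooth:
  assumes "c \<in> A"
  shows "smooth_on (\<lambda>y. gform g c y u v) (img c)"
proof -
  have "bounded_linear (\<lambda>M::real^'n^'n. u \<bullet> (M *v v))"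
    by (intro bounded_linear_inner_right_comp
        bounded_bilinear.bounded_linear_left[OF matrix_vector_mult_bounded_bilinear])
  from smooth_on_linear[OF open_img[OF assms] this g_smooth[OF assms]] show ?thesis
    by (simp add: gform_def)
qed

lemma dgform_smooth:
  assumes "c \<in> A"
  shows "smooth_on (\<lambda>y. dgform g c y w u v) (img c)"
  unfolding dgform_def by (rule smooth_on_frechet[OF gform_smooth[OF assms]])

lemma christoffel_smooth:
  assumes c: "c \<in> A"
  shows "smooth_on (\<lambda>y. christoffel g c y u v) (img c)"
proof -
  have "smooth_on (\<lambda>y. (1/2::real) *\<^sub>R (dgform g c y u v (axis l 1) + dgform g c y v u (axis l 1) + - dgform g c y (axis l 1) u v)) (img c)" for l
    by (intro smooth_on_scale smooth_on_add smooth_on_minus dgform_smooth c open_img)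
  then have "smooth_on (\<lambda>y. (dgform g c y u v (axis l 1) + dgform g c y v u (axis l 1) - dgform g c y (axis l 1) u v) / 2) (img c)" for l
    by simp
  from smooth_on_vec[where f="\<lambda>l y. (dgform g c y u v (axis l 1) + dgform g c y v u (axis l 1) - dgform g c y (axis l 1) u v) / 2",
      OF open_img[OF c] this]
  have "Ck_on k (\<lambda>y. christoffel g c y u v) (img c)" for k
    using g_smooth[OF c] unfolding smooth_on_def
    by (intro Ck_on_solve[where M="g c", OF open_img[OF c] _ _ g_invertible[OF c] christoffel_solve[OF c]]) auto
  then show ?thesis by (simp add: smooth_on_def)
qed

lemma christoffel_has_derivative:
  assumes "c \<in> A" "x \<in> img c"
  shows "((\<lambda>y. christoffel g c y u v) has_derivative (\<lambda>w. dchristoffel g c x w u v)) (at x)"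
  unfolding dchristoffel_def by (rule smooth_onD[OF christoffel_smooth open_img]) (use assms in auto)

lemma dchristoffel_linear_dir:
  assumes "c \<in> A" "x \<in> img c"
  shows "linear (\<lambda>w. dchristoffel g c x w u v)"
  by (rule has_derivative_linear[OF christoffel_has_derivative[OF assms]])

lemma dchristoffel_smooth: "c \<in> A \<Longrightarrow> smooth_on (\<lambda>y. dchristoffel g c y w u v) (img c)"
  unfolding dchristoffel_def by (intro smooth_on_frechet christoffel_smooth)

lemma dchristoffel_sym:
  assumes "c \<in> A" "x \<in> img c"
  shows "dchristoffel g c x w u v = dchristoffel g c x w v u"
proof -
  have "((\<lambda>y. christoffel g c y u v) has_derivative (\<lambda>w. dchristoffel g c x w v u)) (at x)"
    by (rule has_derivative_transform_within_open[OF christoffel_has_derivative[OF assms]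
          open_img[OF assms(1)] assms(2)]) (rule christoffel_sym[OF assms(1)])
  from has_derivative_unique[OF christoffel_has_derivative[OF assms] this] show ?thesis by metis
qed

lemma dchristoffel_linear:
  assumes "c \<in> A" "x \<in> img c"
  shows "linear (\<lambda>u. dchristoffel g c x w u v)" "linear (dchristoffel g c x w u)"
proof -
  show *: "linear (dchristoffel g c x w u)" for u
  proof (rule linearI)
    fix v v'
    have "((\<lambda>y. christoffel g c y u (v + v')) has_derivative
        (\<lambda>w. dchristoffel g c x w u v + dchristoffel g c x w u v')) (at x)"
      by (rule has_derivative_transform_within_open[OF has_derivative_add[OF
            christoffel_has_derivative[OF assms, of u v] christoffel_has_derivative[OF assms, of u v']] open_img[OF assms(1)] assms(2)])
        (simp add: linear_add[OF christoffel_linear(2)[OF assms(1)]])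
    from has_derivative_unique[OF christoffel_has_derivative[OF assms] this]
    show "dchristoffel g c x w u (v + v') = dchristoffel g c x w u v + dchristoffel g c x w u v'" by metis
  next
    fix r v
    have "((\<lambda>y. christoffel g c y u (r *\<^sub>R v)) has_derivative
        (\<lambda>w. r *\<^sub>R dchristoffel g c x w u v)) (at x)"
      by (rule has_derivative_transform_within_open[OF has_derivative_scaleR_right[OF
            christoffel_has_derivative[OF assms, of u v]] open_img[OF assms(1)] assms(2)])
        (simp add: linear_cmul[OF christoffel_linear(2)[OF assms(1)]])
    from has_derivative_unique[OF christoffel_has_derivative[OF assms] this]
    show "dchristoffel g c x w u (r *\<^sub>R v) = r *\<^sub>R dchristoffel g c x w u v" by metis
  qed
  show "linear (\<lambda>u. dchristoffel g c x w u v)"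
    using *[of v] dchristoffel_sym[OF assms, of w _ v] by simp
qed

text \<open>The two linear arguments are inserted one after the other, each by
  \<open>has_derivative_linear_family\<close>, starting from constant vectors.\<close>

lemma christoffel_has_derivative_comp:
  assumes c: "c \<in> A" "z x \<in> img c" and x: "x \<in> S" and z: "(z has_derivative z') (at x within S)"
    and p: "(p has_derivative p') (at x within S)" and q: "(q has_derivative q') (at x within S)"
  shows "((\<lambda>s. christoffel g c (z s) (p s) (q s)) has_derivative
    (\<lambda>w. dchristoffel g c (z x) (z' w) (p x) (q x) + christoffel g c (z x) (p' w) (q x)
       + christoffel g c (z x) (p x) (q' w))) (at x within S)"
proof -
  have "(z \<longlongrightarrow> z x) (at x within S)"
    using has_derivative_continuous[OF z] by (simp add: continuous_within)
  then have ev: "\<forall>\<^sub>F s in at x within S. z s \<in> img c"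
    using topological_tendstoD open_img c by blast
  have 0: "((\<lambda>s. christoffel g c (z s) u v) has_derivative (\<lambda>w. dchristoffel g c (z x) (z' w) u v)) (at x within S)" for u v
    by (rule has_derivative_compose[OF z christoffel_has_derivative[OF c]])
  have 1: "((\<lambda>s. christoffel g c (z s) (p s) v) has_derivative
     (\<lambda>w. dchristoffel g c (z x) (z' w) (p x) v + christoffel g c (z x) (p' w) v)) (at x within S)" for v
    using ev by (intro has_derivative_linear_family[where f="\<lambda>s p. christoffel g c (z s) p v", OF _ _ x 0 p]
        christoffel_linear dchristoffel_linear c) (auto elim!: eventually_mono simp: christoffel_linear c)
  show ?thesis
    using ev by (intro has_derivative_linear_family[where f="\<lambda>s q. christoffel g c (z s) (p s) q", OF _ _ x 1 q]
        christoffel_linear dchristoffel_linear linear_compose_add c) (auto elim!: eventually_mono simp: christoffel_linear c)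
qed

subsection \<open>Symmetries of the curvature\<close>

lemma curvature_antisym: "curvature g c x v u w = - curvature g c x u v w"
  by (simp add: curvature_def)

lemma curvature_bianchi:
  assumes "c \<in> A" "x \<in> img c"
  shows "curvature g c x u v w + curvature g c x v w u + curvature g c x w u v = 0"
  using dchristoffel_sym[OF assms] christoffel_sym[OF assms]
  by (simp add: curvature_def)

text \<open>Differentiating metric compatibility expresses the second derivative of
  \<open>gform g c y u v\<close> along \<open>w\<close> and \<open>z\<close>. It is symmetric in
  \<open>w\<close> and \<open>z\<close>, and so is the sum of the terms
  \<open>?G (?C w u) (?C z v)\<close> and \<open>?G (?C z u) (?C w v)\<close>; what remains says
  that the curvature is skew-adjoint.\<close>

lemma curvature_metric_antisym:
  assumes "c \<in> A" "x \<in> img c"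
  shows "gform g c x (curvature g c x z w u) v = - gform g c x u (curvature g c x z w v)"
proof -
  let ?G = "gform g c x" and ?C = "christoffel g c x" and ?D = "dchristoffel g c x"
  have d2: "((\<lambda>y. dgform g c y w u v) has_derivative
     (\<lambda>z. ?G (?C z (?C w u)) v + ?G (?C w u) (?C z v) + ?G (?D z w u) v
        + ?G (?C z u) (?C w v) + ?G u (?C z (?C w v)) + ?G u (?D z w v))) (at x)" for w
  proof (rule has_derivative_transform_within_open[OF _ open_img[OF assms(1)] assms(2) metric_compatible[OF assms(1), symmetric]])
    show "((\<lambda>y. gform g c y (christoffel g c y w u) v + gform g c y u (christoffel g c y w v)) has_derivative
       (\<lambda>z. ?G (?C z (?C w u)) v + ?G (?C w u) (?C z v) + ?G (?D z w u) v
        + ?G (?C z u) (?C w v) + ?G u (?C z (?C w v)) + ?G u (?D z w v))) (at x)"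
      by (rule has_derivative_eq_rhs[OF has_derivative_add[OF
            gform_has_derivative[where y="\<lambda>y. y", OF assms has_derivative_ident
              christoffel_has_derivative[OF assms] has_derivative_const]
            gform_has_derivative[where y="\<lambda>y. y", OF assms has_derivative_ident
              has_derivative_const christoffel_has_derivative[OF assms]]]])
        (simp add: metric_compatible[OF assms] fun_eq_iff
          linear_0[OF gform_linear(1)] linear_0[OF gform_linear(2)])
  qed
  have fd: "frechet_derivative (\<lambda>y. gform g c y u v) (at y) w = dgform g c y w u v" for y w
    by (simp add: dgform_def)
  have "frechet_derivative (\<lambda>y. dgform g c y w u v) (at x) z = frechet_derivative (\<lambda>y. dgform g c y z u v) (at x) w"
    using mixed_derivatives_commute[OF gform_smooth[OF assms(1)] open_img[OF assms(1)] assms(2), of u v w z]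
    unfolding fd .
  then show ?thesis
    unfolding frechet_derivative_at[OF d2, symmetric] curvature_def gform_simps by simp
qed

text \<open>The case of the pair symmetry that makes the Jacobi operator self-adjoint. In the
  Bianchi identity for \<open>u\<close>, \<open>v\<close>, \<open>w\<close> paired with
  \<open>u\<close>, one term vanishes by skew-adjointness and the other two are the two sides of the
  claim up to sign.\<close>

lemma curvature_pair_sym:
  assumes "c \<in> A" "x \<in> img c"
  shows "gform g c x (curvature g c x u v u) w = gform g c x v (curvature g c x u w u)"
proof -
  define r where "r p q s t = gform g c x (curvature g c x p q s) t" for p q s t
  have 1: "r p q s t = - r q p s t" for p q s t
    unfolding r_def by (subst curvature_antisym) (simp add: gform_simps)
  have 2: "r p q s t = - r p q t s" for p q s t
    unfolding r_def using curvature_metric_antisym[OF assms, of p q s t] g_sym[OF assms] by simp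
  have 3: "r p q s t + r q s p t + r s p q t = 0" for p q s t
    unfolding r_def gform_simps(1)[symmetric] curvature_bianchi[OF assms]
    by (simp add: linear_0[OF gform_linear(1)])
  have "r u v u w = r u w u v"
    using 3[of u v w u] 2[of u v w u] 2[of v w u u] 1[of w u v u] 2[of u w v u] by linarith
  then show ?thesis unfolding r_def using g_sym[OF assms, of v] by simp
qed

subsection \<open>Change of chart\<close>

context
  fixes c d
  assumes c: "c \<in> A" and d: "d \<in> A"
begin

definition dtr where "dtr y v = frechet_derivative (transition c d) (at y) v"
definition d2tr where "d2tr y w v = frechet_derivative (\<lambda>y. dtr y v) (at y) w"

lemma transition_has_derivative: "y \<in> overlap c d \<Longrightarrow> (transition c d has_derivative dtr y) (at y)"
  unfolding dtr_def by (rule smooth_onD[OF transition_smooth[OF c d] open_overlap[OF c d]])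

lemma dtr_smooth: "smooth_on (\<lambda>y. dtr y v) (overlap c d)"
  unfolding dtr_def by (rule smooth_on_frechet[OF transition_smooth[OF c d]])

lemma dtr_has_derivative: "y \<in> overlap c d \<Longrightarrow> ((\<lambda>y. dtr y v) has_derivative (\<lambda>w. d2tr y w v)) (at y)"
  unfolding d2tr_def by (rule smooth_onD[OF dtr_smooth open_overlap[OF c d]])

lemma dtr_linear: "y \<in> overlap c d \<Longrightarrow> linear (dtr y)"
  using has_derivative_linear[OF transition_has_derivative] .

lemma d2tr_sym: "y \<in> overlap c d \<Longrightarrow> d2tr y w v = d2tr y v w"
  unfolding d2tr_def dtr_def
  by (rule mixed_derivatives_commute[OF transition_smooth[OF c d] open_overlap[OF c d]])

lemma d2tr_linear:
  assumes "y \<in> overlap c d"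
  shows "linear (\<lambda>w. d2tr y w v)" "linear (d2tr y w)"
proof -
  show "linear (\<lambda>w. d2tr y w v)" for v by (rule has_derivative_linear[OF dtr_has_derivative[OF assms]])
  from this[of w] show "linear (d2tr y w)" using d2tr_sym[OF assms, of _ w] by simp
qed

context
  fixes x
  assumes x: "x \<in> overlap c d"
begin

lemma x_img: "x \<in> img c" "transition c d x \<in> img d"
  using overlap_sub[of c d] overlap_mem[OF c x] x by blast+

lemma g_trans': "gform g c x u v = gform g d (transition c d x) (dtr x u) (dtr x v)"
  using g_trans[OF c d x] by (simp add: dtr_def)

text \<open>Injectivity comes from the metric: a map that preserves a nondegenerate form has no
  kernel. Equal dimensions then give surjectivity.\<close>

lemma dtr_bij: "bij (dtr x)"
proof -
  have "dtr x u = 0 \<Longrightarrow> u = 0" for u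
    by (rule g_nondeg[OF c x_img(1)]) (simp add: g_trans' linear_0[OF gform_linear(1)])
  then have "inj (dtr x)" using linear_injective_0[OF dtr_linear[OF x]] by auto
  then show ?thesis using linear_inj_imp_surj[OF dtr_linear[OF x]] by (simp add: bij_def)
qed

lemma dgform_trans:
  "dgform g c x w u v = dgform g d (transition c d x) (dtr x w) (dtr x u) (dtr x v)
    + gform g d (transition c d x) (d2tr x w u) (dtr x v) + gform g d (transition c d x) (dtr x u) (d2tr x w v)"
proof -
  have "((\<lambda>y. gform g d (transition c d y) (dtr y u) (dtr y v)) has_derivative
     (\<lambda>w. dgform g d (transition c d x) (dtr x w) (dtr x u) (dtr x v)
    + gform g d (transition c d x) (d2tr x w u) (dtr x v) + gform g d (transition c d x) (dtr x u) (d2tr x w v))) (at x)"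
    by (rule gform_has_derivative[OF d x_img(2) transition_has_derivative[OF x] dtr_has_derivative[OF x] dtr_has_derivative[OF x]])
  then have "((\<lambda>y. gform g c y u v) has_derivative
     (\<lambda>w. dgform g d (transition c d x) (dtr x w) (dtr x u) (dtr x v)
    + gform g d (transition c d x) (d2tr x w u) (dtr x v) + gform g d (transition c d x) (dtr x u) (d2tr x w v))) (at x)"
    by (rule has_derivative_transform_within_open[OF _ open_overlap[OF c d] x])
      (simp add: g_trans[OF c d] dtr_def)
  from fun_cong[OF frechet_derivative_at[OF this], of w] show ?thesis
    by (simp add: dgform_def[of g c])
qed

text \<open>The inhomogeneous transformation law. Both sides are tested against a vector
  \<open>dtr x w\<close> and evaluated by the Koszul formula; of the six second-derivative terms
  that \<open>dgform_trans\<close> produces four cancel by symmetry and the other two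
  coincide.\<close>

lemma christoffel_trans:
  "dtr x (christoffel g c x u v) = d2tr x u v + christoffel g d (transition c d x) (dtr x u) (dtr x v)"
proof (rule g_eqI[OF d x_img(2)])
  fix z obtain w where w: "z = dtr x w" using dtr_bij by (metis bij_pointE)
  let ?G = "gform g d (transition c d x)"
  have s: "?G a b = ?G b a" for a b by (rule g_sym[OF d x_img(2)])
  have "?G (dtr x (christoffel g c x u v)) z = (dgform g c x u v w + dgform g c x v u w - dgform g c x w u v) / 2"
    unfolding w g_trans'[symmetric] by (rule koszul[OF c x_img(1)])
  also have "\<dots> = ?G (d2tr x u v + christoffel g d (transition c d x) (dtr x u) (dtr x v)) z"
    unfolding dgform_trans gform_simps koszul[OF d x_img(2)] w
    using d2tr_sym[OF x, of u v] d2tr_sym[OF x, of u w] d2tr_sym[OF x, of v w]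
      s[of "dtr x u" "d2tr x w v"] s[of "dtr x v" "d2tr x w u"]
    by (simp add: field_simps)
  finally show "?G (dtr x (christoffel g c x u v)) z = ?G (d2tr x u v + christoffel g d (transition c d x) (dtr x u) (dtr x v)) z" .
qed

end

text \<open>Differentiating the transformation law of the Christoffel symbols, all terms except those of
  the curvature are symmetric in the two arguments that get antisymmetrized.\<close>

lemma curvature_trans:
  assumes x: "x \<in> overlap c d"
  shows "dtr x (curvature g c x u v w) = curvature g d (transition c d x) (dtr x u) (dtr x v) (dtr x w)"
proof -
  let ?y = "transition c d x"
  let ?C = "christoffel g c x" and ?D = "dchristoffel g c x"
  let ?C' = "christoffel g d ?y" and ?D' = "dchristoffel g d ?y"
  define d3 where "d3 z v w = frechet_derivative (\<lambda>y. d2tr y v w) (at x) z" for z v w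
  have d3: "((\<lambda>y. d2tr y v w) has_derivative (\<lambda>z. d3 z v w)) (at x)" for v w
    unfolding d3_def d2tr_def
    by (rule smooth_onD[OF smooth_on_frechet[OF dtr_smooth] open_overlap[OF c d] x])
  have d3_sym: "d3 z v w = d3 v z w" for z v w
    unfolding d3_def d2tr_def by (rule mixed_derivatives_commute[OF dtr_smooth open_overlap[OF c d] x])
  have l: "linear (dtr x)" by (rule dtr_linear[OF x])
  have key: "d2tr x z (?C v w) + dtr x (?D z v w) = d3 z v w + ?D' (dtr x z) (dtr x v) (dtr x w)
      + ?C' (d2tr x z v) (dtr x w) + ?C' (dtr x v) (d2tr x z w)" for z v w
  proof -
    have L: "((\<lambda>y. dtr y (christoffel g c y v w)) has_derivative
        (\<lambda>z. d2tr x z (?C v w) + dtr x (?D z v w))) (at x)"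
      by (intro has_derivative_linear_family[OF _ _ UNIV_I dtr_has_derivative[OF x]
            christoffel_has_derivative[OF c x_img(1)[OF x]]] d2tr_linear x l
            eventually_mono[OF eventually_at_in_open'[OF open_overlap[OF c d] x] dtr_linear])
    have R: "((\<lambda>y. d2tr y v w + christoffel g d (transition c d y) (dtr y v) (dtr y w)) has_derivative
        (\<lambda>z. d3 z v w + (?D' (dtr x z) (dtr x v) (dtr x w)
      + ?C' (d2tr x z v) (dtr x w) + ?C' (dtr x v) (d2tr x z w)))) (at x)"
      by (intro has_derivative_add d3 christoffel_has_derivative_comp[where z="transition c d", OF d x_img(2)[OF x] UNIV_I]
          transition_has_derivative dtr_has_derivative x)
    have "((\<lambda>y. dtr y (christoffel g c y v w)) has_derivative
        (\<lambda>z. d3 z v w + (?D' (dtr x z) (dtr x v) (dtr x w)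
      + ?C' (d2tr x z v) (dtr x w) + ?C' (dtr x v) (d2tr x z w)))) (at x)"
      by (rule has_derivative_transform_within_open[OF R open_overlap[OF c d] x])
        (simp add: christoffel_trans)
    from fun_cong[OF has_derivative_unique[OF L this], of z] show ?thesis by (simp add: add.assoc)
  qed
  note lC = christoffel_linear[OF d x_img(2)[OF x]]
  have D: "dtr x (?D z v w) = d3 z v w + ?D' (dtr x z) (dtr x v) (dtr x w)
      + ?C' (d2tr x z v) (dtr x w) + ?C' (dtr x v) (d2tr x z w) - d2tr x z (?C v w)" for z v w
    using key[of z v w] by (simp add: algebra_simps)
  have CC: "dtr x (?C z (?C v w)) = d2tr x z (?C v w) + ?C' (dtr x z) (d2tr x v w)
      + ?C' (dtr x z) (?C' (dtr x v) (dtr x w))" for z v w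
    by (simp add: christoffel_trans[OF x] linear_add[OF lC(2)])
  show ?thesis
    unfolding curvature_def linear_add[OF l] linear_diff[OF l] D CC
    using d3_sym[of u v w] d2tr_sym[OF x, of u v] by simp
qed

end

end

section \<open>Linear differential equations and gluing of local solutions\<close>

text \<open>Picard's fixed point argument: as \<open>K * (q - p) \<le> 1/3\<close>, the integral
  operator contracts the bounded continuous functions with factor \<open>1/3\<close>.\<close>

lemma linear_ode_short_interval:
  fixes G :: "real \<Rightarrow> 'v::euclidean_space \<Rightarrow> 'v"
  assumes pq: "p \<le> q" and lin: "\<And>t. t \<in> {p..q} \<Longrightarrow> linear (G t)"
    and cont: "\<And>v. continuous_on {p..q} (\<lambda>t. G t v)"
    and K: "\<And>t v. t \<in> {p..q} \<Longrightarrow> norm (G t v) \<le> K * norm v" "K \<ge> 0" "K * (q - p) \<le> 1/3"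
  shows "\<exists>y. y p = y0 \<and> (\<forall>t\<in>{p..q}. (y has_vector_derivative G t (y t)) (at t within {p..q}))"
proof -
  \<comment> \<open>\<open>bcontfun\<close> consists of functions on the whole line, so the upper
    limit of integration is clamped to the interval.\<close>
  define cl where "cl t = max p (min q t)" for t
  have cl: "cl t \<in> {p..q}" "t \<in> {p..q} \<Longrightarrow> cl t = t" for t using pq by (auto simp: cl_def)
  have ccl: "continuous_on UNIV cl" unfolding cl_def[abs_def] by (intro continuous_intros)
  have cG: "continuous_on {p..q} (\<lambda>s. G s (apply_bcontfun f s))" for f
    by (rule continuous_on_linear_family[where f=G, OF lin cont]) auto
  then have iG: "(\<lambda>s. G s (apply_bcontfun f s)) integrable_on {p..t}" if "t \<in> {p..q}" for f t
    using that by (intro integrable_continuous_real continuous_on_subset[OF cG]) auto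
  define L where "L f t = y0 + integral {p..cl t} (\<lambda>s. G s (apply_bcontfun f s))" for f t
  have Lc: "continuous_on UNIV (L f)" for f
    unfolding L_def
    by (intro continuous_intros continuous_on_compose2[OF indefinite_integral_continuous_1 ccl])
      (use iG[of q f] pq cl in auto)
  have Lb: "norm (L f t) \<le> norm y0 + K * norm f * (q - p)" for f t
  proof -
    have "norm (integral {p..cl t} (\<lambda>s. G s (apply_bcontfun f s))) \<le> K * norm f * (cl t - p)"
    proof (rule integral_bound)
      show "p \<le> cl t" using cl by auto
      show "continuous_on {p..cl t} (\<lambda>s. G s (apply_bcontfun f s))"
        using cl[of t] by (intro continuous_on_subset[OF cG]) auto
      fix s assume "s \<in> {p..cl t}"
      then have "s \<in> {p..q}" using cl[of t] by auto
      from K(1)[OF this] have "norm (G s (apply_bcontfun f s)) \<le> K * norm (apply_bcontfun f s)" .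
      also have "\<dots> \<le> K * norm f" by (intro mult_left_mono norm_bounded K(2))
      finally show "norm (G s (apply_bcontfun f s)) \<le> K * norm f" .
    qed
    also have "\<dots> \<le> K * norm f * (q - p)" using cl[of t] K(2) by (intro mult_left_mono) auto
    finally show ?thesis unfolding L_def
      using norm_triangle_ineq[of y0 "integral {p..cl t} (\<lambda>s. G s (apply_bcontfun f s))"] by linarith
  qed
  define \<Lambda> where "\<Lambda> f = Bcontfun (L f)" for f
  have \<Lambda>: "apply_bcontfun (\<Lambda> f) = L f" for f
    unfolding \<Lambda>_def by (intro Bcontfun_inverse bcontfun_normI[OF Lc Lb])
  have "\<forall>f h. dist (\<Lambda> f) (\<Lambda> h) \<le> (1/3) * dist f h"
  proof (intro allI dist_bound)
    fix f h t
    have "L f t - L h t = integral {p..cl t} (\<lambda>s. G s (apply_bcontfun f s - apply_bcontfun h s))"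
    proof -
      have "L f t - L h t = integral {p..cl t} (\<lambda>s. G s (apply_bcontfun f s) - G s (apply_bcontfun h s))"
        unfolding L_def by (subst integral_diff[OF iG iG]) (use cl in auto)
      also have "\<dots> = integral {p..cl t} (\<lambda>s. G s (apply_bcontfun f s - apply_bcontfun h s))"
        using cl[of t] by (intro integral_cong) (simp add: linear_diff[OF lin])
      finally show ?thesis .
    qed
    also have "norm \<dots> \<le> K * dist f h * (cl t - p)"
    proof (rule integral_bound)
      show "p \<le> cl t" using cl by auto
      show "continuous_on {p..cl t} (\<lambda>s. G s (apply_bcontfun f s - apply_bcontfun h s))"
        by (rule continuous_on_subset[of "{p..q}"],
            rule continuous_on_linear_family[where f=G and y="\<lambda>s. apply_bcontfun f s - apply_bcontfun h s", OF lin cont])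
          (use cl[of t] in \<open>auto intro: continuous_on_diff\<close>)
      fix s assume "s \<in> {p..cl t}"
      then have "s \<in> {p..q}" using cl[of t] by auto
      from K(1)[OF this] have "norm (G s (apply_bcontfun f s - apply_bcontfun h s)) \<le> K * dist (apply_bcontfun f s) (apply_bcontfun h s)"
        by (simp add: dist_norm)
      also have "\<dots> \<le> K * dist f h" by (intro mult_left_mono dist_bounded K(2))
      finally show "norm (G s (apply_bcontfun f s - apply_bcontfun h s)) \<le> K * dist f h" .
    qed
    also have "\<dots> \<le> K * dist f h * (q - p)" using cl[of t] K(2) by (intro mult_left_mono) auto
    also have "\<dots> \<le> 1/3 * dist f h" using mult_right_mono[OF K(3), of "dist f h"] by (simp add: mult_ac)
    finally show "dist (apply_bcontfun (\<Lambda> f) t) (apply_bcontfun (\<Lambda> h) t) \<le> 1/3 * dist f h"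
      by (simp add: \<Lambda> dist_norm)
  qed
  from banach_fix_type[OF _ _ this] obtain f where f: "\<Lambda> f = f" by auto
  have fix_eq: "apply_bcontfun f t = y0 + integral {p..t} (\<lambda>s. G s (apply_bcontfun f s))" if "t \<in> {p..q}" for t
    using fun_cong[OF \<Lambda>[of f], of t] cl(2)[OF that] unfolding f L_def by simp
  have "(apply_bcontfun f has_vector_derivative G t (apply_bcontfun f t)) (at t within {p..q})" if t: "t \<in> {p..q}" for t
  proof (rule has_vector_derivative_transform[OF t fix_eq])
    show "((\<lambda>t. y0 + integral {p..t} (\<lambda>s. G s (apply_bcontfun f s))) has_vector_derivative G t (apply_bcontfun f t)) (at t within {p..q})"
      using has_vector_derivative_add[OF has_vector_derivative_const integral_has_vector_derivative[OF cG t]] by simp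
  qed
  moreover have "apply_bcontfun f p = y0" using fix_eq[of p] pq by simp
  ultimately show ?thesis by blast
qed

text \<open>If the norm of \<open>y\<close> has maximum \<open>s\<close>, then \<open>y\<close>
  differs from \<open>y p\<close> by at most \<open>s / 3\<close>. At the zero this bounds
  \<open>norm (y p)\<close> by \<open>s / 3\<close>, at the maximum it gives
  \<open>norm (y p) \<ge> 2 * s / 3\<close>; hence \<open>s = 0\<close>. This makes fundamental
  solutions injective.\<close>

lemma linear_ode_injective:
  fixes y :: "real \<Rightarrow> 'v::euclidean_space"
  assumes y: "\<And>t. t \<in> {p..q} \<Longrightarrow> (y has_vector_derivative G t (y t)) (at t within {p..q})"
    and K: "\<And>t v. t \<in> {p..q} \<Longrightarrow> norm (G t v) \<le> K * norm v" "K \<ge> 0" "K * (q - p) \<le> 1/3"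
    and t: "t \<in> {p..q}" "y t = 0"
  shows "y p = 0"
proof -
  have c: "continuous_on {p..q} (\<lambda>t. norm (y t))"
    using y by (intro continuous_on_norm) (auto simp: continuous_on_eq_continuous_within intro!: has_vector_derivative_continuous[OF y])
  obtain m where m: "m \<in> {p..q}" "\<And>s. s \<in> {p..q} \<Longrightarrow> norm (y s) \<le> norm (y m)"
    using continuous_attains_sup[OF _ _ c] t by auto
  have b: "norm (y s - y p) \<le> norm (y m) / 3" if s: "s \<in> {p..q}" for s
  proof -
    have "norm (y s - y p) \<le> K * norm (y m) * norm (s - p)"
    proof (rule differentiable_bound[of "{p..q}" y "\<lambda>t h. h *\<^sub>R G t (y t)"])
      show "convex {p..q}" by simp
      show "(y has_derivative (\<lambda>h. h *\<^sub>R G r (y r))) (at r within {p..q})" if "r \<in> {p..q}" for r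
        using y[OF that] by (simp add: has_vector_derivative_def)
      fix r assume r: "r \<in> {p..q}"
      have "norm (G r (y r)) \<le> K * norm (y m)"
        using K(1)[OF r, of "y r"] mult_left_mono[OF m(2)[OF r] K(2)] by linarith
      then show "onorm (\<lambda>h. h *\<^sub>R G r (y r)) \<le> K * norm (y m)"
        by (intro onorm_bound) (use K(2) in \<open>auto simp: mult.commute[of _ "\<bar>_\<bar>"] intro!: mult_left_mono\<close>)
    qed (use s in auto)
    also have "\<dots> \<le> K * norm (y m) * (q - p)" using s K(2) by (intro mult_left_mono) auto
    also have "\<dots> \<le> 1/3 * norm (y m)" using mult_right_mono[OF K(3), of "norm (y m)"] by (simp add: mult_ac)
    finally show ?thesis by simp
  qed
  have "norm (y m) \<le> norm (y p) + norm (y m) / 3"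
    using b[OF m(1)] norm_triangle_sub[of "y m" "y p"] by linarith
  moreover have "norm (y p) \<le> norm (y m) / 3" using b[OF t(1)] t(2) by simp
  ultimately have "norm (y p) \<le> 0" using norm_ge_zero[of "y m"] by linarith
  then show ?thesis by simp
qed

lemma has_vector_derivative_within_Icc_join:
  fixes f :: "real \<Rightarrow> 'v::real_normed_vector"
  assumes "t \<in> {p..q} \<Longrightarrow> (f has_vector_derivative D) (at t within {p..q})"
    and "t \<in> {q..r} \<Longrightarrow> (f has_vector_derivative D) (at t within {q..r})"
    and "p \<le> q" "q \<le> r" "t \<in> {p..r}"
  shows "(f has_vector_derivative D) (at t within {p..r})"
proof -
  \<comment> \<open>Outside the closed interval the filter is trivial and any derivative is
    admissible, so the position of \<open>t\<close> relative to \<open>q\<close> requires no case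
    distinction.\<close>
  have triv: "(f has_vector_derivative D) (at t within {x..y})" if "t \<notin> {x..y}" for x y
  proof -
    have "at t within {x..y} = bot"
      using that by (simp add: at_within_eq_bot_iff closure_closed)
    then show ?thesis
      unfolding has_vector_derivative_def has_derivative_def
      by (simp add: bounded_linear_scaleR_left)
  qed
  have "(f has_vector_derivative D) (at t within {p..q})" "(f has_vector_derivative D) (at t within {q..r})"
    using assms triv by blast+
  then have "(f has_vector_derivative D) (at t within ({p..q} \<union> {q..r}))"
    unfolding has_vector_derivative_def has_derivative_at_within by (auto intro: Lim_Un)
  then show ?thesis using assms by (simp add: ivl_disj_un_two_touch)
qed

text \<open>A linear differential equation along a curve covered by charts: \<open>G c\<close> are the coefficients of
  the equation in the chart \<open>c\<close>, valid for parameters in \<open>D c\<close>, and \<open>T c d\<close> translates from the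
  chart \<open>c\<close> to the chart \<open>d\<close>.\<close>

locale linear_system =
  fixes C :: "'c set" and D :: "'c \<Rightarrow> real set" and G :: "'c \<Rightarrow> real \<Rightarrow> 'v::euclidean_space \<Rightarrow> 'v"
    and T :: "'c \<Rightarrow> 'c \<Rightarrow> real \<Rightarrow> 'v \<Rightarrow> 'v" and a b :: real
  assumes ab: "a \<le> b"
    and cover: "t \<in> {a..b} \<Longrightarrow> \<exists>c\<in>C. \<exists>e>0. \<forall>s\<in>{a..b}. \<bar>s - t\<bar> < e \<longrightarrow> s \<in> D c"
    and G_linear: "c \<in> C \<Longrightarrow> t \<in> {a..b} \<Longrightarrow> t \<in> D c \<Longrightarrow> linear (G c t)"
    and G_cont: "c \<in> C \<Longrightarrow> continuous_on ({a..b} \<inter> D c) (\<lambda>t. G c t v)"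
    and T_linear: "c \<in> C \<Longrightarrow> d \<in> C \<Longrightarrow> t \<in> {a..b} \<Longrightarrow> t \<in> D c \<Longrightarrow> t \<in> D d \<Longrightarrow> linear (T c d t)"
    and T_bij: "c \<in> C \<Longrightarrow> d \<in> C \<Longrightarrow> t \<in> {a..b} \<Longrightarrow> t \<in> D c \<Longrightarrow> t \<in> D d \<Longrightarrow> bij (T c d t)"
    and T_cocycle: "c \<in> C \<Longrightarrow> d \<in> C \<Longrightarrow> e \<in> C \<Longrightarrow> t \<in> {a..b} \<Longrightarrow> t \<in> D c \<Longrightarrow> t \<in> D d \<Longrightarrow> t \<in> D e \<Longrightarrow>
      T d e t (T c d t v) = T c e t v"
    and gauge: "c \<in> C \<Longrightarrow> d \<in> C \<Longrightarrow> a \<le> p \<Longrightarrow> q \<le> b \<Longrightarrow> t \<in> {p..q} \<Longrightarrow> t \<in> D c \<Longrightarrow> t \<in> D d \<Longrightarrow>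
      (y has_vector_derivative G c t (y t)) (at t within {p..q}) \<Longrightarrow>
      ((\<lambda>s. T c d s (y s)) has_vector_derivative G d t (T c d t (y t))) (at t within {p..q})"
begin

text \<open>A fundamental solution, read in every chart that covers \<open>t\<close>. No initial
  value is prescribed, so that pieces can be readjusted by a constant automorphism when they are
  joined.\<close>

definition frame :: "real \<Rightarrow> real \<Rightarrow> ('c \<Rightarrow> real \<Rightarrow> 'v \<Rightarrow> 'v) \<Rightarrow> bool" where
  "frame p q F \<longleftrightarrow> (\<forall>c\<in>C. \<forall>t\<in>{p..q} \<inter> D c. linear (F c t) \<and> bij (F c t) \<and>
     (\<forall>v. ((\<lambda>s. F c s v) has_vector_derivative G c t (F c t v)) (at t within {p..q})) \<and>
     (\<forall>d\<in>C. t \<in> D d \<longrightarrow> (\<forall>v. F d t v = T c d t (F c t v))))"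

lemma frameD:
  assumes "frame p q F" "c \<in> C" "t \<in> {p..q}" "t \<in> D c"
  shows "linear (F c t)" "bij (F c t)"
    "((\<lambda>s. F c s v) has_vector_derivative G c t (F c t v)) (at t within {p..q})"
    "d \<in> C \<Longrightarrow> t \<in> D d \<Longrightarrow> F d t v = T c d t (F c t v)"
proof -
  have "linear (F c t) \<and> bij (F c t) \<and>
     (\<forall>v. ((\<lambda>s. F c s v) has_vector_derivative G c t (F c t v)) (at t within {p..q})) \<and>
     (\<forall>d\<in>C. t \<in> D d \<longrightarrow> (\<forall>v. F d t v = T c d t (F c t v)))"
    using assms unfolding frame_def by blast
  then show "linear (F c t)" "bij (F c t)"
    "((\<lambda>s. F c s v) has_vector_derivative G c t (F c t v)) (at t within {p..q})"
    "d \<in> C \<Longrightarrow> t \<in> D d \<Longrightarrow> F d t v = T c d t (F c t v)"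
    by blast+
qed

lemma frameI:
  assumes "\<And>c t. c \<in> C \<Longrightarrow> t \<in> {p..q} \<Longrightarrow> t \<in> D c \<Longrightarrow> linear (F c t)"
    "\<And>c t. c \<in> C \<Longrightarrow> t \<in> {p..q} \<Longrightarrow> t \<in> D c \<Longrightarrow> bij (F c t)"
    "\<And>c t v. c \<in> C \<Longrightarrow> t \<in> {p..q} \<Longrightarrow> t \<in> D c \<Longrightarrow>
      ((\<lambda>s. F c s v) has_vector_derivative G c t (F c t v)) (at t within {p..q})"
    "\<And>c d t v. c \<in> C \<Longrightarrow> d \<in> C \<Longrightarrow> t \<in> {p..q} \<Longrightarrow> t \<in> D c \<Longrightarrow> t \<in> D d \<Longrightarrow> F d t v = T c d t (F c t v)"
  shows "frame p q F"
  unfolding frame_def by (intro ballI conjI allI impI; elim IntE; rule assms; assumption)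

text \<open>Only the labels of the solutions change: \<open>F c t (M v)\<close> is the solution
  formerly attached to \<open>M v\<close>. This serves to match frames and to normalise
  them.\<close>

lemma frame_translate:
  assumes "frame p q F" "linear M" "bij M"
  shows "frame p q (\<lambda>c t v. F c t (M v))"
proof (rule frameI)
  fix c t assume ct: "c \<in> C" "t \<in> {p..q}" "t \<in> D c"
  note F = frameD[OF assms(1) ct]
  show "linear (\<lambda>v. F c t (M v))" using linear_compose[OF assms(2) F(1)] by (simp add: o_def)
  show "bij (\<lambda>v. F c t (M v))" using bij_comp[OF assms(3) F(2)] by (simp add: o_def)
  show "((\<lambda>s. F c s (M v)) has_vector_derivative G c t (F c t (M v))) (at t within {p..q})" for v by (rule F(3))
  show "F d t (M v) = T c d t (F c t (M v))" if "d \<in> C" "t \<in> D d" for d v by (rule F(4)[OF that])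
qed

lemma frame_glue:
  assumes F: "frame p q F1" "frame q r F2" and le: "a \<le> p" "p \<le> q" "q \<le> r" "r \<le> b"
  shows "\<exists>F. frame p r F"
proof -
  obtain c where c: "c \<in> C" "q \<in> D c" using cover[of q] le by fastforce
  have q1: "q \<in> {p..q}" and q2: "q \<in> {q..r}" using le by auto
  note 1 = frameD[OF F(1) c(1) q1 c(2)] and 2 = frameD[OF F(2) c(1) q2 c(2)]
  \<comment> \<open>Chosen so that the second frame agrees with the first at \<open>q\<close> in the
    chart \<open>c\<close>; translation by \<open>T\<close> then gives agreement in every chart that
    covers \<open>q\<close>.\<close>
  define M where "M = inv (F2 c q) \<circ> F1 c q"
  have "linear (inv (F2 c q))"
    using inj_linear_imp_inv_linear[OF 2(1) bij_is_inj[OF 2(2)]] .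
  then have M: "linear M" "bij M"
    unfolding M_def using 1 2 by (auto intro: linear_compose bij_comp bij_imp_bij_inv)
  have cM: "F2 c q (M v) = F1 c q v" for v
    using 2(2) by (simp add: M_def bij_is_surj surj_f_inv_f)
  have at_q: "F2 d q (M v) = F1 d q v" if "d \<in> C" "q \<in> D d" for d v
    by (simp add: 1(4)[OF that] 2(4)[OF that] cM)
  have F2': "frame q r (\<lambda>c t v. F2 c t (M v))" by (rule frame_translate[OF F(2) M])
  define H where "H d t v = (if t \<le> q then F1 d t v else F2 d t (M v))" for d t v
  have H1: "H d t = F1 d t" if "t \<in> {p..q}" for d t using that by (auto simp: H_def)
  have H2: "H d t = (\<lambda>v. F2 d t (M v))" if "t \<in> {q..r}" "t \<in> D d" "d \<in> C" for d t
    using that at_q[OF that(3)] by (cases "t = q") (auto simp: H_def fun_eq_iff)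
  have "frame p r H"
  proof (rule frameI)
    fix d t assume d: "d \<in> C" and t: "t \<in> {p..r}" and tD: "t \<in> D d"
    have cases: "t \<in> {p..q} \<or> t \<in> {q..r}" using t by auto
    then show "linear (H d t)"
      using frameD(1)[OF F(1) d _ tD] frameD(1)[OF F2' d _ tD] H1[of t d] H2[OF _ tD d] by metis
    from cases show "bij (H d t)"
      using frameD(2)[OF F(1) d _ tD] frameD(2)[OF F2' d _ tD] H1[of t d] H2[OF _ tD d] by metis
    show "H e t v = T d e t (H d t v)" if e: "e \<in> C" "t \<in> D e" for e v
      using cases frameD(4)[OF F(1) d _ tD e] frameD(4)[OF F2' d _ tD e] H1[of t] H2[OF _ tD d] H2[OF _ e(2,1)]
      by auto
    fix v
    show "((\<lambda>s. H d s v) has_vector_derivative G d t (H d t v)) (at t within {p..r})"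
    proof (rule has_vector_derivative_within_Icc_join[OF _ _ le(2,3) t])
      assume t1: "t \<in> {p..q}"
      show "((\<lambda>s. H d s v) has_vector_derivative G d t (H d t v)) (at t within {p..q})"
        unfolding H1[OF t1]
        by (rule has_vector_derivative_transform[OF t1 _ frameD(3)[OF F(1) d t1 tD]]) (simp add: H1)
    next
      assume t1: "t \<in> {q..r}"
      show "((\<lambda>s. H d s v) has_vector_derivative G d t (H d t v)) (at t within {q..r})"
        unfolding H2[OF t1 tD d]
      \<comment> \<open>If \<open>d\<close> does not cover \<open>q\<close>, the two pieces need not
        agree there, but then \<open>t\<close> differs from \<open>q\<close> and \<open>H\<close> is
        the second piece near \<open>t\<close>.\<close>
      proof (cases "q \<in> D d")
        case True
        show "((\<lambda>s. H d s v) has_vector_derivative G d t (F2 d t (M v))) (at t within {q..r})"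
          by (rule has_vector_derivative_transform[OF t1 _ frameD(3)[OF F2' d t1 tD]])
            (use at_q[OF d True] in \<open>auto simp: H_def\<close>)
      next
        case False
        then have tq: "t - q > 0" using tD t1 by (cases "t = q") auto
        show "((\<lambda>s. H d s v) has_vector_derivative G d t (F2 d t (M v))) (at t within {q..r})"
          by (rule has_vector_derivative_transform_within[OF frameD(3)[OF F2' d t1 tD] tq t1])
             (auto simp: H_def dist_real_def)
      qed
    qed
  qed
  then show ?thesis by blast
qed

text \<open>A chart valid around \<open>x\<close> has bounded coefficients on a compact
  neighbourhood \<open>N\<close>, hence solutions on short intervals; all other charts receive them
  through \<open>T\<close>.\<close>

lemma frame_local:
  assumes x: "a \<le> x" "x \<le> b"
  shows "\<exists>e>0. \<forall>p q. a \<le> p \<and> p \<le> x \<and> x \<le> q \<and> q \<le> b \<and> q - p < e \<longrightarrow> (\<exists>F. frame p q F)"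
proof -
  obtain c e where c: "c \<in> C" and e: "e > 0" "\<And>s. s \<in> {a..b} \<Longrightarrow> \<bar>s - x\<bar> < e \<Longrightarrow> s \<in> D c"
    using cover[of x] x by auto
  define N where "N = {max a (x - e/2)..min b (x + e/2)}"
  have N: "N \<subseteq> {a..b} \<inter> D c" using e by (auto simp: N_def abs_if)
  have "\<exists>k. \<forall>t\<in>N. norm (G c t i) \<le> k" for i
  proof -
    have "compact ((\<lambda>t. G c t i) ` N)"
      by (intro compact_continuous_image continuous_on_subset[OF G_cont[OF c] N]) (simp add: N_def)
    then show ?thesis using compact_imp_bounded bounded_iff by (metis image_eqI)
  qed
  then obtain k where k: "\<And>i t. t \<in> N \<Longrightarrow> norm (G c t i) \<le> k i" by metis
  define K where "K = (\<Sum>i\<in>Basis. \<bar>k i\<bar>)"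
  have K0: "K \<ge> 0" by (auto simp: K_def intro: sum_nonneg)
  have K: "norm (G c t v) \<le> K * norm v" if t: "t \<in> N" for t v
  proof -
    have "linear (G c t)" using t N by (intro G_linear[OF c]) auto
    then have "G c t v = (\<Sum>i\<in>Basis. (v \<bullet> i) *\<^sub>R G c t i)" by (rule linear_basis_expansion)
    also have "norm \<dots> \<le> (\<Sum>i\<in>Basis. norm v * \<bar>k i\<bar>)"
      by (rule sum_norm_le)
        (use k[OF t] in \<open>auto intro!: mult_mono Basis_le_norm order_trans[OF k[OF t] abs_ge_self]\<close>)
    finally show ?thesis by (simp add: K_def sum_distrib_left[symmetric] mult.commute)
  qed
  \<comment> \<open>The first bound keeps the interval inside \<open>N\<close>, the second yields
    \<open>K * (q - p) \<le> 1/3\<close>, with \<open>K + 1\<close> guarding against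
    \<open>K = 0\<close>.\<close>
  define \<delta> where "\<delta> = min (e/2) (1 / (3 * (K + 1)))"
  show ?thesis
  proof (intro exI[of _ \<delta>] conjI allI impI)
    show "\<delta> > 0" using e K0 by (auto simp: \<delta>_def)
    fix p q assume pq: "a \<le> p \<and> p \<le> x \<and> x \<le> q \<and> q \<le> b \<and> q - p < \<delta>"
    then have sub: "{p..q} \<subseteq> N" by (auto simp: N_def \<delta>_def)
    have le: "p \<le> q" using pq by simp
    have "K * (q - p) \<le> K * (1 / (3 * (K + 1)))" using pq K0 by (intro mult_left_mono) (auto simp: \<delta>_def)
    also have "\<dots> \<le> 1/3" using K0 by (simp add: field_simps)
    finally have Kpq: "K * (q - p) \<le> 1/3" .
    have lin: "linear (G c t)" if "t \<in> {p..q}" for t using subsetD[OF sub that] N by (intro G_linear[OF c]) auto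
    have "\<exists>y. y p = y0 \<and> (\<forall>t\<in>{p..q}. (y has_vector_derivative G c t (y t)) (at t within {p..q}))" for y0
      by (rule linear_ode_short_interval[OF le lin _ _ K0 Kpq])
        (use K subsetD[OF sub] continuous_on_subset[OF G_cont[OF c] subset_trans[OF sub N]] in auto)
    then obtain Y where Y: "\<And>y0. Y y0 p = y0"
      "\<And>y0 t. t \<in> {p..q} \<Longrightarrow> (Y y0 has_vector_derivative G c t (Y y0 t)) (at t within {p..q})" by metis
    \<comment> \<open>Only the solutions that start at basis vectors are used, so linearity in the
      initial value is built in.\<close>
    define F0 where "F0 t v = (\<Sum>i\<in>Basis. (v \<bullet> i) *\<^sub>R Y i t)" for t v
    have F0p: "F0 p v = v" for v by (simp add: F0_def Y(1) euclidean_representation)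
    have F0l: "linear (F0 t)" for t
      by (rule linearI) (simp_all add: F0_def inner_add_left scaleR_add_left sum.distrib scaleR_sum_right)
    have F0d: "((\<lambda>s. F0 s v) has_vector_derivative G c t (F0 t v)) (at t within {p..q})" if t: "t \<in> {p..q}" for t v
    proof -
      have "((\<lambda>s. F0 s v) has_vector_derivative (\<Sum>i\<in>Basis. (v \<bullet> i) *\<^sub>R G c t (Y i t))) (at t within {p..q})"
        unfolding F0_def
        by (intro has_vector_derivative_sum bounded_linear.has_vector_derivative[OF bounded_linear_scaleR_right] Y t)
      then show ?thesis
        by (simp add: F0_def linear_sum[OF lin[OF t]] linear_cmul[OF lin[OF t]])
    qed
    have F0b: "bij (F0 t)" if t: "t \<in> {p..q}" for t
    proof -
      have "v = 0" if "F0 t v = 0" for v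
        using linear_ode_injective[where y="\<lambda>s. F0 s v" and G="G c", OF F0d K[OF subsetD[OF sub]] K0 Kpq t that]
        by (simp add: F0p)
      then have "inj (F0 t)" using linear_injective_0[OF F0l] by auto
      then show ?thesis using linear_inj_imp_surj[OF F0l] by (simp add: bij_def)
    qed
    have tD: "t \<in> D c" "t \<in> {a..b}" if "t \<in> {p..q}" for t using subsetD[OF sub that] N by auto
    have "frame p q (\<lambda>d t v. T c d t (F0 t v))"
    proof (rule frameI)
      fix d t assume d: "d \<in> C" and t: "t \<in> {p..q}" "t \<in> D d"
      note t' = tD(2)[OF t(1)] tD(1)[OF t(1)] t(2)
      show "linear (\<lambda>v. T c d t (F0 t v))"
        using linear_compose[OF F0l T_linear[OF c d t']] by (simp add: o_def)
      show "bij (\<lambda>v. T c d t (F0 t v))"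
        using bij_comp[OF F0b[OF t(1)] T_bij[OF c d t']] by (simp add: o_def)
      show "((\<lambda>s. T c d s (F0 s v)) has_vector_derivative G d t (T c d t (F0 t v))) (at t within {p..q})" for v
        using pq by (intro gauge[OF c d _ _ t(1) t'(2,3) F0d[OF t(1)]]) auto
      show "T c e t (F0 t v) = T d e t (T c d t (F0 t v))" if "e \<in> C" "t \<in> D e" for e v
        by (rule T_cocycle[OF c d that(1) t' that(2), symmetric])
    qed
    then show "\<exists>F. frame p q F" by blast
  qed
qed

text \<open>Bisection: adjacent intervals with a frame can be joined, and short intervals around any
  point have one.\<close>

lemma frame_exists: "\<exists>F. frame a b F"
proof -
  \<comment> \<open>Intervals that leave \<open>{a..b}\<close> satisfy \<open>P\<close> vacuously,
    since the induction rule does not confine them.\<close>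
  define P where "P p q \<longleftrightarrow> (a \<le> p \<and> p \<le> q \<and> q \<le> b \<longrightarrow> (\<exists>F. frame p q F))" for p q
  have "P a b"
    using ab
  proof (induction rule: Bolzano)
    case (trans p q r)
    then show ?case unfolding P_def using frame_glue[of p q _ r] by (meson order_trans)
  next
    case (local x)
    from frame_local[OF this] obtain e where "e > 0"
      "\<And>p q. a \<le> p \<and> p \<le> x \<and> x \<le> q \<and> q \<le> b \<and> q - p < e \<Longrightarrow> (\<exists>F. frame p q F)" by blast
    then show ?case unfolding P_def by blast
  qed
  then show ?thesis using ab by (auto simp: P_def)
qed

end

text \<open>The case of a single chart, normalised at \<open>t0\<close> by precomposing with the
  inverse of the frame there.\<close>

lemma fundamental_solution_exists:
  fixes G :: "real \<Rightarrow> 'v::euclidean_space \<Rightarrow> 'v"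
  assumes "a \<le> b" and lin: "\<And>t. t \<in> {a..b} \<Longrightarrow> linear (G t)"
    and cont: "\<And>v. continuous_on {a..b} (\<lambda>t. G t v)" and t0: "t0 \<in> {a..b}"
  obtains F where "\<And>t. t \<in> {a..b} \<Longrightarrow> linear (F t)" "\<And>t. t \<in> {a..b} \<Longrightarrow> bij (F t)"
    "\<And>t v. t \<in> {a..b} \<Longrightarrow> ((\<lambda>s. F s v) has_vector_derivative G t (F t v)) (at t within {a..b})"
    "\<And>v. F t0 v = v"
proof -
  interpret linear_system "{()}" "\<lambda>_. UNIV" "\<lambda>_. G" "\<lambda>_ _ _ v. v" a b
  proof (rule linear_system.intro)
    show "linear (\<lambda>v::'v. v)" by (rule linearI) auto
    show "bij (\<lambda>v::'v. v)" by (metis bij_id eq_id_iff)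
    show "continuous_on ({a..b} \<inter> UNIV) (\<lambda>t. G t v)" for v using cont by simp
    show "\<exists>c\<in>{()}. \<exists>e>0. \<forall>s\<in>{a..b}. \<bar>s - t\<bar> < e \<longrightarrow> s \<in> UNIV" for t :: real
      by (auto intro: exI[of _ "1::real"])
  qed (use assms(1) lin in auto)
  obtain F where F: "frame a b F" using frame_exists by blast
  have l: "linear (F () t)" "bij (F () t)" if "t \<in> {a..b}" for t
    by (rule frameD[OF F _ that]; simp)+
  let ?M = "inv (F () t0)"
  have M: "linear ?M" "bij ?M"
    using inj_linear_imp_inv_linear[OF l(1)[OF t0] bij_is_inj[OF l(2)[OF t0]]] bij_imp_bij_inv[OF l(2)[OF t0]] .
  note F' = frame_translate[OF F M]
  show ?thesis
  proof (rule that[of "\<lambda>t v. F () t (?M v)"])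
    show "F () t0 (?M v) = v" for v using l(2)[OF t0] by (simp add: bij_is_surj surj_f_inv_f)
  qed (rule frameD[OF F']; simp)+
qed

section \<open>Parallel frames and Jacobi fields\<close>

text \<open>Coordinates are pairings under \<open>h\<close> with fixed vectors; so continuity and
  derivatives of a curve may be checked on its pairings.\<close>

lemma nondegenerate_form_components:
  fixes h :: "real^'n \<Rightarrow> real^'n \<Rightarrow> real"
  assumes "\<And>v w. h v w = v \<bullet> (H *v w)" "invertible H"
  shows "v \<bullet> e = h v (matrix_inv H *v e)"
  using assms by (simp add: matrix_vector_mul_assoc matrix_inv_right)

lemma continuous_on_by_form:
  fixes h :: "real^'n \<Rightarrow> real^'n \<Rightarrow> real"
  assumes h: "\<And>v w. h v w = v \<bullet> (H *v w)" "invertible H" and "\<And>w. continuous_on S (\<lambda>t. h (f t) w)"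
  shows "continuous_on S f"
proof -
  have "continuous_on S (\<lambda>t. \<Sum>e\<in>Basis. (f t \<bullet> e) *\<^sub>R e)"
    unfolding nondegenerate_form_components[OF h] by (intro continuous_intros assms(3))
  then show ?thesis by (simp add: euclidean_representation)
qed

lemma has_vector_derivative_by_form:
  fixes h :: "real^'n \<Rightarrow> real^'n \<Rightarrow> real" and f :: "real \<Rightarrow> real^'n"
  assumes h: "\<And>v w. h v w = v \<bullet> (H *v w)" "invertible H"
    and d: "\<And>w. ((\<lambda>t. h (f t) w) has_vector_derivative h f' w) (at t within S)"
  shows "(f has_vector_derivative f') (at t within S)"
  unfolding has_vector_derivative_def
proof (subst has_derivative_componentwise_within, intro ballI)
  fix e :: "real^'n"
  have "h (r *\<^sub>R f') w = r * h f' w" for r w by (simp add: h(1))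
  then show "((\<lambda>t. f t \<bullet> e) has_derivative (\<lambda>r. r *\<^sub>R f' \<bullet> e)) (at t within S)"
    using d[of "matrix_inv H *v e", unfolded has_vector_derivative_def]
    unfolding nondegenerate_form_components[OF h] by simp
qed

lemma has_vector_derivative_Icc_unique:
  fixes f :: "real \<Rightarrow> 'v::real_normed_vector"
  assumes "p < q" "t \<in> {p..q}" "(f has_vector_derivative D) (at t within {p..q})"
  shows "vector_derivative f (at t within {p..q}) = D"
  using vector_derivative_within_cbox[of p q t f D] assms by simp

context semi_riemannian_manifold
begin

lemma chart_at: "chart_at A p \<in> A" "p \<in> fst (chart_at A p)"
proof -
  have "\<exists>c. c \<in> A \<and> p \<in> fst c" using atlas unfolding smooth_atlas_def by blast
  then have "chart_at A p \<in> A \<and> p \<in> fst (chart_at A p)" unfolding chart_at_def by (rule someI_ex)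
  then show "chart_at A p \<in> A" "p \<in> fst (chart_at A p)" by auto
qed

lemma curvature_linear:
  assumes "c \<in> A" "x \<in> img c"
  shows "linear (\<lambda>u. curvature g c x u v w)" "linear (\<lambda>v. curvature g c x u v w)" "linear (curvature g c x u v)"
proof -
  note l = linear_add[OF christoffel_linear(1)[OF assms]] linear_add[OF christoffel_linear(2)[OF assms]]
    linear_add[OF dchristoffel_linear_dir[OF assms]] linear_add[OF dchristoffel_linear(1)[OF assms]]
    linear_add[OF dchristoffel_linear(2)[OF assms]]
    linear_cmul[OF christoffel_linear(1)[OF assms]] linear_cmul[OF christoffel_linear(2)[OF assms]]
    linear_cmul[OF dchristoffel_linear_dir[OF assms]] linear_cmul[OF dchristoffel_linear(1)[OF assms]]
    linear_cmul[OF dchristoffel_linear(2)[OF assms]]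
  show "linear (\<lambda>u. curvature g c x u v w)" "linear (\<lambda>v. curvature g c x u v w)" "linear (curvature g c x u v)"
    by (rule linearI; simp add: curvature_def l algebra_simps)+
qed

lemma curvature_cont:
  assumes "c \<in> A"
  shows "continuous_on (img c) (\<lambda>x. curvature g c x u v w)"
proof -
  have 1: "continuous_on (img c) (\<lambda>x. christoffel g c x u v)" for u v
    by (intro smooth_on_continuous christoffel_smooth assms)
  have 2: "continuous_on (img c) (\<lambda>x. christoffel g c x u (christoffel g c x v w))" for u v w
    by (rule continuous_on_linear_family[where f="\<lambda>x. christoffel g c x u"])
      (use 1 christoffel_linear assms in auto)
  have 3: "continuous_on (img c) (\<lambda>x. dchristoffel g c x u v w)" for u v w
    by (intro smooth_on_continuous dchristoffel_smooth assms)
  show ?thesis unfolding curvature_def by (intro continuous_intros 2 3)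
qed

end

section \<open>Parallel transport as a linear system over the charts\<close>

locale curve_along = semi_riemannian_manifold A g
  for A :: "('m::topological_space, 'n::finite) chart set" and g :: "('m, 'n) metric" +
  fixes \<gamma> :: "real \<Rightarrow> 'm" and a b :: real
  assumes ab: "a < b" and cont: "continuous_on {a..b} \<gamma>"
    and diff: "differentiable_along A \<gamma> {a..b} (\<lambda>c. snd c \<circ> \<gamma>)"
    and diff_vel: "differentiable_along A \<gamma> {a..b} (velocity \<gamma> {a..b})"
begin

definition pos :: "('m, 'n) chart \<Rightarrow> real \<Rightarrow> real^'n" where "pos c t = snd c (\<gamma> t)"
definition vel :: "('m, 'n) chart \<Rightarrow> real \<Rightarrow> real^'n" where "vel = velocity \<gamma> {a..b}"
definition dom :: "('m, 'n) chart \<Rightarrow> real set" where "dom c = {t. \<gamma> t \<in> fst c}"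

lemma pos_img: "t \<in> dom c \<Longrightarrow> pos c t \<in> img c"
  by (auto simp: dom_def pos_def)

lemma pos_overlap: "t \<in> dom c \<Longrightarrow> t \<in> dom d \<Longrightarrow> pos c t \<in> overlap c d"
  by (auto simp: dom_def pos_def intro: overlap_memI)

lemma pos_trans: "c \<in> A \<Longrightarrow> t \<in> dom c \<Longrightarrow> transition c d (pos c t) = pos d t"
  by (auto simp: dom_def pos_def transition_chart)

lemma dom_near:
  assumes "c \<in> A" "t \<in> {a..b}" "t \<in> dom c"
  shows "\<exists>e>0. \<forall>s\<in>{a..b}. \<bar>s - t\<bar> < e \<longrightarrow> s \<in> dom c"
proof -
  have "\<exists>B. open B \<and> t \<in> B \<and> (\<forall>y\<in>{a..b}. y \<in> B \<longrightarrow> \<gamma> y \<in> fst c)"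
    using cont[unfolded continuous_on_topological, rule_format, OF assms(2) open_dom[OF assms(1)]] assms(3)
    by (simp add: dom_def)
  then obtain B where B: "open B" "t \<in> B" "\<And>y. y \<in> {a..b} \<Longrightarrow> y \<in> B \<Longrightarrow> \<gamma> y \<in> fst c" by blast
  obtain e where "e > 0" "ball t e \<subseteq> B" using B open_contains_ball by blast
  then show ?thesis using B(3) by (intro exI[of _ e]) (auto simp: dom_def dist_real_def subset_iff abs_minus_commute)
qed

lemma dom_eventually:
  assumes "c \<in> A" "t \<in> {a..b}" "t \<in> dom c" "S \<subseteq> {a..b}"
  shows "\<forall>\<^sub>F s in at t within S. s \<in> dom c"
proof -
  obtain e where "e > 0" "\<forall>s\<in>{a..b}. \<bar>s - t\<bar> < e \<longrightarrow> s \<in> dom c" using dom_near[OF assms(1-3)] by blast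
  then show ?thesis using assms(4) unfolding eventually_at
    by (intro exI[of _ e]) (auto simp: dist_real_def)
qed

lemma pos_deriv:
  assumes "c \<in> A" "t \<in> {a..b}" "t \<in> dom c" "S \<subseteq> {a..b}"
  shows "(pos c has_vector_derivative vel c t) (at t within S)"
proof -
  have "(snd c \<circ> \<gamma>) differentiable (at t within {a..b})"
    using diff assms by (auto simp: differentiable_along_def dom_def)
  then have "(pos c has_vector_derivative vel c t) (at t within {a..b})"
    unfolding vector_derivative_works vel_def velocity_def pos_def[abs_def] by (simp add: o_def)
  then show ?thesis using has_vector_derivative_within_subset assms(4) by blast
qed

lemma pos_continuous: "c \<in> A \<Longrightarrow> continuous_on ({a..b} \<inter> dom c) (pos c)"
  unfolding continuous_on_eq_continuous_within
  using has_vector_derivative_continuous[OF pos_deriv] by auto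

lemma vel_continuous:
  assumes "c \<in> A"
  shows "continuous_on ({a..b} \<inter> dom c) (vel c)"
  unfolding continuous_on_eq_continuous_within
proof
  fix t assume t: "t \<in> {a..b} \<inter> dom c"
  then have "vel c differentiable (at t within {a..b})"
    using diff_vel assms by (auto simp: differentiable_along_def dom_def vel_def)
  from differentiable_imp_continuous_within[OF this] show "continuous (at t within ({a..b} \<inter> dom c)) (vel c)"
    by (rule continuous_within_subset) auto
qed

text \<open>Derivatives within a subinterval agree with those within \<open>{a..b}\<close>, also at
  its end points; this lets a geodesic be compared with its extension.\<close>

lemma velocity_eq:
  assumes "c \<in> A" "t \<in> {p..q}" "t \<in> dom c" "{p..q} \<subseteq> {a..b}" "p < q" "\<And>s. s \<in> {p..q} \<Longrightarrow> \<eta> s = \<gamma> s"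
  shows "velocity \<eta> {p..q} c t = vel c t"
  unfolding velocity_def
  by (rule has_vector_derivative_Icc_unique[OF assms(5,2)],
      rule has_vector_derivative_transform[OF assms(2) _ pos_deriv[OF assms(1) _ assms(3,4)]])
    (use assms in \<open>auto simp: pos_def\<close>)

lemma vel_trans:
  assumes c: "c \<in> A" "d \<in> A" and t: "t \<in> {a..b}" "t \<in> dom c" "t \<in> dom d"
  shows "vel d t = dtr c d (pos c t) (vel c t)"
proof -
  have ov: "pos c t \<in> overlap c d" by (rule pos_overlap[OF t(2,3)])
  have "((\<lambda>s. transition c d (pos c s)) has_derivative (\<lambda>h. dtr c d (pos c t) (h *\<^sub>R vel c t))) (at t within {a..b})"
    by (rule has_derivative_compose[OF pos_deriv[OF c(1) t(1,2), unfolded has_vector_derivative_def]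
          transition_has_derivative[OF c ov]]) simp
  then have "((\<lambda>s. transition c d (pos c s)) has_vector_derivative dtr c d (pos c t) (vel c t)) (at t within {a..b})"
    by (simp add: has_vector_derivative_def linear_cmul[OF dtr_linear[OF c ov]])
  then have "(pos d has_vector_derivative dtr c d (pos c t) (vel c t)) (at t within {a..b})"
    unfolding has_vector_derivative_def
  proof (rule has_derivative_transform_eventually)
    show "\<forall>\<^sub>F s in at t within {a..b}. transition c d (pos c s) = pos d s"
      using dom_eventually[OF c(1) t(1,2) subset_refl] by eventually_elim (rule pos_trans[OF c(1)])
  qed (use pos_trans[OF c(1) t(2)] t in auto)
  then show ?thesis
    using has_vector_derivative_Icc_unique[OF ab t(1)] pos_deriv[OF c(2) t(1,3) subset_refl] by metis
qed

definition parallel_rhs :: "('m, 'n) chart \<Rightarrow> real \<Rightarrow> real^'n \<Rightarrow> real^'n" where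
  "parallel_rhs c t v = - christoffel g c (pos c t) (vel c t) v"

lemma parallel_rhs_linear: "c \<in> A \<Longrightarrow> t \<in> dom c \<Longrightarrow> linear (parallel_rhs c t)"
  unfolding parallel_rhs_def
  using linear_compose_neg[OF christoffel_linear(2)[OF _ pos_img]] by auto

text \<open>The cocycle condition is the chain rule for coordinate changes. The condition
  \<open>gauge\<close> is the transformation law of the Christoffel symbols: its second-derivative
  term cancels the one that arises from differentiating \<open>dtr\<close> along the curve.\<close>

lemma parallel_system:
  "linear_system A dom parallel_rhs (\<lambda>c d t. dtr c d (pos c t)) a b"
proof (rule linear_system.intro)
  show "a \<le> b" using ab by simp
  show "\<exists>c\<in>A. \<exists>e>0. \<forall>s\<in>{a..b}. \<bar>s - t\<bar> < e \<longrightarrow> s \<in> dom c" if "t \<in> {a..b}" for t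
    using dom_near[OF chart_at(1) that, of "\<gamma> t"] chart_at by (auto simp: dom_def)
  show "linear (parallel_rhs c t)" if "c \<in> A" "t \<in> {a..b}" "t \<in> dom c" for c t
    using parallel_rhs_linear that by blast
  show "continuous_on ({a..b} \<inter> dom c) (\<lambda>t. parallel_rhs c t v)" if c: "c \<in> A" for c v
    unfolding parallel_rhs_def
  proof (intro continuous_on_minus, rule continuous_on_linear_family[where f="\<lambda>t u. christoffel g c (pos c t) u v" and y="vel c"])
    show "linear (\<lambda>u. christoffel g c (pos c t) u v)" if "t \<in> {a..b} \<inter> dom c" for t
      using christoffel_linear(1)[OF c pos_img] that by auto
    show "continuous_on ({a..b} \<inter> dom c) (\<lambda>t. christoffel g c (pos c t) u v)" for u
      by (rule continuous_on_compose2[OF smooth_on_continuous[OF christoffel_smooth[OF c]] pos_continuous[OF c]])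
        (auto intro: pos_img)
  qed (rule vel_continuous[OF c])
  fix c d t assume c: "c \<in> A" "d \<in> A" and t: "t \<in> {a..b}" "t \<in> dom c" "t \<in> dom d"
  show "linear (dtr c d (pos c t))" by (rule dtr_linear[OF c pos_overlap[OF t(2,3)]])
  show "bij (dtr c d (pos c t))" by (rule dtr_bij[OF c pos_overlap[OF t(2,3)]])
next
  fix c d e t v assume c: "c \<in> A" "d \<in> A" "e \<in> A" and t: "t \<in> {a..b}" "t \<in> dom c" "t \<in> dom d" "t \<in> dom e"
  let ?x = "pos c t"
  have ov: "?x \<in> overlap c d \<inter> overlap c e" using pos_overlap t by auto
  have "open (overlap c d \<inter> overlap c e)" using open_overlap[OF c(1,2)] open_overlap[OF c(1,3)] by (rule open_Int)
  moreover have "((\<lambda>y. transition d e (transition c d y)) has_derivative (\<lambda>v. dtr d e (transition c d ?x) (dtr c d ?x v))) (at ?x)"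
    by (rule has_derivative_compose[OF transition_has_derivative transition_has_derivative])
      (use c ov t pos_trans[OF c(1) t(2)] pos_overlap[OF t(3,4)] in auto)
  moreover have "transition d e (transition c d y) = transition c e y" if "y \<in> overlap c d \<inter> overlap c e" for y
  proof -
    obtain p where "p \<in> fst c" "p \<in> fst d" "y = snd c p" using \<open>y \<in> _\<close> by (auto simp: overlap_def)
    then show ?thesis using c by (simp add: transition_chart)
  qed
  ultimately have "(transition c e has_derivative (\<lambda>v. dtr d e (transition c d ?x) (dtr c d ?x v))) (at ?x)"
    using has_derivative_transform_within_open ov by blast
  from has_derivative_unique[OF this transition_has_derivative] ov c
  show "dtr d e (pos d t) (dtr c d (pos c t) v) = dtr c e (pos c t) v"
    using pos_trans[OF c(1) t(2)] by (auto dest: fun_cong)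
next
  fix c d p q t y assume c: "c \<in> A" "d \<in> A" and pq: "a \<le> p" "q \<le> b" and t: "t \<in> {p..q}" "t \<in> dom c" "t \<in> dom d"
    and y: "(y has_vector_derivative parallel_rhs c t (y t)) (at t within {p..q})"
  have t': "t \<in> {a..b}" and sub: "{p..q} \<subseteq> {a..b}" using t pq by auto
  let ?x = "pos c t"
  have ov: "?x \<in> overlap c d" by (rule pos_overlap[OF t(2,3)])
  have x: "(pos c has_derivative (\<lambda>h. h *\<^sub>R vel c t)) (at t within {p..q})"
    using pos_deriv[OF c(1) t' t(2) sub] by (simp add: has_vector_derivative_def)
  have ev: "\<forall>\<^sub>F s in at t within {p..q}. linear (dtr c d (pos c s))"
    using dom_eventually[OF c(1) t' t(2) sub] dom_eventually[OF c(2) t' t(3) sub]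
    by eventually_elim (intro dtr_linear c pos_overlap)
  note l = dtr_linear[OF c ov] and l2 = d2tr_linear[OF c ov]
  have "((\<lambda>s. dtr c d (pos c s) (y s)) has_derivative
     (\<lambda>h. d2tr c d ?x (h *\<^sub>R vel c t) (y t) + dtr c d ?x (h *\<^sub>R parallel_rhs c t (y t)))) (at t within {p..q})"
    by (rule has_derivative_linear_family[where f="\<lambda>s. dtr c d (pos c s)", OF ev l t(1)
          has_derivative_compose[OF x dtr_has_derivative[OF c ov]] y[unfolded has_vector_derivative_def] l2(2)])
  moreover have "d2tr c d ?x (h *\<^sub>R vel c t) (y t) + dtr c d ?x (h *\<^sub>R parallel_rhs c t (y t)) =
      h *\<^sub>R parallel_rhs d t (dtr c d ?x (y t))" for h
    using christoffel_trans[OF c ov, of "vel c t" "y t"]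
    by (simp add: parallel_rhs_def linear_cmul[OF l] linear_cmul[OF l2(1)] linear_neg[OF l]
        vel_trans[OF c t' t(2,3)] pos_trans[OF c(1) t(2)] scaleR_add_right[symmetric] del: scaleR_minus_right)
  ultimately show "((\<lambda>s. dtr c d (pos c s) (y s)) has_vector_derivative parallel_rhs d t (dtr c d ?x (y t))) (at t within {p..q})"
    by (simp add: has_vector_derivative_def)
qed

end

text \<open>In the application the interval is that of the extended geodesic and \<open>t0\<close>
  is the initial instant of the original one. The normalisation makes frame components at
  \<open>t0\<close> equal to what \<open>value_at\<close> returns.\<close>

locale parallel_frame = curve_along A g \<gamma> a b
  for A :: "('m::topological_space, 'n::finite) chart set" and g :: "('m, 'n) metric"
    and \<gamma> :: "real \<Rightarrow> 'm" and a b :: real +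
  fixes F :: "('m, 'n) chart \<Rightarrow> real \<Rightarrow> real^'n \<Rightarrow> real^'n" and t0 :: real
  assumes F: "linear_system.frame A dom parallel_rhs (\<lambda>c d t. dtr c d (pos c t)) a b F"
    and t0: "t0 \<in> {a..b}" and F_t0: "F (chart_at A (\<gamma> t0)) t0 v = v"
begin

lemmas frameD = linear_system.frameD[OF parallel_system F]
lemmas F_linear = frameD(1) and F_bij = frameD(2) and F_deriv = frameD(3) and F_trans = frameD(4)

lemma F_inv: "c \<in> A \<Longrightarrow> t \<in> {a..b} \<Longrightarrow> t \<in> dom c \<Longrightarrow> F c t (inv (F c t) v) = v"
  and F_inv': "c \<in> A \<Longrightarrow> t \<in> {a..b} \<Longrightarrow> t \<in> dom c \<Longrightarrow> inv (F c t) (F c t v) = v"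
  using F_bij by (auto simp: bij_is_surj surj_f_inv_f bij_is_inj)

lemma F_eq_iff: "c \<in> A \<Longrightarrow> t \<in> {a..b} \<Longrightarrow> t \<in> dom c \<Longrightarrow> F c t v = F c t w \<longleftrightarrow> v = w"
  using inj_eq[OF bij_is_inj[OF F_bij]] by blast

abbreviation chart0 where "chart0 t \<equiv> chart_at A (\<gamma> t)"

lemma chart0: "chart0 t \<in> A" "t \<in> dom (chart0 t)"
  using chart_at by (auto simp: dom_def)

definition form :: "real^'n \<Rightarrow> real^'n \<Rightarrow> real" where "form = metric_at A g (\<gamma> t0)"

text \<open>The columns of the frame have covariant derivative zero, so metric compatibility leaves
  only the covariant derivative of \<open>K\<close>.\<close>

lemma F_gform_has_derivative:
  assumes c: "c \<in> A" and t: "t \<in> {a..b}" "t \<in> dom c" and S: "S \<subseteq> {a..b}"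
    and k: "(K has_vector_derivative K') (at t within S)"
  shows "((\<lambda>s. gform g c (pos c s) (K s) (F c s w)) has_vector_derivative
    gform g c (pos c t) (K' + christoffel g c (pos c t) (vel c t) (K t)) (F c t w)) (at t within S)"
proof -
  let ?x = "pos c t" and ?u = "vel c t"
  have x: "(pos c has_derivative (\<lambda>h. h *\<^sub>R ?u)) (at t within S)"
    using pos_deriv[OF c t S] by (simp add: has_vector_derivative_def)
  have f: "((\<lambda>s. F c s w) has_derivative (\<lambda>h. h *\<^sub>R parallel_rhs c t (F c t w))) (at t within S)"
    using has_vector_derivative_within_subset[OF F_deriv[OF c t] S] by (simp add: has_vector_derivative_def)
  note d = gform_has_derivative[where y="pos c", OF c pos_img[OF t(2)] x k[unfolded has_vector_derivative_def] f]
  have "dgform g c ?x (h *\<^sub>R ?u) (K t) (F c t w) + gform g c ?x (h *\<^sub>R K') (F c t w)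
      + gform g c ?x (K t) (h *\<^sub>R parallel_rhs c t (F c t w)) =
    h *\<^sub>R gform g c ?x (K' + christoffel g c ?x ?u (K t)) (F c t w)" for h
    using metric_compatible[OF c pos_img[OF t(2)], of ?u "K t" "F c t w"]
    by (simp add: gform_simps parallel_rhs_def linear_cmul[OF dgform_linear(1)[OF c pos_img[OF t(2)]]] algebra_simps)
  with d show ?thesis by (simp add: has_vector_derivative_def)
qed

lemma form_chart_indep:
  assumes c: "c \<in> A" "d \<in> A" and t: "t \<in> {a..b}" "t \<in> dom c" "t \<in> dom d"
  shows "gform g d (pos d t) (F d t v) (F d t w) = gform g c (pos c t) (F c t v) (F c t w)"
  using g_trans'[OF c pos_overlap[OF t(2,3)]] F_trans[OF c(1) t(1,2) c(2) t(3)] pos_trans[OF c(1) t(2)] by simp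

text \<open>Parallel transport preserves the metric, so one constant form represents it at all
  instants.\<close>

lemma form_eq:
  assumes c: "c \<in> A" and t: "t \<in> {a..b}" "t \<in> dom c"
  shows "gform g c (pos c t) (F c t v) (F c t w) = form v w"
proof -
  \<comment> \<open>Each instant uses its own chart; by chart independence \<open>m\<close> is
    nevertheless given by a single chart near each instant, and can be differentiated there.\<close>
  define m where "m s = gform g (chart0 s) (pos (chart0 s) s) (F (chart0 s) s v) (F (chart0 s) s w)" for s
  have m: "m s = gform g d (pos d s) (F d s v) (F d s w)" if "d \<in> A" "s \<in> {a..b}" "s \<in> dom d" for d s
    unfolding m_def by (rule form_chart_indep[OF that(1) chart0(1) that(2,3) chart0(2)])
  have "(m has_derivative (\<lambda>h. 0)) (at s within {a..b})" if s: "s \<in> {a..b}" for s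
  proof -
    let ?d = "chart0 s"
    have "((\<lambda>r. gform g ?d (pos ?d r) (F ?d r v) (F ?d r w)) has_derivative (\<lambda>h. 0)) (at s within {a..b})"
      using F_gform_has_derivative[OF chart0(1) s chart0(2) subset_refl F_deriv[OF chart0(1) s chart0(2)]]
      by (simp add: has_vector_derivative_def parallel_rhs_def linear_0[OF gform_linear(1)])
    then show ?thesis
    proof (rule has_derivative_transform_eventually)
      show "\<forall>\<^sub>F r in at s within {a..b}. gform g ?d (pos ?d r) (F ?d r v) (F ?d r w) = m r"
        using dom_eventually[OF chart0(1) s chart0(2) subset_refl]
        unfolding eventually_at_filter by eventually_elim (use m[OF chart0(1)] in auto)
    qed (use m[OF chart0(1) s chart0(2)] s in auto)
  qed
  from has_derivative_zero_unique[OF _ this t(1) t0] have "m t = m t0" by simp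
  then show ?thesis unfolding m[OF c t] by (simp add: m_def form_def metric_at_def F_t0 pos_def)
qed

lemma form_matrix:
  "form v w = v \<bullet> (g (chart0 t0) (pos (chart0 t0) t0) *v w)" "invertible (g (chart0 t0) (pos (chart0 t0) t0))"
  using g_invertible[OF chart0(1) pos_img[OF chart0(2)]] by (auto simp: form_def metric_at_def gform_def pos_def)

text \<open>The Jacobi operator of the curve in the frame; by \<open>F_jac\<close> the choice of
  chart does not matter.\<close>

definition jac :: "real \<Rightarrow> real^'n \<Rightarrow> real^'n" where
  "jac t v = inv (F (chart0 t) t) (curvature g (chart0 t) (pos (chart0 t) t) (vel (chart0 t) t)
     (F (chart0 t) t v) (vel (chart0 t) t))"

lemma F_jac:
  assumes c: "c \<in> A" and t: "t \<in> {a..b}" "t \<in> dom c"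
  shows "F c t (jac t v) = curvature g c (pos c t) (vel c t) (F c t v) (vel c t)"
proof -
  note c0 = chart0[of t]
  have "F c t (jac t v) = dtr (chart0 t) c (pos (chart0 t) t) (F (chart0 t) t (jac t v))"
    by (rule F_trans[OF c0(1) t(1) c0(2) c t(2)])
  also have "F (chart0 t) t (jac t v) = curvature g (chart0 t) (pos (chart0 t) t) (vel (chart0 t) t)
     (F (chart0 t) t v) (vel (chart0 t) t)"
    unfolding jac_def by (rule F_inv[OF c0(1) t(1) c0(2)])
  finally show ?thesis
    by (simp add: curvature_trans[OF c0(1) c pos_overlap[OF c0(2) t(2)]] pos_trans[OF c0]
        vel_trans[OF c0(1) c t(1) c0(2) t(2)] F_trans[OF c0(1) t(1) c0(2) c t(2)])
qed

lemma jac_linear: "t \<in> {a..b} \<Longrightarrow> linear (jac t)"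
proof -
  assume t: "t \<in> {a..b}"
  note c = chart0[of t]
  note l = curvature_linear(2)[OF c(1) pos_img[OF c(2)]] and lF = F_linear[OF c(1) t c(2)]
  have "F (chart0 t) t (jac t (v + w)) = F (chart0 t) t (jac t v + jac t w)"
    "F (chart0 t) t (jac t (r *\<^sub>R v)) = F (chart0 t) t (r *\<^sub>R jac t v)" for v w r
    by (simp_all add: F_jac[OF c(1) t c(2)] linear_add[OF lF] linear_cmul[OF lF] linear_add[OF l] linear_cmul[OF l])
  then show ?thesis unfolding F_eq_iff[OF c(1) t c(2)] by (intro linearI)
qed

lemma jac_sym:
  assumes t: "t \<in> {a..b}"
  shows "form (jac t v) w = form v (jac t w)"
proof -
  note c = chart0[of t]
  show ?thesis
    unfolding form_eq[OF c(1) t c(2), symmetric] F_jac[OF c(1) t c(2)]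
    by (rule curvature_pair_sym[OF c(1) pos_img[OF c(2)]])
qed

lemma F_cont:
  assumes c: "c \<in> A"
  shows "continuous_on ({a..b} \<inter> dom c) (\<lambda>t. F c t v)"
  unfolding continuous_on_eq_continuous_within
proof
  fix t assume t: "t \<in> {a..b} \<inter> dom c"
  show "continuous (at t within ({a..b} \<inter> dom c)) (\<lambda>t. F c t v)"
    by (rule continuous_within_subset[OF has_vector_derivative_continuous[OF F_deriv[OF c]]]) (use t in auto)
qed

text \<open>Pairing with \<open>w\<close> turns the inverse frame in \<open>jac\<close> into the
  metric pairing of the curvature with \<open>F c s w\<close>, whose continuity is visible in a
  chart around each instant.\<close>

lemma jac_cont: "continuous_on {a..b} (\<lambda>t. jac t v)"
proof (rule continuous_on_by_form[OF form_matrix])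
  fix w
  show "continuous_on {a..b} (\<lambda>t. form (jac t v) w)"
    unfolding continuous_on_eq_continuous_within
  proof
    fix t assume t: "t \<in> {a..b}"
    let ?c = "chart0 t" and ?S = "{a..b} \<inter> dom (chart0 t)"
    note c = chart0[of t]
    have R: "continuous_on ?S (\<lambda>s. curvature g ?c (pos ?c s) u v w)" for u v w
      by (rule continuous_on_compose2[OF curvature_cont[OF c(1)] pos_continuous[OF c(1)]]) (auto intro: pos_img)
    have "continuous_on ?S (\<lambda>s. curvature g ?c (pos ?c s) (vel ?c s) v w)" for v w
      by (rule continuous_on_linear_family[where f="\<lambda>s u. curvature g ?c (pos ?c s) u v w", OF _ R vel_continuous[OF c(1)]])
        (use curvature_linear(1)[OF c(1) pos_img] in auto)
    then have "continuous_on ?S (\<lambda>s. curvature g ?c (pos ?c s) (vel ?c s) (F ?c s v) w)" for w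
      by (intro continuous_on_linear_family[where f="\<lambda>s u. curvature g ?c (pos ?c s) (vel ?c s) u w", OF _ _ F_cont[OF c(1)]]
        curvature_linear(2)[OF c(1) pos_img]) auto
    then have "continuous_on ?S (\<lambda>s. curvature g ?c (pos ?c s) (vel ?c s) (F ?c s v) (vel ?c s))"
      by (intro continuous_on_linear_family[where f="\<lambda>s. curvature g ?c (pos ?c s) (vel ?c s) (F ?c s v)", OF _ _ vel_continuous[OF c(1)]]
        curvature_linear(3)[OF c(1) pos_img]) auto
    moreover have "continuous_on ?S (\<lambda>s. g ?c (pos ?c s))"
      by (rule continuous_on_compose2[OF smooth_on_continuous[OF g_smooth[OF c(1)]] pos_continuous[OF c(1)]]) (auto intro: pos_img)
    ultimately have "continuous_on ?S (\<lambda>s. gform g ?c (pos ?c s) (curvature g ?c (pos ?c s) (vel ?c s) (F ?c s v) (vel ?c s)) (F ?c s w))"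
      unfolding gform_def
      by (intro continuous_on_inner bounded_bilinear.continuous_on[OF matrix_vector_mult_bounded_bilinear] F_cont[OF c(1)])
    then have "continuous_on ?S (\<lambda>s. form (jac s v) w)"
      by (rule continuous_on_eq) (simp add: F_jac[OF c(1), symmetric] form_eq[OF c(1)])
    then have "continuous (at t within ?S) (\<lambda>s. form (jac s v) w)"
      using t c(2) by (simp add: continuous_on_eq_continuous_within)
    moreover have "at t within ?S = at t within {a..b}"
    proof -
      obtain e where e: "e > 0" "\<forall>s\<in>{a..b}. \<bar>s - t\<bar> < e \<longrightarrow> s \<in> dom ?c" using dom_near[OF c(1) t c(2)] by blast
      show ?thesis
        by (rule at_within_nhd[of t "ball t e"]) (use e in \<open>auto simp: dist_real_def abs_minus_commute\<close>)
    qed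
    ultimately show "continuous (at t within {a..b}) (\<lambda>s. form (jac s v) w)" by simp
  qed
qed

definition solution :: "real \<Rightarrow> real \<Rightarrow> (real \<Rightarrow> real^'n) \<Rightarrow> (real \<Rightarrow> real^'n) \<Rightarrow> bool" where
  "solution p q j j' \<longleftrightarrow> (\<forall>t\<in>{p..q}. (j has_vector_derivative j' t) (at t within {p..q}) \<and>
     (j' has_vector_derivative jac t (j t)) (at t within {p..q}))"

section \<open>Jacobi fields on subintervals as solutions in the frame\<close>

context
  fixes p q :: real and \<eta> :: "real \<Rightarrow> 'm"
  assumes pq: "p < q" "{p..q} \<subseteq> {a..b}" and eta: "\<And>t. t \<in> {p..q} \<Longrightarrow> \<eta> t = \<gamma> t"
begin

lemma eta_dom: "t \<in> {p..q} \<Longrightarrow> \<eta> t \<in> fst c \<longleftrightarrow> t \<in> dom c"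
  by (simp add: eta dom_def)

lemma dom_eventually_sub: "c \<in> A \<Longrightarrow> t \<in> {p..q} \<Longrightarrow> t \<in> dom c \<Longrightarrow> \<forall>\<^sub>F s in at t within {p..q}. s \<in> {p..q} \<and> s \<in> dom c"
  using dom_eventually[of c t "{p..q}"] pq(2)
  by (auto simp: eventually_at_filter elim!: eventually_mono)

lemma velocity_eta: "c \<in> A \<Longrightarrow> t \<in> {p..q} \<Longrightarrow> t \<in> dom c \<Longrightarrow> velocity \<eta> {p..q} c t = vel c t"
  using velocity_eq pq eta by blast

text \<open>In a parallel frame the covariant derivative is the ordinary derivative of the
  components: the transport term cancels the Christoffel term.\<close>

lemma field_deriv_of_components:
  assumes c: "c \<in> A" and t: "t \<in> {p..q}" "t \<in> dom c"
    and K: "\<And>s. s \<in> {p..q} \<Longrightarrow> s \<in> dom c \<Longrightarrow> K c s = F c s (k s)"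
    and k: "(k has_vector_derivative k') (at t within {p..q})"
  shows "K c differentiable (at t within {p..q})" "cov_deriv g \<eta> {p..q} K c t = F c t k'"
proof -
  have t': "t \<in> {a..b}" using t pq by auto
  have ev: "\<forall>\<^sub>F s in at t within {p..q}. linear (F c s)"
    using dom_eventually_sub[OF c t] by eventually_elim (use pq(2) in \<open>auto intro!: F_linear[OF c]\<close>)
  \<comment> \<open>The added and subtracted \<open>k'\<close> cancel: \<open>parallel_rhs\<close>
    is applied to \<open>F c t (k t)\<close>.\<close>
  have "((\<lambda>s. F c s (k s)) has_derivative (\<lambda>h. h *\<^sub>R parallel_rhs c t (k' + F c t (k t) - k') + F c t (h *\<^sub>R k'))) (at t within {p..q})"
    by (rule has_derivative_eq_rhs[OF has_derivative_linear_family[where f="F c" and f'="\<lambda>h v. h *\<^sub>R parallel_rhs c t (F c t v)",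
            OF ev F_linear[OF c t' t(2)] t(1) _ k[unfolded has_vector_derivative_def]]])
      (use has_vector_derivative_within_subset[OF F_deriv[OF c t' t(2)] pq(2)] in
        \<open>auto simp: has_vector_derivative_def intro!: linear_compose_scale_right linear_compose[OF F_linear[OF c t' t(2)] parallel_rhs_linear[OF c t(2)], unfolded o_def]\<close>)
  then have "((\<lambda>s. F c s (k s)) has_vector_derivative parallel_rhs c t (F c t (k t)) + F c t k') (at t within {p..q})"
    by (simp add: has_vector_derivative_def linear_cmul[OF F_linear[OF c t' t(2)]] scaleR_add_right)
  then have d: "(K c has_vector_derivative parallel_rhs c t (F c t (k t)) + F c t k') (at t within {p..q})"
    unfolding has_vector_derivative_def
  proof (rule has_derivative_transform_eventually)
    show "\<forall>\<^sub>F s in at t within {p..q}. F c s (k s) = K c s"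
      using dom_eventually_sub[OF c t] by eventually_elim (use K in auto)
  qed (use K t in auto)
  show "K c differentiable (at t within {p..q})" using d differentiableI_vector by blast
  show "cov_deriv g \<eta> {p..q} K c t = F c t k'"
    unfolding cov_deriv_def has_vector_derivative_Icc_unique[OF pq(1) t(1) d]
      velocity_eta[OF c t] K[OF t] eta[OF t(1)] pos_def[symmetric]
    by (simp add: parallel_rhs_def)
qed

text \<open>The converse passage. Pairing with the parallel columns of the frame recovers the
  components without differentiating the inverse frame.\<close>

lemma components_deriv_of_field:
  assumes c: "c \<in> A" and t: "t \<in> {p..q}" "t \<in> dom c"
    and K: "\<And>s. s \<in> {p..q} \<Longrightarrow> s \<in> dom c \<Longrightarrow> K c s = F c s (k s)"
    and d: "K c differentiable (at t within {p..q})"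
  shows "(k has_vector_derivative inv (F c t) (cov_deriv g \<eta> {p..q} K c t)) (at t within {p..q})"
proof (rule has_vector_derivative_by_form[OF form_matrix])
  fix w
  have t': "t \<in> {a..b}" using t pq by auto
  from F_gform_has_derivative[OF c t' t(2) pq(2) d[unfolded vector_derivative_works]]
  have "((\<lambda>s. gform g c (pos c s) (K c s) (F c s w)) has_vector_derivative
      gform g c (pos c t) (cov_deriv g \<eta> {p..q} K c t) (F c t w)) (at t within {p..q})"
    unfolding cov_deriv_def velocity_eta[OF c t] eta[OF t(1)] pos_def[symmetric] .
  moreover have "gform g c (pos c t) (cov_deriv g \<eta> {p..q} K c t) (F c t w) = form (inv (F c t) (cov_deriv g \<eta> {p..q} K c t)) w"
    by (simp add: form_eq[OF c t' t(2), symmetric] F_inv[OF c t' t(2)])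
  ultimately have "((\<lambda>s. gform g c (pos c s) (K c s) (F c s w)) has_vector_derivative
      form (inv (F c t) (cov_deriv g \<eta> {p..q} K c t)) w) (at t within {p..q})" by simp
  then show "((\<lambda>s. form (k s) w) has_vector_derivative form (inv (F c t) (cov_deriv g \<eta> {p..q} K c t)) w) (at t within {p..q})"
    unfolding has_vector_derivative_def
  proof (rule has_derivative_transform_eventually)
    show "\<forall>\<^sub>F s in at t within {p..q}. gform g c (pos c s) (K c s) (F c s w) = form (k s) w"
      using dom_eventually_sub[OF c t] by eventually_elim (use K pq(2) in \<open>auto simp: form_eq[OF c]\<close>)
  qed (use K[OF t] t form_eq[OF c t' t(2)] in auto)
qed

lemma jacobi_of_solution:
  assumes "solution p q j j'"
  shows "\<exists>J. jacobi_field A g \<eta> {p..q} J \<and> (\<forall>t\<in>{p..q}. value_at A \<eta> J t = F (chart0 t) t (j t) \<and>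
    value_at A \<eta> (cov_deriv g \<eta> {p..q} J) t = F (chart0 t) t (j' t))"
proof -
  define J where "J c t = F c t (j t)" for c t
  have d: "(j has_vector_derivative j' t) (at t within {p..q})" "(j' has_vector_derivative jac t (j t)) (at t within {p..q})"
    if "t \<in> {p..q}" for t using assms that by (auto simp: solution_def)
  have 1: "J c differentiable (at t within {p..q})" "cov_deriv g \<eta> {p..q} J c t = F c t (j' t)"
    if "c \<in> A" "t \<in> {p..q}" "t \<in> dom c" for c t
    by (rule field_deriv_of_components[OF that _ d(1)[OF that(2)]], simp add: J_def)+
  have 2: "cov_deriv g \<eta> {p..q} J c differentiable (at t within {p..q})"
    "cov_deriv g \<eta> {p..q} (cov_deriv g \<eta> {p..q} J) c t = F c t (jac t (j t))"
    if "c \<in> A" "t \<in> {p..q}" "t \<in> dom c" for c t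
    by (rule field_deriv_of_components[OF that _ d(2)[OF that(2)]], simp add: 1(2) that)+
  have "jacobi_field A g \<eta> {p..q} J"
    unfolding jacobi_field_def
  proof (intro conjI)
    show "vector_field_along A \<eta> {p..q} J"
      unfolding vector_field_along_def
    proof (intro ballI impI)
      fix c d t assume "c \<in> A" "d \<in> A" "t \<in> {p..q}" "\<eta> t \<in> fst c \<inter> fst d"
      then show "J d t = frechet_derivative (transition c d) (at (snd c (\<eta> t))) (J c t)"
        using F_trans[of c t d "j t"] pq(2) by (auto simp: J_def dom_def dtr_def pos_def eta)
    qed
    show "differentiable_along A \<eta> {p..q} J" "differentiable_along A \<eta> {p..q} (cov_deriv g \<eta> {p..q} J)"
      unfolding differentiable_along_def using 1(1) 2(1) eta_dom by auto
    show "\<forall>c\<in>A. \<forall>t\<in>{p..q}. \<eta> t \<in> fst c \<longrightarrow> cov_deriv g \<eta> {p..q} (cov_deriv g \<eta> {p..q} J) c t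
        - curvature g c (snd c (\<eta> t)) (velocity \<eta> {p..q} c t) (J c t) (velocity \<eta> {p..q} c t) = 0"
    proof (intro ballI impI)
      fix c t assume c: "c \<in> A" and t: "t \<in> {p..q}" and "\<eta> t \<in> fst c"
      then have tD: "t \<in> dom c" using eta_dom by auto
      show "cov_deriv g \<eta> {p..q} (cov_deriv g \<eta> {p..q} J) c t
        - curvature g c (snd c (\<eta> t)) (velocity \<eta> {p..q} c t) (J c t) (velocity \<eta> {p..q} c t) = 0"
        unfolding 2(2)[OF c t tD] velocity_eta[OF c t tD] eta[OF t] pos_def[symmetric] J_def
        using F_jac[OF c _ tD] t pq(2) by auto
    qed
  qed
  moreover have "value_at A \<eta> J t = F (chart0 t) t (j t)"
    "value_at A \<eta> (cov_deriv g \<eta> {p..q} J) t = F (chart0 t) t (j' t)" if "t \<in> {p..q}" for t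
    using 1(2)[OF chart0(1) that chart0(2)] by (simp_all add: value_at_def eta[OF that] J_def)
  ultimately show ?thesis by blast
qed

lemma solution_of_jacobi:
  assumes J: "jacobi_field A g \<eta> {p..q} J"
  shows "\<exists>j j'. solution p q j j' \<and> (\<forall>t\<in>{p..q}. value_at A \<eta> J t = F (chart0 t) t (j t) \<and>
    value_at A \<eta> (cov_deriv g \<eta> {p..q} J) t = F (chart0 t) t (j' t))"
proof -
  let ?K = "cov_deriv g \<eta> {p..q} J"
  define j where "j t = inv (F (chart0 t) t) (J (chart0 t) t)" for t
  define j' where "j' t = inv (F (chart0 t) t) (?K (chart0 t) t)" for t
  have ab: "t \<in> {a..b}" if "t \<in> {p..q}" for t using that pq(2) by auto
  have Jj: "J c t = F c t (j t)" if c: "c \<in> A" and t: "t \<in> {p..q}" "t \<in> dom c" for c t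
  proof -
    note c0 = chart0[of t]
    have "J c t = dtr (chart0 t) c (pos (chart0 t) t) (J (chart0 t) t)"
    proof -
      have "vector_field_along A \<eta> {p..q} J" using J by (simp add: jacobi_field_def)
      from this[unfolded vector_field_along_def, rule_format, OF c0(1) c t(1)]
      show ?thesis using c0 c t(2) by (simp add: dtr_def pos_def eta_dom[OF t(1)] eta[OF t(1)] dom_def)
    qed
    then show ?thesis
      using F_trans[OF c0(1) ab[OF t(1)] c0(2) c t(2), of "j t"] F_inv[OF c0(1) ab[OF t(1)] c0(2)] by (simp add: j_def)
  qed
  have dJ: "J c differentiable (at t within {p..q})" "?K c differentiable (at t within {p..q})"
    "cov_deriv g \<eta> {p..q} ?K c t = curvature g c (pos c t) (vel c t) (J c t) (vel c t)"
    if c: "c \<in> A" and t: "t \<in> {p..q}" "t \<in> dom c" for c t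
  proof -
    have e: "\<eta> t \<in> fst c" using t eta_dom by simp
    show "J c differentiable (at t within {p..q})" "?K c differentiable (at t within {p..q})"
      using J c t(1) e unfolding jacobi_field_def differentiable_along_def by blast+
    have "cov_deriv g \<eta> {p..q} ?K c t - curvature g c (snd c (\<eta> t)) (velocity \<eta> {p..q} c t) (J c t) (velocity \<eta> {p..q} c t) = 0"
      using J c t(1) e unfolding jacobi_field_def by blast
    then show "cov_deriv g \<eta> {p..q} ?K c t = curvature g c (pos c t) (vel c t) (J c t) (vel c t)"
      by (simp add: velocity_eta[OF c t] eta[OF t(1)] pos_def)
  qed
  have d1: "(j has_vector_derivative inv (F c t) (?K c t)) (at t within {p..q})"
    if "c \<in> A" "t \<in> {p..q}" "t \<in> dom c" for c t
    by (rule components_deriv_of_field[where K=J and k=j, OF that Jj[OF that(1)] dJ(1)[OF that]])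
  \<comment> \<open>Every chart computes the derivative of the same curve \<open>j\<close>;
    uniqueness of that derivative shows that the covariant derivative has the same components in all
    charts.\<close>
  have Kj: "?K c t = F c t (j' t)" if c: "c \<in> A" and t: "t \<in> {p..q}" "t \<in> dom c" for c t
    using has_vector_derivative_Icc_unique[OF pq(1) t(1) d1[OF c t]]
      has_vector_derivative_Icc_unique[OF pq(1) t(1) d1[OF chart0(1) t(1) chart0(2)]]
      F_inv[OF c ab[OF t(1)] t(2)] by (metis j'_def)
  have d2: "(j' has_vector_derivative jac t (j t)) (at t within {p..q})" if t: "t \<in> {p..q}" for t
  proof -
    note c = chart0[of t]
    have "(j' has_vector_derivative inv (F (chart0 t) t) (cov_deriv g \<eta> {p..q} ?K (chart0 t) t)) (at t within {p..q})"
      by (rule components_deriv_of_field[where K="?K" and k=j', OF c(1) t c(2) Kj[OF c(1)] dJ(2)[OF c(1) t c(2)]])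
    then show ?thesis
      unfolding dJ(3)[OF c(1) t c(2)] Jj[OF c(1) t c(2)] F_jac[OF c(1) ab[OF t] c(2), symmetric] F_inv'[OF c(1) ab[OF t] c(2)] .
  qed
  have "solution p q j j'"
    unfolding solution_def using d2 d1[OF chart0(1) _ chart0(2)] by (simp add: j'_def)
  moreover have "value_at A \<eta> J t = F (chart0 t) t (j t)"
    "value_at A \<eta> ?K t = F (chart0 t) t (j' t)" if "t \<in> {p..q}" for t
    using Jj[OF chart0(1) that chart0(2)] Kj[OF chart0(1) that chart0(2)] by (simp_all add: value_at_def eta[OF that])
  ultimately show ?thesis by blast
qed

end

end

lemma (in curve_along) parallel_frame_exists:
  assumes t0: "t0 \<in> {a..b}"
  shows "\<exists>F. parallel_frame A g \<gamma> a b F t0"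
proof -
  interpret L: linear_system A dom parallel_rhs "\<lambda>c d t. dtr c d (pos c t)" a b by (rule parallel_system)
  obtain F where F: "L.frame a b F" using L.frame_exists by blast
  let ?c = "chart_at A (\<gamma> t0)"
  have c: "?c \<in> A" "t0 \<in> dom ?c" using chart_at by (auto simp: dom_def)
  note f = L.frameD[OF F c(1) t0 c(2)]
  have M: "linear (inv (F ?c t0))" "bij (inv (F ?c t0))"
    using inj_linear_imp_inv_linear[OF f(1) bij_is_inj[OF f(2)]] bij_imp_bij_inv[OF f(2)] .
  have "parallel_frame A g \<gamma> a b (\<lambda>c t v. F c t (inv (F ?c t0) v)) t0"
    by unfold_locales (use L.frame_translate[OF F M] t0 f(2) in \<open>auto simp: bij_is_surj surj_f_inv_f\<close>)
  then show ?thesis by blast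
qed

section \<open>The index of a symmetric bilinear form\<close>

definition neg_def_on :: "'v::real_vector set \<Rightarrow> ('v \<Rightarrow> 'v \<Rightarrow> real) \<Rightarrow> bool" where
  "neg_def_on W B \<longleftrightarrow> (\<forall>w\<in>W. w \<noteq> 0 \<longrightarrow> B w w < 0)"

text \<open>The dimensions in question are bounded, and the zero subspace contributes 0, so the
  maximum in \<open>neg_index\<close> is a genuine one.\<close>

lemma
  fixes S :: "'v::euclidean_space set"
  assumes S: "subspace S"
  shows neg_index_attained: "\<exists>W. subspace W \<and> W \<subseteq> S \<and> neg_def_on W B \<and> dim W = neg_index S B"
    and neg_index_ge: "subspace W \<Longrightarrow> W \<subseteq> S \<Longrightarrow> neg_def_on W B \<Longrightarrow> dim W \<le> neg_index S B"
proof -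
  let ?D = "{dim W |W. subspace W \<and> W \<subseteq> S \<and> (\<forall>w\<in>W. w \<noteq> 0 \<longrightarrow> B w w < 0)}"
  have "?D \<subseteq> {..DIM('v)}" using dim_subset_UNIV by auto
  then have fin: "finite ?D" by (rule finite_subset) simp
  have "0 \<in> ?D"
    using S subspace_0 by (auto intro!: exI[of _ "{0}"] simp: subspace_single_0)
  then have "Max ?D \<in> ?D" using fin by (intro Max_in) auto
  then show "\<exists>W. subspace W \<and> W \<subseteq> S \<and> neg_def_on W B \<and> dim W = neg_index S B"
    unfolding neg_index_def neg_def_on_def by auto
  show "dim W \<le> neg_index S B" if "subspace W" "W \<subseteq> S" "neg_def_on W B"
    unfolding neg_index_def by (rule Max_ge[OF fin]) (use that in \<open>auto simp: neg_def_on_def\<close>)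
qed

text \<open>Only signs on the diagonal matter; this absorbs the positive factor \<open>t - a\<close>
  later on.\<close>

lemma neg_index_cong:
  assumes "\<And>w. w \<in> S \<Longrightarrow> B w w < 0 \<longleftrightarrow> B' w w < 0"
  shows "neg_index S B = neg_index S B'"
proof -
  have "(\<forall>w\<in>W. w \<noteq> 0 \<longrightarrow> B w w < 0) \<longleftrightarrow> (\<forall>w\<in>W. w \<noteq> 0 \<longrightarrow> B' w w < 0)" if "W \<subseteq> S" for W
    using that assms by blast
  then have "{dim W |W. subspace W \<and> W \<subseteq> S \<and> (\<forall>w\<in>W. w \<noteq> 0 \<longrightarrow> B w w < 0)} =
    {dim W |W. subspace W \<and> W \<subseteq> S \<and> (\<forall>w\<in>W. w \<noteq> 0 \<longrightarrow> B' w w < 0)}" by blast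
  then show ?thesis unfolding neg_index_def by simp
qed

text \<open>Serves to move the coindex from the Lagrangian of all \<open>(0, w)\<close> to
  \<open>real ^ 'n\<close> itself.\<close>

lemma neg_index_image:
  fixes f :: "'a::euclidean_space \<Rightarrow> 'b::euclidean_space"
  assumes f: "linear f" "inj f"
  shows "neg_index (range f) B = neg_index UNIV (\<lambda>x y. B (f x) (f y))"
proof -
  have "{dim W |W. subspace W \<and> W \<subseteq> range f \<and> (\<forall>w\<in>W. w \<noteq> 0 \<longrightarrow> B w w < 0)} =
    {dim W |W. subspace W \<and> W \<subseteq> UNIV \<and> (\<forall>w\<in>W. w \<noteq> 0 \<longrightarrow> B (f w) (f w) < 0)}" (is "?L = ?R")
  proof (intro subset_antisym subsetI)
    fix d assume "d \<in> ?L"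
    then obtain W where W: "subspace W" "W \<subseteq> range f" "\<And>w. w \<in> W \<Longrightarrow> w \<noteq> 0 \<Longrightarrow> B w w < 0" "d = dim W" by blast
    let ?U = "f -` W"
    have "f ` ?U = W" using W(2) by auto
    then have "dim ?U = d" using dim_image_eq[OF f(1) inj_on_subset[OF f(2) subset_UNIV], of ?U] W(4) by simp
    moreover have "subspace ?U" using f(1) W(1) by (rule linear_subspace_vimage)
    moreover have "B (f w) (f w) < 0" if "w \<in> ?U" "w \<noteq> 0" for w
      using W(3) that f linear_injective_0 by blast
    ultimately show "d \<in> ?R" by blast
  next
    fix d assume "d \<in> ?R"
    then obtain W where W: "subspace W" "\<And>w. w \<in> W \<Longrightarrow> w \<noteq> 0 \<Longrightarrow> B (f w) (f w) < 0" "d = dim W" by blast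
    have "dim (f ` W) = d" using dim_image_eq[OF f(1) inj_on_subset[OF f(2) subset_UNIV], of W] W(3) by simp
    moreover have "subspace (f ` W)" using f(1) W(1) by (rule linear_subspace_image)
    moreover have "B y y < 0" if "y \<in> f ` W" "y \<noteq> 0" for y
      using W(2) that linear_0[OF f(1)] by auto
    ultimately show "d \<in> ?L" by blast
  qed
  then show ?thesis unfolding neg_index_def by simp
qed

text \<open>A negative definite subspace meets \<open>K\<close> only in 0, so the two dimensions fit
  together into the whole space.\<close>

lemma neg_index_add_dim_le:
  fixes B :: "'v::euclidean_space \<Rightarrow> 'v \<Rightarrow> real"
  assumes K: "subspace K" "\<And>x. x \<in> K \<Longrightarrow> B x x \<ge> 0"
  shows "neg_index UNIV B + dim K \<le> DIM('v)"
proof -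
  obtain W where W: "subspace W" "neg_def_on W B" "dim W = neg_index UNIV B"
    using neg_index_attained[OF subspace_UNIV, of B] by metis
  have "W \<inter> K \<subseteq> {0}" using W(2) K(2) unfolding neg_def_on_def by force
  then have "dim (W \<inter> K) = 0" using dim_eq_0 by blast
  then have "dim {x + y |x y. x \<in> W \<and> y \<in> K} = dim W + dim K"
    using dim_sums_Int[OF W(1) K(1)] by linarith
  then show ?thesis using W(3) dim_subset_UNIV[of "{x + y |x y. x \<in> W \<and> y \<in> K}"] by linarith
qed

text \<open>\<open>N\<close> is a negative definite subspace of maximal dimension and
  \<open>P\<close> its orthogonal complement for \<open>B\<close>. Maximality makes \<open>B\<close>
  nonnegative on \<open>P\<close>, and nondegeneracy then makes it positive definite there.\<close>

lemma symmetric_form_sylvester: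
  fixes B :: "'v::euclidean_space \<Rightarrow> 'v \<Rightarrow> real"
  assumes B: "bilinear B" and sym: "\<And>x y. B x y = B y x" and nd: "\<And>x. (\<And>y. B x y = 0) \<Longrightarrow> x = 0"
  shows "pos_index UNIV B + neg_index UNIV B = DIM('v)"
proof -
  have l1: "linear (\<lambda>x. B x y)" and l2: "linear (B x)" for x y
    using B by (auto simp: bilinear_def)
  note Bs = linear_add[OF l1] linear_add[OF l2] linear_cmul[OF l1] linear_cmul[OF l2]
  obtain N where N: "subspace N" "neg_def_on N B" "dim N = neg_index UNIV B"
    using neg_index_attained[OF subspace_UNIV, of B] by metis
  define P where "P = {x. \<forall>n\<in>N. B x n = 0}"
  have P: "subspace P" unfolding P_def subspace_def using Bs by (auto simp: linear_0[OF l1])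
  \<comment> \<open>\<open>T\<close> represents \<open>B\<close> through the Euclidean inner
    product, so that \<open>P\<close> is the Euclidean orthogonal complement of the image of
    \<open>N\<close> under \<open>T\<close>; this bounds its dimension from below.\<close>
  define T where "T y = (\<Sum>e\<in>Basis. B e y *\<^sub>R e)" for y
  have T: "B x y = x \<bullet> T y" for x y
    using linear_basis_expansion[OF l1[of y], of x] by (simp add: T_def inner_sum_right mult.commute)
  have lT: "linear T" by (rule linearI) (simp_all add: T_def Bs scaleR_add_left sum.distrib scaleR_sum_right)
  have "P = {y \<in> UNIV. \<forall>x\<in>T ` N. orthogonal x y}"
    by (auto simp: P_def T orthogonal_def inner_commute)
  then have "dim P + dim (T ` N) = DIM('v)"
    using dim_subspace_orthogonal_to_vectors[OF linear_subspace_image[OF lT N(1)] subspace_UNIV] by simp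
  then have dimP: "dim P + dim N \<ge> DIM('v)" using dim_image_le[OF lT, of N] by linarith
  have Ppos: "B x x \<ge> 0" if x: "x \<in> P" for x
  proof (rule ccontr)
    assume "\<not> B x x \<ge> 0"
    then have neg: "B x x < 0" by simp
    have xN: "x \<notin> N" using x neg unfolding P_def by auto
    have x0: "x \<noteq> 0" using N(1) xN subspace_0 by blast
    let ?W = "{u + v |u v. u \<in> N \<and> v \<in> span {x}}"
    have "neg_def_on ?W B"
      unfolding neg_def_on_def
    proof (intro ballI impI)
      fix w assume "w \<in> ?W" "w \<noteq> 0"
      then obtain n r where n: "n \<in> N" "w = n + r *\<^sub>R x" by (auto simp: span_singleton)
      have "B w w = B n n + r * r * B x x"
        using x n sym[of n x] by (simp add: Bs P_def algebra_simps)
      moreover have "B n n < 0 \<or> n = 0" using N(2) n by (auto simp: neg_def_on_def)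
      moreover have "B 0 0 = 0" by (simp add: linear_0[OF l1])
      moreover have "r * r * B x x \<le> 0" "r \<noteq> 0 \<Longrightarrow> r * r * B x x < 0"
        using neg by (auto simp: mult_le_0_iff mult_less_0_iff zero_less_mult_iff)
      ultimately show "B w w < 0" using n \<open>w \<noteq> 0\<close> by (cases "r = 0") auto
    qed
    moreover have "subspace ?W" by (intro subspace_sums N(1) subspace_span)
    ultimately have "dim ?W \<le> dim N" using neg_index_ge[OF subspace_UNIV] N(3) by simp
    moreover have "dim ?W + dim (N \<inter> span {x}) = dim N + dim (span {x})"
      by (rule dim_sums_Int[OF N(1) subspace_span])
    moreover have "N \<inter> span {x} \<subseteq> {0}"
    proof
      fix y assume "y \<in> N \<inter> span {x}"
      then obtain r where r: "y = r *\<^sub>R x" "y \<in> N" by (auto simp: span_singleton)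
      have "r = 0"
      proof (rule ccontr)
        assume "r \<noteq> 0"
        then have "x = (1/r) *\<^sub>R y" using r by simp
        then show False using xN r(2) N(1) subspace_scale by blast
      qed
      then show "y \<in> {0}" using r by simp
    qed
    then have "dim (N \<inter> span {x}) = 0" using dim_eq_0 by blast
    moreover have "dim (span {x}) = 1" using x0 by simp
    ultimately show False by linarith
  qed
  have "N \<inter> P \<subseteq> {0}" using N(2) unfolding neg_def_on_def P_def by force
  then have "dim (N \<inter> P) = 0" using dim_eq_0 by blast
  then have "dim {x + y |x y. x \<in> N \<and> y \<in> P} = DIM('v)"
    using dim_sums_Int[OF N(1) P] dimP dim_subset_UNIV[of "{x + y |x y. x \<in> N \<and> y \<in> P}"] by linarith
  then have sum: "{x + y |x y. x \<in> N \<and> y \<in> P} = UNIV"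
    using dim_eq_full[of "{x + y |x y. x \<in> N \<and> y \<in> P}"] span_eq_iff[THEN iffD2, OF subspace_sums[OF N(1) P]] by simp
  have "B x x > 0" if x: "x \<in> P" "x \<noteq> 0" for x
  proof (rule ccontr)
    assume "\<not> B x x > 0"
    then have x0: "B x x = 0" using Ppos[OF x(1)] by simp
    have "B x y = 0" if y: "y \<in> P" for y
    proof (rule ccontr)
      assume ne: "B x y \<noteq> 0"
      \<comment> \<open>With this coefficient \<open>2 * r * B x y + B y y\<close> equals
        -1.\<close>
      define r where "r = - (B y y + 1) / (2 * B x y)"
      have "r *\<^sub>R x + y \<in> P" using x y P by (simp add: subspace_add subspace_scale)
      then have "0 \<le> B (r *\<^sub>R x + y) (r *\<^sub>R x + y)" by (rule Ppos)
      also have "\<dots> = 2 * r * B x y + B y y" using x0 sym[of y x] by (simp add: Bs algebra_simps)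
      also have "\<dots> = -1" using ne by (simp add: r_def field_simps)
      finally show False by simp
    qed
    moreover have "B x n = 0" if "n \<in> N" for n using x that by (auto simp: P_def)
    ultimately have "B x z = 0" for z
    proof -
      obtain n y where "n \<in> N" "y \<in> P" "z = n + y" using sum by blast
      then show ?thesis using \<open>\<And>y. y \<in> P \<Longrightarrow> B x y = 0\<close> \<open>\<And>n. n \<in> N \<Longrightarrow> B x n = 0\<close> by (simp add: Bs)
    qed
    then show False using nd x(2) by blast
  qed
  then have "neg_def_on P (\<lambda>x y. - B x y)" by (auto simp: neg_def_on_def)
  then have "dim P \<le> pos_index UNIV B"
    unfolding pos_index_def using neg_index_ge[OF subspace_UNIV P] by simp
  moreover have "neg_index UNIV (\<lambda>x y. - B x y) + dim N \<le> DIM('v)"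
    using N(1,2) by (intro neg_index_add_dim_le) (auto simp: neg_def_on_def linear_0[OF l1] intro: less_imp_le)
  ultimately show ?thesis using dimP N(3) by (simp add: pos_index_def)
qed

text \<open>By compactness of the unit sphere, \<open>B s\<close> has a uniform negative margin on a
  maximal negative definite subspace \<open>N\<close>. The quadratic forms vary uniformly on that
  sphere, so \<open>N\<close> stays negative definite for nearby \<open>t\<close>.\<close>

lemma neg_index_lower_semicontinuous:
  fixes B :: "real \<Rightarrow> 'v::euclidean_space \<Rightarrow> 'v \<Rightarrow> real"
  assumes B: "\<And>t. t \<in> S \<Longrightarrow> bilinear (B t)" and c: "\<And>v w. continuous_on S (\<lambda>t. B t v w)" and s: "s \<in> S"
  shows "\<forall>\<^sub>F t in at s within S. neg_index UNIV (B s) \<le> neg_index UNIV (B t)"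
proof -
  obtain N where N: "subspace N" "neg_def_on N (B s)" "dim N = neg_index UNIV (B s)"
    using neg_index_attained[OF subspace_UNIV, of "B s"] by metis
  have Bexp: "B t x x = (\<Sum>i\<in>Basis. \<Sum>k\<in>Basis. (x \<bullet> i) * (x \<bullet> k) * B t i k)" if "t \<in> S" for t x
  proof -
    have l: "linear (\<lambda>x. B t x y)" "linear (B t y)" for y
      using B[OF that] by (auto simp: bilinear_def)
    have "B t x x = (\<Sum>i\<in>Basis. (x \<bullet> i) *\<^sub>R B t i x)" by (rule linear_basis_expansion[OF l(1)])
    also have "\<dots> = (\<Sum>i\<in>Basis. (x \<bullet> i) *\<^sub>R (\<Sum>k\<in>Basis. (x \<bullet> k) *\<^sub>R B t i k))"
      by (intro sum.cong arg_cong2[of _ _ _ _ scaleR] linear_basis_expansion[OF l(2)] refl)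
    finally show ?thesis by (simp add: sum_distrib_left mult.assoc)
  qed
  have "\<exists>m>0. \<forall>x\<in>N. B s x x \<le> - m * (norm x)\<^sup>2"
  \<comment> \<open>Without unit vectors \<open>N\<close> is zero and any margin will do.\<close>
  proof (cases "N \<inter> sphere 0 1 = {}")
    case True
    have "x = 0" if "x \<in> N" for x
    proof (rule ccontr)
      assume "x \<noteq> 0"
      then have "(1 / norm x) *\<^sub>R x \<in> N \<inter> sphere 0 1" using that N(1) by (auto simp: subspace_scale)
      then show False using True by blast
    qed
    moreover have "B s 0 0 = 0" by (simp add: Bexp[OF s])
    ultimately have "\<forall>x\<in>N. B s x x \<le> - 1 * (norm x)\<^sup>2" by fastforce
    then show ?thesis using zero_less_one by blast
  next
    case False
    have "compact (N \<inter> sphere 0 1)"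
      using closed_subspace[OF N(1)] by (intro closed_Int_compact) auto
    moreover have "continuous_on (N \<inter> sphere 0 1) (\<lambda>x. B s x x)"
      unfolding Bexp[OF s] by (intro continuous_intros)
    ultimately obtain y where y: "y \<in> N \<inter> sphere 0 1" "\<And>x. x \<in> N \<inter> sphere 0 1 \<Longrightarrow> B s x x \<le> B s y y"
      using continuous_attains_sup[OF _ False] by blast
    have "y \<noteq> 0" using y(1) by auto
    then have m: "B s y y < 0" using N(2) y(1) by (auto simp: neg_def_on_def)
    have "B s x x \<le> B s y y * (norm x)\<^sup>2" if x: "x \<in> N" for x
    proof (cases "x = 0")
      case True then show ?thesis by (simp add: Bexp[OF s])
    next
      case False
      let ?u = "(1 / norm x) *\<^sub>R x"
      have "?u \<in> N \<inter> sphere 0 1" using x N(1) False by (auto simp: subspace_scale)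
      then have "B s ?u ?u \<le> B s y y" by (rule y(2))
      moreover have "B s ?u ?u = B s x x / (norm x)\<^sup>2"
        unfolding Bexp[OF s] by (simp add: sum_divide_distrib power2_eq_square)
      ultimately show ?thesis using False by (simp add: divide_le_eq)
    qed
    then show ?thesis using m by (intro exI[of _ "- B s y y"]) auto
  qed
  then obtain m where m: "m > 0" "\<And>x. x \<in> N \<Longrightarrow> B s x x \<le> - m * (norm x)\<^sup>2" by blast
  \<comment> \<open>The change from \<open>B s x x\<close> to \<open>B t x x\<close> is at most
    \<open>(norm x)\<^sup>2 * e t\<close>.\<close>
  define e where "e t = (\<Sum>i\<in>Basis. \<Sum>k\<in>Basis. \<bar>B t i k - B s i k\<bar>)" for t
  have "continuous_on S e" unfolding e_def by (intro continuous_intros c)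
  then have "(e \<longlongrightarrow> e s) (at s within S)" using s by (simp add: continuous_on_def)
  then have "\<forall>\<^sub>F t in at s within S. e t < m" using m(1) by (intro order_tendstoD(2)[of e "e s"]) (auto simp: e_def)
  moreover have "\<forall>\<^sub>F t in at s within S. t \<in> S" by (simp add: eventually_at_filter)
  ultimately show ?thesis
  proof eventually_elim
    case (elim t)
    have "neg_def_on N (B t)"
      unfolding neg_def_on_def
    proof (intro ballI impI)
      fix x assume x: "x \<in> N" "x \<noteq> 0"
      have "B t x x - B s x x = (\<Sum>i\<in>Basis. \<Sum>k\<in>Basis. (x \<bullet> i) * (x \<bullet> k) * (B t i k - B s i k))"
        unfolding Bexp[OF elim(2)] Bexp[OF s] by (simp add: sum_subtractf algebra_simps)
      also have "\<dots> \<le> (\<Sum>i\<in>Basis. \<Sum>k\<in>Basis. norm x * norm x * \<bar>B t i k - B s i k\<bar>)"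
      proof (intro sum_mono)
        fix i k :: 'v assume ik: "i \<in> Basis" "k \<in> Basis"
        have "(x \<bullet> i) * (x \<bullet> k) * (B t i k - B s i k) \<le> \<bar>x \<bullet> i\<bar> * \<bar>x \<bullet> k\<bar> * \<bar>B t i k - B s i k\<bar>"
          by (metis abs_ge_self abs_mult)
        also have "\<dots> \<le> norm x * norm x * \<bar>B t i k - B s i k\<bar>"
          by (intro mult_right_mono mult_mono Basis_le_norm ik) auto
        finally show "(x \<bullet> i) * (x \<bullet> k) * (B t i k - B s i k) \<le> norm x * norm x * \<bar>B t i k - B s i k\<bar>" .
      qed
      also have "\<dots> = (norm x)\<^sup>2 * e t" by (simp add: e_def sum_distrib_left power2_eq_square)
      also have "\<dots> < (norm x)\<^sup>2 * m" using elim(1) x(2) by (intro mult_strict_left_mono) auto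
      finally show "B t x x < 0" using m(2)[OF x(1)] by (simp add: mult.commute)
    qed
    then show ?case using neg_index_ge[OF subspace_UNIV N(1)] N(3) by simp
  qed
qed

text \<open>Index and coindex are both lower semicontinuous, and their sum is the dimension as long
  as the form is nondegenerate; so neither can jump, and the interval is connected.\<close>

lemma pos_index_nondegenerate_path:
  fixes B :: "real \<Rightarrow> 'v::euclidean_space \<Rightarrow> 'v \<Rightarrow> real"
  assumes ac: "a \<le> c" and B: "\<And>t. t \<in> {a..c} \<Longrightarrow> bilinear (B t)"
    and sym: "\<And>t x y. t \<in> {a..c} \<Longrightarrow> B t x y = B t y x"
    and nd: "\<And>t x. t \<in> {a..c} \<Longrightarrow> (\<And>y. B t x y = 0) \<Longrightarrow> x = 0"
    and cont: "\<And>v w. continuous_on {a..c} (\<lambda>t. B t v w)"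
  shows "pos_index UNIV (B a) = pos_index UNIV (B c)"
proof (rule connected_local_const[where A="{a..c}"])
  have syl: "pos_index UNIV (B t) + neg_index UNIV (B t) = DIM('v)" if "t \<in> {a..c}" for t
    by (rule symmetric_form_sylvester[OF B[OF that] sym[OF that] nd[OF that]])
  show "\<forall>s\<in>{a..c}. \<forall>\<^sub>F t in at s within {a..c}. pos_index UNIV (B s) = pos_index UNIV (B t)"
  proof
    fix s assume s: "s \<in> {a..c}"
    have "bilinear (\<lambda>x y. - B t x y)" if "t \<in> {a..c}" for t
      using B[OF that] by (auto simp: bilinear_def intro: linear_compose_neg)
    from neg_index_lower_semicontinuous[of "{a..c}" "\<lambda>t x y. - B t x y", OF this continuous_on_minus[OF cont] s]
    have "\<forall>\<^sub>F t in at s within {a..c}. pos_index UNIV (B s) \<le> pos_index UNIV (B t)"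
      unfolding pos_index_def .
    moreover have "\<forall>\<^sub>F t in at s within {a..c}. neg_index UNIV (B s) \<le> neg_index UNIV (B t)"
      by (rule neg_index_lower_semicontinuous[OF B cont s])
    moreover have "\<forall>\<^sub>F t in at s within {a..c}. t \<in> {a..c}" by (simp add: eventually_at_filter)
    ultimately show "\<forall>\<^sub>F t in at s within {a..c}. pos_index UNIV (B s) = pos_index UNIV (B t)"
    proof eventually_elim
      case (elim t)
      then show ?case
        using syl[OF s] syl[OF elim(3)] by linarith
    qed
  qed
qed (use ac in auto)

section \<open>The Lagrangian curve of a linear symmetric system\<close>

text \<open>The variational inequality for the nearest point holds for \<open>u\<close> and for
  \<open>- u\<close>, which turns it into an equality.\<close>

lemma closest_point_subspace:
  fixes L :: "'v::euclidean_space set"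
  assumes L: "subspace L"
  shows "closest_point L z \<in> L" "u \<in> L \<Longrightarrow> (z - closest_point L z) \<bullet> u = 0"
proof -
  have cl: "closed L" and cv: "convex L" and ne: "L \<noteq> {}"
    using L closed_subspace subspace_imp_convex subspace_0 by blast+
  show P: "closest_point L z \<in> L" by (rule closest_point_in_set[OF cl ne])
  assume u: "u \<in> L"
  have "(z - closest_point L z) \<bullet> u \<le> 0"
    using closest_point_dot[OF cv cl subspace_add[OF L P u], of z] by simp
  moreover have "(z - closest_point L z) \<bullet> (- u) \<le> 0"
    using closest_point_dot[OF cv cl subspace_add[OF L P subspace_neg[OF L u]], of z] by simp
  ultimately show "(z - closest_point L z) \<bullet> u = 0" by (simp add: inner_minus_right)
qed

lemma matrix_invertible_of_kernel:
  fixes M :: "real^'n^'n"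
  assumes "\<And>v. M *v v = 0 \<Longrightarrow> v = 0"
  shows "invertible M"
proof -
  have "inj ((*v) M)" using assms linear_injective_0[of "(*v) M"] by auto
  then show ?thesis using invertible_left_inverse matrix_left_invertible_injective by blast
qed

lemma linear_axis_expansion:
  fixes f :: "real^'n \<Rightarrow> 'v::real_vector"
  assumes "linear f"
  shows "f v = (\<Sum>k\<in>UNIV. (v $ k) *\<^sub>R f (axis k 1))"
proof -
  have "f v = f (\<Sum>k\<in>UNIV. (v $ k) *\<^sub>R axis k 1)"
    using basis_expansion[of v] by (simp add: scalar_mult_eq_scaleR)
  then show ?thesis by (simp add: linear_sum[OF assms] linear_cmul[OF assms])
qed

text \<open>The orthogonal projection onto the range of \<open>B t\<close> is \<open>B (B\<^sup>* B)\<^sup>-\<^sup>1 B\<^sup>*\<close>.\<close>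

lemma continuous_on_closest_point_range:
  fixes B :: "'t::metric_space \<Rightarrow> real^'n \<Rightarrow> 'v::euclidean_space"
  assumes lin: "\<And>t. t \<in> S \<Longrightarrow> linear (B t)" and inj: "\<And>t. t \<in> S \<Longrightarrow> inj (B t)"
    and cont: "\<And>w. continuous_on S (\<lambda>t. B t w)"
  shows "continuous_on S (\<lambda>t. closest_point (range (B t)) z)"
proof -
  have sub: "subspace (range (B t))" if "t \<in> S" for t
    using linear_subspace_image[OF lin[OF that] subspace_UNIV] by simp
  have "\<exists>y. closest_point (range (B t)) z = B t y" if "t \<in> S" for t
    using closest_point_subspace(1)[OF sub[OF that]] by blast
  then obtain y where y: "\<And>t. t \<in> S \<Longrightarrow> closest_point (range (B t)) z = B t (y t)" by metis
  define N where "N t = (\<chi> i k. B t (axis i 1) \<bullet> B t (axis k 1))" for t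
  have N: "(N t *v v) $ i = B t (axis i 1) \<bullet> B t v" if "t \<in> S" for t v i
    unfolding linear_axis_expansion[OF lin[OF that], of v]
    by (simp add: N_def matrix_vector_mult_def inner_sum_right mult.commute)
  have yc: "continuous_on S y"
  proof (rule continuous_on_solve)
    show "continuous_on S N" unfolding N_def by (intro continuous_on_vec_lambda continuous_on_inner cont)
    show "continuous_on S (\<lambda>t. \<chi> i. B t (axis i 1) \<bullet> z)"
      by (intro continuous_on_vec_lambda continuous_on_inner cont continuous_on_const)
    fix t assume t: "t \<in> S"
    show "invertible (N t)"
    proof (rule matrix_invertible_of_kernel)
      fix v assume 0: "N t *v v = 0"
      have "B t v \<bullet> B t v = (\<Sum>k\<in>UNIV. (v $ k) *\<^sub>R B t (axis k 1)) \<bullet> B t v"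
        by (rule arg_cong[OF linear_axis_expansion[OF lin[OF t]], of "\<lambda>x. x \<bullet> B t v"])
      also have "\<dots> = (\<Sum>k\<in>UNIV. (v $ k) * (B t (axis k 1) \<bullet> B t v))" by (simp add: inner_sum_left)
      also have "\<dots> = 0" using N[OF t, of v] 0 by simp
      finally have "B t v = 0" by simp
      then show "v = 0" using inj[OF t] linear_injective_0[OF lin[OF t]] by blast
    qed
    have "(z - B t (y t)) \<bullet> B t (axis i 1) = 0" for i
      using closest_point_subspace(2)[OF sub[OF t], of "B t (axis i 1)" z] y[OF t] by simp
    then have "B t (axis i 1) \<bullet> B t (y t) = B t (axis i 1) \<bullet> z" for i
      unfolding inner_diff_left by (metis eq_iff_diff_eq_0 inner_commute)
    then show "N t *v y t = (\<chi> i. B t (axis i 1) \<bullet> z)"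
      by (simp add: vec_eq_iff N[OF t])
  qed
  have "continuous_on S (\<lambda>t. B t (y t))"
    by (rule continuous_on_linear_family[where f=B, OF lin cont yc])
  then show ?thesis by (rule continuous_on_eq) (simp add: y)
qed

text \<open>\<open>\<Psi> t\<close> maps the initial data of a solution at \<open>a\<close> to its
  value and derivative at \<open>t\<close>. The left end \<open>p\<close> is going to be the instant
  at which the fields of the transverse Lagrangian vanish.\<close>

locale jacobi_system =
  fixes H :: "real^'n^'n" and R :: "real \<Rightarrow> real^'n \<Rightarrow> real^'n"
    and \<Psi> :: "real \<Rightarrow> (real^'n) \<times> (real^'n) \<Rightarrow> (real^'n) \<times> (real^'n)" and p q a :: real
    and h :: "real^'n \<Rightarrow> real^'n \<Rightarrow> real"
  assumes pq: "p < q" "a \<in> {p..q}"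
    and h_eq: "h v w = v \<bullet> (H *v w)" and h_sym: "h v w = h w v" and H_inv: "invertible H"
    and R_sym: "t \<in> {p..q} \<Longrightarrow> h (R t v) w = h v (R t w)" and R_linear: "t \<in> {p..q} \<Longrightarrow> linear (R t)"
    and \<Psi>_linear: "t \<in> {p..q} \<Longrightarrow> linear (\<Psi> t)" and \<Psi>_bij: "t \<in> {p..q} \<Longrightarrow> bij (\<Psi> t)"
    and \<Psi>_deriv: "t \<in> {p..q} \<Longrightarrow>
      ((\<lambda>s. \<Psi> s z) has_vector_derivative (snd (\<Psi> t z), R t (fst (\<Psi> t z)))) (at t within {p..q})"
    and \<Psi>_a: "\<Psi> a z = z"
begin

lemma h_linear: "linear (\<lambda>v. h v w)" "linear (h v)"
  unfolding h_eq[abs_def]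
  by (auto simp: linear_iff inner_add_left inner_add_right matrix_vector_right_distrib matrix_vector_mult_scaleR)

lemmas h_simps = linear_add[OF h_linear(1)] linear_add[OF h_linear(2)]
  linear_diff[OF h_linear(1)] linear_diff[OF h_linear(2)]
  linear_cmul[OF h_linear(1)] linear_cmul[OF h_linear(2)]
  linear_neg[OF h_linear(1)] linear_neg[OF h_linear(2)] linear_0[OF h_linear(1)] linear_0[OF h_linear(2)]

lemma h_nondeg: "(\<And>w. h v w = 0) \<Longrightarrow> v = 0"
  using nondegenerate_form_components[OF h_eq H_inv, of v v] by simp

definition om :: "(real^'n) \<times> (real^'n) \<Rightarrow> (real^'n) \<times> (real^'n) \<Rightarrow> real" where
  "om z y = h (fst y) (snd z) - h (fst z) (snd y)"

lemma om_bilinear: "bilinear om"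
  unfolding bilinear_def by (auto intro!: linearI simp: om_def h_simps algebra_simps)

lemma om_nondeg:
  assumes "\<And>y. om z y = 0"
  shows "z = 0"
proof -
  have "h (fst z) w = 0" for w using assms[of "(0, w)"] by (simp add: om_def h_simps)
  moreover have "h (snd z) w = 0" for w using assms[of "(w, 0)"] h_sym by (simp add: om_def h_simps)
  ultimately show ?thesis using h_nondeg by (simp add: prod_eq_iff)
qed

definition flow_on :: "real set \<Rightarrow> (real \<Rightarrow> (real^'n) \<times> (real^'n)) \<Rightarrow> bool" where
  "flow_on I Z \<longleftrightarrow> (\<forall>t\<in>I. (Z has_vector_derivative (snd (Z t), R t (fst (Z t)))) (at t within I))"

text \<open>The Wronskian of two solutions: its derivative cancels by the symmetry of
  \<open>R\<close> and \<open>h\<close>. Isotropy of \<open>ell\<close>, uniqueness of solutions and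
  continuity of \<open>B\<close> all rest on it.\<close>

lemma om_conserved:
  assumes sub: "{r..s} \<subseteq> {p..q}" and Z: "flow_on {r..s} Z" and Y: "flow_on {r..s} Y"
    and t: "t \<in> {r..s}" "u \<in> {r..s}"
  shows "om (Z t) (Y t) = om (Z u) (Y u)"
proof -
  have bb: "bounded_bilinear om" using om_bilinear bilinear_conv_bounded_bilinear by blast
  have "((\<lambda>x. om (Z x) (Y x)) has_derivative (\<lambda>h. 0)) (at x within {r..s})" if x: "x \<in> {r..s}" for x
  proof -
    have "((\<lambda>x. om (Z x) (Y x)) has_vector_derivative
      om (Z x) (snd (Y x), R x (fst (Y x))) + om (snd (Z x), R x (fst (Z x))) (Y x)) (at x within {r..s})"
      using bounded_bilinear.has_vector_derivative[OF bb] Z Y x by (auto simp: flow_on_def)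
    moreover have "om (Z x) (snd (Y x), R x (fst (Y x))) + om (snd (Z x), R x (fst (Z x))) (Y x) = 0"
      using R_sym[of x "fst (Z x)" "fst (Y x)"] h_sym[of "snd (Y x)" "snd (Z x)"]
        h_sym[of "fst (Y x)" "R x (fst (Z x))"] sub x by (auto simp: om_def)
    ultimately show ?thesis by (simp add: has_vector_derivative_def)
  qed
  from has_derivative_zero_unique[OF _ this t(1) t(2)] show ?thesis by simp
qed

lemma flow_\<Psi>: "{r..s} \<subseteq> {p..q} \<Longrightarrow> flow_on {r..s} (\<lambda>t. \<Psi> t z)"
  unfolding flow_on_def by (blast intro: has_vector_derivative_within_subset[OF \<Psi>_deriv])

lemma om_\<Psi>: "t \<in> {p..q} \<Longrightarrow> om (\<Psi> t z) (\<Psi> t y) = om z y"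
  using om_conserved[OF subset_refl flow_\<Psi> flow_\<Psi>, OF subset_refl subset_refl _ pq(2), of t] by (simp add: \<Psi>_a)

text \<open>The Wronskian of the difference with every solution \<open>\<Psi> t y\<close> is zero at
  \<open>u\<close>, hence at \<open>t\<close>; the vectors \<open>\<Psi> t y\<close> fill the space
  and \<open>om\<close> is nondegenerate.\<close>

lemma flow_unique:
  assumes sub: "{r..s} \<subseteq> {p..q}" and Z: "flow_on {r..s} Z" and u: "u \<in> {r..s}" "Z u = \<Psi> u z" and t: "t \<in> {r..s}"
  shows "Z t = \<Psi> t z"
proof -
  have D: "flow_on {r..s} (\<lambda>t. Z t - \<Psi> t z)"
    unfolding flow_on_def
  proof
    fix t assume t: "t \<in> {r..s}"
    then have t': "t \<in> {p..q}" using sub by auto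
    have "((\<lambda>t. Z t - \<Psi> t z) has_vector_derivative (snd (Z t), R t (fst (Z t))) - (snd (\<Psi> t z), R t (fst (\<Psi> t z)))) (at t within {r..s})"
      by (rule has_vector_derivative_diff[OF Z[unfolded flow_on_def, rule_format, OF t]
            flow_\<Psi>[OF sub, unfolded flow_on_def, rule_format, OF t]])
    then show "((\<lambda>t. Z t - \<Psi> t z) has_vector_derivative (snd (Z t - \<Psi> t z), R t (fst (Z t - \<Psi> t z)))) (at t within {r..s})"
      by (simp add: linear_diff[OF R_linear[OF t']])
  qed
  have "om (Z t - \<Psi> t z) (\<Psi> t y) = 0" for y
    using om_conserved[OF sub D flow_\<Psi>[OF sub] t u(1)] u(2) by (simp add: om_def h_simps)
  moreover have "surj (\<Psi> t)" by (rule bij_is_surj[OF \<Psi>_bij]) (use t sub in auto)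
  ultimately have "om (Z t - \<Psi> t z) y = 0" for y by (metis surjD)
  from om_nondeg[OF this] show ?thesis by simp
qed

lemma \<Psi>_inv: "t \<in> {p..q} \<Longrightarrow> \<Psi> t (inv (\<Psi> t) z) = z"
  using \<Psi>_bij by (simp add: bij_is_surj surj_f_inv_f)

lemma \<Psi>_cont: "continuous_on {p..q} (\<lambda>t. \<Psi> t z)"
  unfolding continuous_on_eq_continuous_within using has_vector_derivative_continuous[OF \<Psi>_deriv] by blast

definition ell :: "real \<Rightarrow> ((real^'n) \<times> (real^'n)) set" where
  "ell t = {z. fst (\<Psi> t z) = 0}"

text \<open>The initial data at \<open>a\<close> of the solution with value 0 and derivative
  \<open>w\<close> at \<open>t\<close>: a parametrisation of \<open>ell t\<close> that turns out to
  be continuous in \<open>t\<close>.\<close>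

definition B :: "real \<Rightarrow> real^'n \<Rightarrow> (real^'n) \<times> (real^'n)" where
  "B t w = inv (\<Psi> t) (0, w)"

lemma \<Psi>_B: "t \<in> {p..q} \<Longrightarrow> \<Psi> t (B t w) = (0, w)"
  by (simp add: B_def \<Psi>_inv)

lemma ell_a: "z \<in> ell a \<longleftrightarrow> fst z = 0"
  by (simp add: ell_def \<Psi>_a)

lemma B_linear:
  assumes t: "t \<in> {p..q}"
  shows "linear (B t)"
proof -
  have "linear (inv (\<Psi> t))" by (rule inj_linear_imp_inv_linear[OF \<Psi>_linear[OF t] bij_is_inj[OF \<Psi>_bij[OF t]]])
  moreover have "linear (\<lambda>w::real^'n. (0::real^'n, w))" by (rule linearI) auto
  ultimately show ?thesis unfolding B_def[abs_def] using linear_compose by (force simp: o_def)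
qed

lemma B_inj: "t \<in> {p..q} \<Longrightarrow> inj (B t)"
  by (rule injI) (metis \<Psi>_B prod.inject)

lemma ell_range:
  assumes t: "t \<in> {p..q}"
  shows "ell t = range (B t)"
proof (intro subset_antisym subsetI)
  fix z assume "z \<in> ell t"
  then have "\<Psi> t z = (0, snd (\<Psi> t z))" by (simp add: ell_def prod_eq_iff)
  then have "z = B t (snd (\<Psi> t z))"
    unfolding B_def using \<Psi>_bij[OF t] by (metis bij_inv_eq_iff)
  then show "z \<in> range (B t)" by blast
qed (use \<Psi>_B[OF t] in \<open>auto simp: ell_def\<close>)

lemma ell_subspace: "t \<in> {p..q} \<Longrightarrow> subspace (ell t)"
  unfolding ell_range using linear_subspace_image[OF B_linear subspace_UNIV] by simp

lemma ell_isotropic: "t \<in> {p..q} \<Longrightarrow> z \<in> ell t \<Longrightarrow> y \<in> ell t \<Longrightarrow> om z y = 0"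
  using om_\<Psi>[of t z y] by (simp add: ell_def om_def h_simps)

lemma ell_lagrangian:
  assumes t: "t \<in> {p..q}"
  shows "lagrangian om (ell t)"
proof -
  have "dim (ell t) = dim (UNIV :: (real^'n) set)"
    unfolding ell_range[OF t] by (rule dim_image_eq[OF B_linear[OF t]]) (use B_inj[OF t] in \<open>auto intro: inj_on_subset\<close>)
  then show ?thesis using ell_subspace ell_isotropic t by (auto simp: lagrangian_def)
qed

text \<open>\<open>om (B t w) y\<close> equals \<open>h (fst (\<Psi> t y)) w\<close>, which is
  continuous in \<open>t\<close>. The vectors \<open>(v, 0)\<close> and \<open>(0, v)\<close> for
  \<open>y\<close> recover the two components, without a limit of inverse maps.\<close>

lemma B_cont: "continuous_on {p..q} (\<lambda>t. B t w)"
proof -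
  have *: "om (B t w) y = h (fst (\<Psi> t y)) w" if "t \<in> {p..q}" for t y
    using om_\<Psi>[OF that, of "B t w" y] \<Psi>_B[OF that] by (simp add: om_def h_simps)
  have c: "continuous_on {p..q} (\<lambda>t. h (fst (\<Psi> t y)) w)" for y
    unfolding h_eq by (intro continuous_intros \<Psi>_cont)
  have "continuous_on {p..q} (\<lambda>t. snd (B t w))"
  proof (rule continuous_on_by_form[OF h_eq H_inv])
    fix v show "continuous_on {p..q} (\<lambda>t. h (snd (B t w)) v)"
    proof (rule continuous_on_eq[OF c[of "(v, 0)"]])
      fix t assume "t \<in> {p..q}"
      from *[OF this, of "(v, 0)"] show "h (fst (\<Psi> t (v, 0))) w = h (snd (B t w)) v"
        by (simp add: om_def h_simps h_sym[of v])
    qed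
  qed
  moreover have "continuous_on {p..q} (\<lambda>t. fst (B t w))"
  proof (rule continuous_on_by_form[OF h_eq H_inv])
    fix v show "continuous_on {p..q} (\<lambda>t. h (fst (B t w)) v)"
    proof (rule continuous_on_eq[OF continuous_on_minus[OF c[of "(0, v)"]]])
      fix t assume "t \<in> {p..q}"
      from *[OF this, of "(0, v)"] show "- h (fst (\<Psi> t (0, v))) w = h (fst (B t w)) v"
        by (simp add: om_def h_simps)
    qed
  qed
  ultimately have "continuous_on {p..q} (\<lambda>t. (fst (B t w), snd (B t w)))" by (rule continuous_on_Pair[rotated])
  then show ?thesis by simp
qed

text \<open>In \<open>lag_top\<close> continuity is pointwise continuity of the orthogonal
  projections, here those onto the ranges of \<open>B t\<close>.\<close>

lemma ell_lag_path:
  assumes "{r..s} \<subseteq> {p..q}" and e: "\<And>t. t \<in> {r..s} \<Longrightarrow> e t = ell t"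
  shows "lag_path om r s e"
  unfolding lag_path_def lag_top_def
proof (rule continuous_map_pullback')
  have "continuous_on {r..s} (closest_point \<circ> e)"
  proof (rule continuous_on_coordinatewise_then_product)
    fix z
    have "continuous_on {r..s} (\<lambda>t. closest_point (range (B t)) z)"
      using assms(1) by (intro continuous_on_closest_point_range B_linear B_inj continuous_on_subset[OF B_cont]) auto
    then show "continuous_on {r..s} (\<lambda>t. (closest_point \<circ> e) t z)"
      by (rule continuous_on_eq) (use e ell_range assms(1) in \<open>auto simp: subset_iff\<close>)
  qed
  then show "continuous_map (top_of_set {r..s}) euclidean (closest_point \<circ> e)" by simp
  show "topspace (top_of_set {r..s}) \<subseteq> e -` {L. lagrangian om L}"
    using e ell_lagrangian assms(1) by auto
qed

text \<open>The solutions that vanish at \<open>a\<close>, by their derivative there; a nonzero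
  kernel of \<open>Y t\<close> is what makes \<open>t\<close> conjugate to \<open>a\<close>.\<close>

definition Y :: "real \<Rightarrow> real^'n \<Rightarrow> real^'n" where "Y t w = fst (\<Psi> t (0, w))"

lemma linear_fst_\<Psi>: "t \<in> {p..q} \<Longrightarrow> linear f \<Longrightarrow> linear (\<lambda>v. fst (\<Psi> t (f v)))"
  by (rule linearI) (simp_all add: linear_add linear_cmul \<Psi>_linear)

lemma linear_zero_Pair: "linear (\<lambda>w::real^'n. (0::real^'n, w))"
  by (rule linearI) auto

lemma Y_linear: "t \<in> {p..q} \<Longrightarrow> linear (Y t)"
  unfolding Y_def[abs_def] by (rule linear_fst_\<Psi>[OF _ linear_zero_Pair])

end

text \<open>The situation to be refuted, in coordinates: \<open>ell p\<close> is the Lagrangian of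
  the fields that vanish at \<open>p\<close>, and \<open>t0\<close> will be the conjugate
  instant.\<close>

locale transverse_lagrangian = jacobi_system H R \<Psi> p q a h
  for H :: "real^'n^'n" and R \<Psi> p q a h +
  fixes t0 :: real
  assumes t0: "a \<le> t0" "t0 \<le> q"
    and transversal: "t \<in> {a..t0} \<Longrightarrow> ell t \<inter> ell p = {0}"
begin

lemma in_pq: "t \<in> {a..t0} \<Longrightarrow> t \<in> {p..q}"
  using pq t0 by auto

text \<open>\<open>ell a\<close> is the second factor, and a Lagrangian transverse to it is a graph
  over the first: a solution that vanishes at \<open>p\<close> is determined by its value at
  \<open>a\<close>.\<close>

lemma ell_p_graph: "\<exists>S. linear S \<and> (\<forall>z. z \<in> ell p \<longleftrightarrow> snd z = S (fst z))"
proof -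
  have p: "p \<in> {p..q}" using pq by auto
  define f where "f w = fst (B p w)" for w
  have f: "linear f" unfolding f_def[abs_def] using linear_compose[OF B_linear[OF p] linear_fst] by (simp add: o_def)
  have "w = 0" if "f w = 0" for w
  proof -
    have "B p w \<in> ell a \<inter> ell p" using that ell_range[OF p] by (auto simp: ell_a f_def)
    then have "B p w = 0" using transversal[of a] t0 by auto
    then show "w = 0" using B_inj[OF p] linear_injective_0[OF B_linear[OF p]] by blast
  qed
  then have inj: "inj f" using linear_injective_0[OF f] by blast
  then have surj: "surj f" using linear_inj_imp_surj[OF f] by blast
  define S where "S v = snd (B p (inv f v))" for v
  have "linear S"
    unfolding S_def[abs_def]
    using linear_compose[OF linear_compose[OF inj_linear_imp_inv_linear[OF f inj] B_linear[OF p]] linear_snd] by (simp add: o_def)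
  moreover have "z \<in> ell p \<longleftrightarrow> snd z = S (fst z)" for z
  proof
    assume "z \<in> ell p"
    then obtain w where "z = B p w" using ell_range[OF p] by blast
    then show "snd z = S (fst z)" using inj by (simp add: S_def flip: f_def)
  next
    assume z: "snd z = S (fst z)"
    have "fst (B p (inv f (fst z))) = fst z" using surj by (simp add: surj_f_inv_f flip: f_def)
    then have "z = B p (inv f (fst z))" using z by (simp add: S_def prod_eq_iff)
    then show "z \<in> ell p" using ell_range[OF p] by blast
  qed
  ultimately show ?thesis by blast
qed

definition S where "S = (SOME S. linear S \<and> (\<forall>z. z \<in> ell p \<longleftrightarrow> snd z = S (fst z)))"

lemma S: "linear S" "z \<in> ell p \<longleftrightarrow> snd z = S (fst z)"
  using someI_ex[OF ell_p_graph] unfolding S_def by blast+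

text \<open>The solutions that vanish at \<open>p\<close>, by their value at \<open>a\<close>;
  transversality of \<open>ell t\<close> to \<open>ell p\<close> amounts to \<open>X t\<close> being
  invertible.\<close>

definition X :: "real \<Rightarrow> real^'n \<Rightarrow> real^'n" where "X t v = fst (\<Psi> t (v, S v))"

lemma X_linear: "t \<in> {p..q} \<Longrightarrow> linear (X t)"
proof -
  assume t: "t \<in> {p..q}"
  have "linear (\<lambda>v. (v, S v))" by (rule linearI) (simp_all add: linear_add[OF S(1)] linear_cmul[OF S(1)])
  then show ?thesis unfolding X_def[abs_def] by (rule linear_fst_\<Psi>[OF t])
qed

lemma X_matrix: "t \<in> {p..q} \<Longrightarrow> matrix (X t) *v v = X t v"
  using matrix_works linear_matrix_vector_mul_eq X_linear by metis

lemma X_invertible: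
  assumes t: "t \<in> {a..t0}"
  shows "invertible (matrix (X t))"
proof (rule matrix_invertible_of_kernel)
  fix v assume "matrix (X t) *v v = 0"
  then have "(v, S v) \<in> ell t \<inter> ell p" using X_matrix[OF in_pq[OF t]] S by (simp add: ell_def X_def)
  then show "v = 0" using transversal[OF t] by (auto simp: zero_prod_def)
qed

text \<open>The value at \<open>a\<close> of the solution in \<open>ell p\<close> that has to be
  added to the one with data \<open>(0, w)\<close> in order to make the sum vanish at
  \<open>t\<close>.\<close>

definition V :: "real \<Rightarrow> real^'n \<Rightarrow> real^'n" where "V t w = - (matrix_inv (matrix (X t)) *v Y t w)"

lemma X_V:
  assumes t: "t \<in> {a..t0}"
  shows "X t (V t w) = - Y t w"
proof -
  have "matrix (X t) *v V t w = - (matrix (X t) *v (matrix_inv (matrix (X t)) *v Y t w))"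
    by (simp add: V_def linear_neg[OF matrix_vector_mul_linear])
  also have "\<dots> = - Y t w" by (simp add: matrix_vector_mul_assoc matrix_inv_right[OF X_invertible[OF t]])
  finally show ?thesis using X_matrix[OF in_pq[OF t]] by simp
qed

lemma V_unique:
  assumes t: "t \<in> {a..t0}" and "X t v = - Y t w"
  shows "v = V t w"
proof -
  have "matrix (X t) *v (v - V t w) = 0"
    using assms(2) X_V[OF t] X_matrix[OF in_pq[OF t]] by (simp add: linear_diff[OF X_linear[OF in_pq[OF t]]])
  moreover have "matrix (X t) *v u = 0 \<Longrightarrow> u = 0" for u
    using X_invertible[OF t] by (metis matrix_inv_left matrix_vector_mul_assoc matrix_vector_mul_lid matrix_vector_mult_0_right)
  ultimately show ?thesis by force
qed

lemma V_linear: "t \<in> {a..t0} \<Longrightarrow> linear (V t)"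
  unfolding V_def[abs_def]
  by (intro linear_compose_neg linear_compose[of "Y t" "(*v) _", unfolded o_def] Y_linear in_pq) auto

lemma graph_member:
  assumes t: "t \<in> {a..t0}"
  shows "(v, w + S v) \<in> ell t \<longleftrightarrow> v = V t w"
proof -
  have "fst (\<Psi> t (v, w + S v)) = X t v + Y t w"
    using linear_add[OF \<Psi>_linear[OF in_pq[OF t]], of "(v, S v)" "(0, w)"]
    by (simp add: X_def Y_def add.commute)
  then have "(v, w + S v) \<in> ell t \<longleftrightarrow> X t v = - Y t w" by (simp add: ell_def eq_neg_iff_add_eq_0)
  then show ?thesis using X_V[OF t] V_unique[OF t] by blast
qed

lemma graph_map_ell:
  assumes t: "t \<in> {a..t0}"
  shows "graph_map (ell a) (ell p) (ell t) (0, w) = (V t w, S (V t w))"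
  unfolding graph_map_def
proof (rule the_equality)
  show "(V t w, S (V t w)) \<in> ell p \<and> (0, w) + (V t w, S (V t w)) \<in> ell t"
    using graph_member[OF t] S(2) by simp
  fix y assume y: "y \<in> ell p \<and> (0, w) + y \<in> ell t"
  obtain v where v: "y = (v, S v)" using y S(2) by (metis prod.collapse)
  then show "y = (V t w, S (V t w))" using y graph_member[OF t] by simp
qed

lemma lag_chart_ell:
  "t \<in> {a..t0} \<Longrightarrow> lag_chart om (ell a) (ell p) (ell t) (0, w) (0, w') = - h (V t w) w'"
  by (simp add: lag_chart_def graph_map_ell om_def h_simps)

text \<open>Both \<open>ell t\<close> and \<open>ell p\<close> are isotropic; the difference of the
  two resulting identities is the claim.\<close>

lemma V_symmetric:
  assumes t: "t \<in> {a..t0}"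
  shows "h (V t w) w' = h (V t w') w"
proof -
  have p: "p \<in> {p..q}" using pq by auto
  have "om (V t w, w + S (V t w)) (V t w', w' + S (V t w')) = 0"
    by (rule ell_isotropic[OF in_pq[OF t]]) (simp_all add: graph_member[OF t])
  moreover have "om (V t w, S (V t w)) (V t w', S (V t w')) = 0"
    by (rule ell_isotropic[OF p]) (simp_all add: S(2))
  ultimately show ?thesis by (simp add: om_def h_simps)
qed

lemma pos_index_lag_chart:
  assumes t: "t \<in> {a..t0}"
  shows "pos_index (ell a) (lag_chart om (ell a) (ell p) (ell t)) = pos_index UNIV (\<lambda>w w'. - h (V t w) w')"
proof -
  have "ell a = range (\<lambda>w. (0, w))" by (auto simp: ell_a prod_eq_iff image_iff)
  moreover have "inj (\<lambda>w::real^'n. (0::real^'n, w))" by (rule injI) simp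
  ultimately show ?thesis
    unfolding pos_index_def using neg_index_image[OF linear_zero_Pair] lag_chart_ell[OF t] by simp
qed

text \<open>The chart image of \<open>ell t\<close>, divided by \<open>t - a\<close>; it extends continuously to \<open>t = a\<close>, where
  it is the metric.\<close>

definition Q :: "real \<Rightarrow> real^'n \<Rightarrow> real^'n" where
  "Q t w = (if t = a then w else - (1 / (t - a)) *\<^sub>R V t w)"

text \<open>\<open>Q t w\<close> solves a linear equation with matrix \<open>X t\<close> and
  right-hand side \<open>Y t w\<close> divided by \<open>t - a\<close>, replaced by \<open>w\<close>
  at \<open>t = a\<close>. So continuity at \<open>a\<close> amounts to \<open>Y\<close> having the
  derivative \<open>w\<close> there.\<close>

lemma Q_cont: "continuous_on {a..t0} (\<lambda>t. Q t w)"
proof (rule continuous_on_solve)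
  let ?b = "\<lambda>t. if t = a then w else (1 / (t - a)) *\<^sub>R Y t w"
  have sub: "{a..t0} \<subseteq> {p..q}" using in_pq by blast
  have Xc: "continuous_on {a..t0} (\<lambda>t. X t v)" for v
    unfolding X_def by (intro continuous_on_fst continuous_on_subset[OF \<Psi>_cont sub])
  show "continuous_on {a..t0} (\<lambda>t. matrix (X t))"
    unfolding matrix_def by (intro continuous_on_vec_lambda continuous_on_component Xc)
  show "invertible (matrix (X t))" if "t \<in> {a..t0}" for t by (rule X_invertible[OF that])
  show "matrix (X t) *v Q t w = ?b t" if t: "t \<in> {a..t0}" for t
  proof -
    have "X t (Q t w) = ?b t"
      using X_V[OF t, of w] linear_neg[OF X_linear[OF in_pq[OF t]]] linear_cmul[OF X_linear[OF in_pq[OF t]]]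
      by (simp add: Q_def X_def \<Psi>_a)
    then show ?thesis using X_matrix[OF in_pq[OF t]] by simp
  qed
  show "continuous_on {a..t0} ?b"
    unfolding continuous_on_def
  proof
    fix t assume t: "t \<in> {a..t0}"
    have Yd: "((\<lambda>s. Y s w) has_vector_derivative snd (\<Psi> t (0, w))) (at t within {a..t0})"
      using bounded_linear.has_vector_derivative[OF bounded_linear_fst
          has_vector_derivative_within_subset[OF \<Psi>_deriv[OF in_pq[OF t], of "(0, w)"] sub]]
      by (simp add: Y_def)
    show "(?b \<longlongrightarrow> ?b t) (at t within {a..t0})"
    proof (cases "t = a")
      case True
      have "((\<lambda>s. (1 / norm (s - a)) *\<^sub>R (Y s w - (Y a w + (s - a) *\<^sub>R w))) \<longlongrightarrow> 0) (at a within {a..t0})"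
        using Yd unfolding True \<Psi>_a has_vector_derivative_def has_derivative_within by simp
      then have "((\<lambda>s. ?b s - w) \<longlongrightarrow> 0) (at a within {a..t0})"
        by (rule Lim_transform_within[where d=1]) (auto simp: Y_def \<Psi>_a scaleR_diff_right)
      then show ?thesis unfolding True by (simp add: LIM_zero_iff)
    next
      case False
      have Yc: "((\<lambda>s. Y s w) \<longlongrightarrow> Y t w) (at t within {a..t0})"
        using has_vector_derivative_continuous[OF Yd] by (simp add: continuous_within)
      have "((\<lambda>s. (1 / (s - a)) *\<^sub>R Y s w) \<longlongrightarrow> (1 / (t - a)) *\<^sub>R Y t w) (at t within {a..t0})"
        using False by (intro tendsto_intros Yc) auto
      then have "(?b \<longlongrightarrow> (1 / (t - a)) *\<^sub>R Y t w) (at t within {a..t0})"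
        by (rule Lim_transform_within[where d="\<bar>t - a\<bar>"]) (use False in \<open>auto simp: dist_real_def\<close>)
      then show ?thesis using False by simp
    qed
  qed
qed

lemma pos_index_Q:
  assumes t: "t \<in> {a<..t0}"
  shows "pos_index UNIV (\<lambda>w w'. - h (V t w) w') = pos_index UNIV (\<lambda>w w'. h (Q t w) w')"
  unfolding pos_index_def
  by (rule neg_index_cong) (use t in \<open>auto simp: Q_def h_simps zero_less_divide_iff divide_less_0_iff\<close>)

text \<open>The forms of \<open>Q\<close> join \<open>h\<close> at \<open>a\<close> to the chart
  form at \<open>c\<close>. If \<open>Q t w = 0\<close> for some later \<open>t\<close>, then
  \<open>Y t w = 0\<close>, so \<open>(0, w)\<close> lies in \<open>ell t\<close> and in
  \<open>ell a\<close>.\<close>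

lemma pos_index_initial:
  assumes c: "a < c" "c \<le> t0" and nd: "\<And>t. t \<in> {a<..c} \<Longrightarrow> ell t \<inter> ell a = {0}"
  shows "pos_index UNIV (\<lambda>w w'. - h (V c w) w') = pos_index UNIV h"
proof -
  have t: "t \<in> {a..t0}" if "t \<in> {a..c}" for t using that c by auto
  have "pos_index UNIV (\<lambda>w w'. h (Q a w) w') = pos_index UNIV (\<lambda>w w'. h (Q c w) w')"
  proof (rule pos_index_nondegenerate_path)
    show "a \<le> c" using c by simp
    fix t assume tc: "t \<in> {a..c}"
    have Ql: "linear (Q t)"
      using linear_compose_scale_right[OF V_linear[OF t[OF tc]], of "- (1 / (t - a))"]
      by (cases "t = a") (auto simp: Q_def[abs_def] linear_iff)
    show "bilinear (\<lambda>w w'. h (Q t w) w')"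
      unfolding bilinear_def using linear_compose[OF Ql h_linear(1)] h_linear(2) by (auto simp: o_def)
    show "h (Q t w) w' = h (Q t w') w" for w w'
      using V_symmetric[OF t[OF tc]] h_sym[of w w'] by (auto simp: Q_def h_simps)
    fix w assume "\<And>w'. h (Q t w) w' = 0"
    then have Q0: "Q t w = 0" by (rule h_nondeg)
    show "w = 0"
    proof (cases "t = a")
      case True then show ?thesis using Q0 by (simp add: Q_def)
    next
      case False
      then have "V t w = 0" using Q0 by (simp add: Q_def)
      then have "Y t w = 0" using X_V[OF t[OF tc], of w] linear_0[OF X_linear[OF in_pq[OF t[OF tc]]]] by simp
      then have "(0, w) \<in> ell t" by (simp add: ell_def Y_def)
      then have "(0, w) \<in> ell t \<inter> ell a" by (simp add: ell_a)
      then show ?thesis using nd[of t] False tc by (auto simp: zero_prod_def)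
    qed
  next
    fix v w show "continuous_on {a..c} (\<lambda>t. h (Q t v) w)"
      unfolding h_eq using c by (intro continuous_intros continuous_on_subset[OF Q_cont]) auto
  qed
  moreover have "(\<lambda>w w'. h (Q a w) w') = h" by (simp add: Q_def)
  ultimately show ?thesis using pos_index_Q[of c] c by simp
qed

text \<open>The chart form vanishes on the kernel of \<open>Y t0\<close>, so a subspace on which it
  is positive definite meets this kernel only in 0.\<close>

lemma pos_index_final: "pos_index UNIV (\<lambda>w w'. - h (V t0 w) w') + dim {w. Y t0 w = 0} \<le> CARD('n)"
proof -
  have t: "t0 \<in> {a..t0}" using t0 by simp
  have "V t0 w = 0" if "Y t0 w = 0" for w using that by (simp add: V_def)
  moreover have "subspace {w. Y t0 w = 0}" using Y_linear[OF in_pq[OF t]] by (rule linear_subspace_kernel)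
  ultimately show ?thesis
    unfolding pos_index_def
    using neg_index_add_dim_le[of "{w. Y t0 w = 0}" "\<lambda>w w'. - (- h (V t0 w) w')"] by (simp add: h_simps)
qed

text \<open>\<open>k\<close> is the coindex of the chart form at \<open>t0\<close>; as a natural
  number it also carries the estimate of the Maslov index from below.\<close>

lemma maslov_bound:
  assumes mu: "is_maslov_index om (ell a) \<mu>" and c: "a < c" "c < t0"
    and nd: "\<And>t. t \<in> {a<..c} \<Longrightarrow> ell t \<inter> ell a = {0}"
    and e: "\<And>t. t \<in> {c..t0} \<Longrightarrow> e t = ell t"
  shows "\<exists>k. \<mu> c t0 e = int k - int (pos_index UNIV h) \<and> k + dim {w. Y t0 w = 0} \<le> CARD('n)"
proof -
  have p: "p \<in> {p..q}" using pq by auto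
  have sub: "{c..t0} \<subseteq> {p..q}" using in_pq c by force
  have "\<mu> c t0 e = int (pos_index (ell a) (lag_chart om (ell a) (ell p) (e t0)))
      - int (pos_index (ell a) (lag_chart om (ell a) (ell p) (e c)))"
    using mu[unfolded is_maslov_index_def, THEN conjunct2, THEN conjunct2, rule_format,
        OF c(2) ell_lag_path[OF sub e] ell_lagrangian[OF p]] transversal c t0 e
    by (auto simp: transverse_def)
  also have "\<dots> = int (pos_index UNIV (\<lambda>w w'. - h (V t0 w) w')) - int (pos_index UNIV h)"
    using e c t0 pos_index_lag_chart pos_index_initial[OF c(1) _ nd] by auto
  finally show ?thesis using pos_index_final by blast
qed

end

section \<open>Conjugate points\<close>

context semi_riemannian_manifold
begin

lemma gform_sylvester:
  assumes "c \<in> A" "x \<in> img c"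
  shows "pos_index UNIV (gform g c x) + neg_index UNIV (gform g c x) = CARD('n)"
  using symmetric_form_sylvester[of "gform g c x"] gform_linear g_sym[OF assms] g_nondeg[OF assms]
  by (simp add: bilinear_def)

text \<open>The point \<open>x\<close> makes the constant unique, as \<open>THE\<close> requires;
  the coindex is constant because it is the dimension minus the index.\<close>

lemma metric_index_eq:
  assumes cx: "c \<in> A" "x \<in> img c"
  shows "metric_index A g = neg_index UNIV (gform g c x)"
    and "metric_coindex A g = pos_index UNIV (gform g c x)"
proof -
  have "\<exists>k. \<forall>c\<in>A. \<forall>x\<in>img c. neg_index UNIV (gform g c x) = k"
    using metric unfolding semi_riemannian_def by (elim conjE)
  then obtain k where k: "\<And>c x. c \<in> A \<Longrightarrow> x \<in> img c \<Longrightarrow> neg_index UNIV (gform g c x) = k" by metis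
  have k': "pos_index UNIV (gform g c x) = CARD('n) - k" if "c \<in> A" "x \<in> img c" for c x
    using gform_sylvester[OF that] k[OF that] by simp
  have "metric_index A g = k"
    unfolding metric_index_def
  proof (rule the_equality)
    show "\<forall>c\<in>A. \<forall>x\<in>img c. neg_index UNIV (gform g c x) = k" using k by simp
    fix l assume "\<forall>c\<in>A. \<forall>x\<in>img c. neg_index UNIV (gform g c x) = l"
    from this[rule_format, OF cx] show "l = k" using k[OF cx] by simp
  qed
  then show "metric_index A g = neg_index UNIV (gform g c x)" using k[OF cx] by simp
  have "metric_coindex A g = CARD('n) - k"
    unfolding metric_coindex_def
  proof (rule the_equality)
    show "\<forall>c\<in>A. \<forall>x\<in>img c. pos_index UNIV (gform g c x) = CARD('n) - k" using k' by simp
    fix l assume "\<forall>c\<in>A. \<forall>x\<in>img c. pos_index UNIV (gform g c x) = l"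
    from this[rule_format, OF cx] show "l = CARD('n) - k" using k'[OF cx] by simp
  qed
  then show "metric_coindex A g = pos_index UNIV (gform g c x)" using k'[OF cx] by simp
qed

end

section \<open>From the linear system back to Jacobi fields and conjugate instants\<close>

context parallel_frame
begin

lemma form_sym: "form v w = form w v"
  using g_sym[OF chart0(1) pos_img[OF chart0(2)]] by (simp add: form_def metric_at_def pos_def)

lemma jacobi_system_exists:
  "\<exists>\<Psi>. jacobi_system (g (chart0 t0) (pos (chart0 t0) t0)) jac \<Psi> a b t0 form"
proof -
  let ?G = "\<lambda>t z. (snd z, jac t (fst z))"
  have lin: "linear (?G t)" if "t \<in> {a..b}" for t
    using jac_linear[OF that] by (auto intro!: linearI simp: linear_add linear_cmul)
  have cont: "continuous_on {a..b} (\<lambda>t. ?G t z)" for z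
    by (intro continuous_on_Pair continuous_on_const jac_cont)
  show ?thesis
  proof (rule fundamental_solution_exists[where G="?G", OF less_imp_le[OF ab] lin cont t0])
    fix \<Psi> :: "real \<Rightarrow> (real^'n) \<times> (real^'n) \<Rightarrow> (real^'n) \<times> (real^'n)"
    assume \<Psi>: "\<And>t. t \<in> {a..b} \<Longrightarrow> linear (\<Psi> t)" "\<And>t. t \<in> {a..b} \<Longrightarrow> bij (\<Psi> t)"
      "\<And>t z. t \<in> {a..b} \<Longrightarrow> ((\<lambda>s. \<Psi> s z) has_vector_derivative ?G t (\<Psi> t z)) (at t within {a..b})" "\<And>z. \<Psi> t0 z = z"
    have "jacobi_system (g (chart0 t0) (pos (chart0 t0) t0)) jac \<Psi> a b t0 form"
      by (rule jacobi_system.intro[OF ab t0 form_matrix(1) form_sym form_matrix(2) jac_sym jac_linear \<Psi>])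
    then show ?thesis by blast
  qed
qed

context
  fixes \<Psi>
  assumes \<Psi>: "jacobi_system (g (chart0 t0) (pos (chart0 t0) t0)) jac \<Psi> a b t0 form"
begin

interpretation J: jacobi_system "g (chart0 t0) (pos (chart0 t0) t0)" jac \<Psi> a b t0 form
  by (rule \<Psi>)

context
  fixes p q :: real and \<eta> :: "real \<Rightarrow> 'm"
  assumes pq: "p < q" "{p..q} \<subseteq> {a..b}" "t0 \<in> {p..q}" and eta: "\<And>t. t \<in> {p..q} \<Longrightarrow> \<eta> t = \<gamma> t"
begin

lemma solution_iff_flow: "solution p q j j' \<longleftrightarrow> J.flow_on {p..q} (\<lambda>t. (j t, j' t))"
proof -
  have "((\<lambda>t. (j t, j' t)) has_vector_derivative (j' t, jac t (j t))) (at t within {p..q}) \<longleftrightarrow>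
    (j has_vector_derivative j' t) (at t within {p..q}) \<and> (j' has_vector_derivative jac t (j t)) (at t within {p..q})" for t
    using bounded_linear.has_vector_derivative[OF bounded_linear_fst, of "\<lambda>t. (j t, j' t)"]
      bounded_linear.has_vector_derivative[OF bounded_linear_snd, of "\<lambda>t. (j t, j' t)"]
    by (fastforce intro: has_vector_derivative_Pair)
  then show ?thesis
    unfolding solution_def J.flow_on_def by simp
qed

lemma jacobi_of_flow:
  "\<exists>Jf. jacobi_field A g \<eta> {p..q} Jf \<and> (\<forall>t\<in>{p..q}. value_at A \<eta> Jf t = F (chart0 t) t (fst (\<Psi> t z)) \<and>
    value_at A \<eta> (cov_deriv g \<eta> {p..q} Jf) t = F (chart0 t) t (snd (\<Psi> t z)))"
  using jacobi_of_solution[OF pq(1,2) eta, of "\<lambda>t. fst (\<Psi> t z)" "\<lambda>t. snd (\<Psi> t z)"]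
    solution_iff_flow[of "\<lambda>t. fst (\<Psi> t z)" "\<lambda>t. snd (\<Psi> t z)"] J.flow_\<Psi>[OF pq(2), of z] by simp

lemma flow_of_jacobi:
  assumes "jacobi_field A g \<eta> {p..q} Jf"
  shows "\<exists>z. \<forall>t\<in>{p..q}. value_at A \<eta> Jf t = F (chart0 t) t (fst (\<Psi> t z)) \<and>
    value_at A \<eta> (cov_deriv g \<eta> {p..q} Jf) t = F (chart0 t) t (snd (\<Psi> t z))"
proof -
  obtain j j' where j: "solution p q j j'"
    "\<And>t. t \<in> {p..q} \<Longrightarrow> value_at A \<eta> Jf t = F (chart0 t) t (j t)"
    "\<And>t. t \<in> {p..q} \<Longrightarrow> value_at A \<eta> (cov_deriv g \<eta> {p..q} Jf) t = F (chart0 t) t (j' t)"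
    using solution_of_jacobi[OF pq(1,2) eta assms] by blast
  have "(j t, j' t) = \<Psi> t (j t0, j' t0)" if "t \<in> {p..q}" for t
    using J.flow_unique[OF pq(2) j(1)[unfolded solution_iff_flow] pq(3) _ that, of "(j t0, j' t0)"]
    by (simp add: J.\<Psi>_a)
  then show ?thesis
    by (intro exI[of _ "(j t0, j' t0)"]) (metis j(2,3) fst_conv snd_conv)
qed

lemma F0_iff: "t \<in> {p..q} \<Longrightarrow> F (chart0 t) t v = 0 \<longleftrightarrow> v = 0"
  using F_eq_iff[OF chart0(1) _ chart0(2), of t v 0] linear_0[OF F_linear[OF chart0(1) _ chart0(2)]] pq(2)
  by auto

end

text \<open>Jacobi fields on \<open>{t0..q}\<close> correspond to lines of the flow, and the frame
  is the identity at \<open>t0\<close>, so initial data need no conversion. Injectivity of the frame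
  lets vanishing at \<open>t\<close> be read off the components.\<close>

lemma lag_curve_eq:
  assumes "t0 < q" "q \<le> b" and eta: "\<And>t. t \<in> {t0..q} \<Longrightarrow> \<eta> t = \<gamma> t" and t: "t \<in> {t0..q}"
  shows "lag_curve A g \<eta> t0 q t = J.ell t"
proof -
  have pq: "t0 < q" "{t0..q} \<subseteq> {a..b}" "t0 \<in> {t0..q}" using assms t0 by auto
  have "(v, w) \<in> lag_curve A g \<eta> t0 q t \<longleftrightarrow> (v, w) \<in> J.ell t" for v w
  proof
    assume "(v, w) \<in> lag_curve A g \<eta> t0 q t"
    then obtain Jf where Jf: "jacobi_field A g \<eta> {t0..q} Jf" "value_at A \<eta> Jf t0 = v"
      "value_at A \<eta> (cov_deriv g \<eta> {t0..q} Jf) t0 = w" "value_at A \<eta> Jf t = 0"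
      by (auto simp: lag_curve_def)
    obtain z where "\<forall>t\<in>{t0..q}. value_at A \<eta> Jf t = F (chart0 t) t (fst (\<Psi> t z)) \<and>
      value_at A \<eta> (cov_deriv g \<eta> {t0..q} Jf) t = F (chart0 t) t (snd (\<Psi> t z))"
      using flow_of_jacobi[OF pq eta Jf(1)] by blast
    then have "v = fst z" "w = snd z" "fst (\<Psi> t z) = 0"
      using Jf(2-4) t pq(3) F0_iff[OF pq eta t] by (auto simp: F_t0 J.\<Psi>_a)
    then show "(v, w) \<in> J.ell t" by (simp add: J.ell_def)
  next
    assume z: "(v, w) \<in> J.ell t"
    obtain Jf where "jacobi_field A g \<eta> {t0..q} Jf" "\<forall>t\<in>{t0..q}. value_at A \<eta> Jf t = F (chart0 t) t (fst (\<Psi> t (v, w))) \<and>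
      value_at A \<eta> (cov_deriv g \<eta> {t0..q} Jf) t = F (chart0 t) t (snd (\<Psi> t (v, w)))"
      using jacobi_of_flow[OF pq eta] by blast
    then show "(v, w) \<in> lag_curve A g \<eta> t0 q t"
      using z t pq(3) F0_iff[OF pq eta t] by (auto simp: lag_curve_def F_t0 J.\<Psi>_a J.ell_def intro!: exI[of _ Jf])
  qed
  then show ?thesis by auto
qed

text \<open>The derivatives counted by \<open>mul\<close> lie in the image of the kernel of
  \<open>Y t\<close> under a linear map; an upper bound is the direction in which \<open>mul\<close>
  enters the estimate.\<close>

lemma mul_le:
  assumes "t0 < q" "q \<le> b" and eta: "\<And>t. t \<in> {t0..q} \<Longrightarrow> \<eta> t = \<gamma> t" and t: "t \<in> {t0..q}"
  shows "mul A g \<eta> t0 q t \<le> dim {w. J.Y t w = 0}"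
proof -
  have pq: "t0 < q" "{t0..q} \<subseteq> {a..b}" "t0 \<in> {t0..q}" using assms t0 by auto
  have t': "t \<in> {a..b}" using t pq(2) by auto
  let ?L = "\<lambda>w. F (chart0 t) t (snd (\<Psi> t (0, w)))"
  have "linear (\<lambda>w. \<Psi> t (0, w))"
    using linear_compose[OF J.linear_zero_Pair J.\<Psi>_linear[OF t']] by (simp add: o_def)
  then have L: "linear ?L"
    using linear_compose[OF linear_compose[OF _ linear_snd] F_linear[OF chart0(1) t' chart0(2)]] by (simp add: o_def)
  have "{value_at A \<eta> (cov_deriv g \<eta> {t0..q} Jf) t |Jf.
     jacobi_field A g \<eta> {t0..q} Jf \<and> value_at A \<eta> Jf t0 = 0 \<and> value_at A \<eta> Jf t = 0} \<subseteq> ?L ` {w. J.Y t w = 0}"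
  proof (intro subsetI)
    fix x assume "x \<in> {value_at A \<eta> (cov_deriv g \<eta> {t0..q} Jf) t |Jf.
     jacobi_field A g \<eta> {t0..q} Jf \<and> value_at A \<eta> Jf t0 = 0 \<and> value_at A \<eta> Jf t = 0}"
    then obtain Jf where Jf: "jacobi_field A g \<eta> {t0..q} Jf" "value_at A \<eta> Jf t0 = 0" "value_at A \<eta> Jf t = 0"
      "x = value_at A \<eta> (cov_deriv g \<eta> {t0..q} Jf) t" by blast
    obtain z where z: "\<forall>t\<in>{t0..q}. value_at A \<eta> Jf t = F (chart0 t) t (fst (\<Psi> t z)) \<and>
      value_at A \<eta> (cov_deriv g \<eta> {t0..q} Jf) t = F (chart0 t) t (snd (\<Psi> t z))"
      using flow_of_jacobi[OF pq eta Jf(1)] by blast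
    have z0: "z = (0, snd z)" using z Jf(2) pq(3) by (simp add: F_t0 J.\<Psi>_a prod_eq_iff)
    have "fst (\<Psi> t z) = 0" using z Jf(3) t F0_iff[OF pq eta t] by auto
    then have "J.Y t (snd z) = 0" using z0 by (simp add: J.Y_def)
    moreover have "x = ?L (snd z)" using z0 z t Jf(4) by auto
    ultimately show "x \<in> ?L ` {w. J.Y t w = 0}" by blast
  qed
  then have "mul A g \<eta> t0 q t \<le> dim (?L ` {w. J.Y t w = 0})"
    unfolding mul_def by (rule dim_subset)
  also have "\<dots> \<le> dim {w. J.Y t w = 0}" by (rule dim_image_le[OF L])
  finally show ?thesis .
qed

text \<open>A common nonzero vector gives a field that vanishes at both instants. It is not
  identically zero, since otherwise its derivative at \<open>t0\<close> would be zero too, and with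
  it the initial data.\<close>

lemma conjugate_of_intersection:
  assumes t: "t \<in> {a..b}" and "J.ell t \<inter> J.ell a \<noteq> {0}"
  shows "conjugate_along A g \<gamma> {a..b} a t"
proof -
  note pq = ab subset_refl t0
  have a: "a \<in> {a..b}" using ab by simp
  have "0 \<in> J.ell t \<inter> J.ell a" using subspace_0 J.ell_subspace t a by blast
  then obtain z where z: "z \<in> J.ell t" "z \<in> J.ell a" "z \<noteq> 0" using assms(2) by blast
  obtain Jf where Jf: "jacobi_field A g \<gamma> {a..b} Jf" "\<forall>t\<in>{a..b}. value_at A \<gamma> Jf t = F (chart0 t) t (fst (\<Psi> t z))"
    using jacobi_of_flow[OF pq] by blast
  have "\<exists>r\<in>{a..b}. fst (\<Psi> r z) \<noteq> 0"
  proof (rule ccontr)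
    assume "\<not> (\<exists>r\<in>{a..b}. fst (\<Psi> r z) \<noteq> 0)"
    then have 0: "fst (\<Psi> r z) = 0" if "r \<in> {a..b}" for r using that by blast
    have "((\<lambda>r. fst (\<Psi> r z)) has_vector_derivative snd (\<Psi> t0 z)) (at t0 within {a..b})"
      using bounded_linear.has_vector_derivative[OF bounded_linear_fst J.\<Psi>_deriv[OF t0, of z]] by simp
    moreover have "((\<lambda>r. fst (\<Psi> r z)) has_vector_derivative 0) (at t0 within {a..b})"
      by (rule has_vector_derivative_transform[OF t0 _ has_vector_derivative_const[of 0]]) (use 0 in auto)
    ultimately have "snd (\<Psi> t0 z) = 0" using has_vector_derivative_Icc_unique[OF ab t0] by metis
    then show False using 0[OF t0] z(3) by (simp add: J.\<Psi>_a prod_eq_iff)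
  qed
  then have "\<exists>r\<in>{a..b}. value_at A \<gamma> Jf r \<noteq> 0" using Jf(2) F0_iff[OF pq] by auto
  moreover have "value_at A \<gamma> Jf a = 0" "value_at A \<gamma> Jf t = 0"
    using z Jf(2) a t F0_iff[OF pq] by (auto simp: J.ell_def)
  ultimately show ?thesis unfolding conjugate_along_def using Jf(1) by blast
qed

lemma symp_form_eq: "symp_form A g (\<gamma> t0) = J.om"
  by (simp add: fun_eq_iff symp_form_def J.om_def form_def[symmetric] split_beta)

lemma form_gform: "form = gform g (chart0 t0) (pos (chart0 t0) t0)"
  by (simp add: form_def metric_at_def pos_def)

text \<open>Here \<open>a\<close> is the earlier instant, \<open>t0\<close> the initial and
  \<open>t1\<close> the conjugate one. With \<open>k\<close> from \<open>maslov_bound\<close>,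
  \<open>k \<ge> 0\<close> yields the second estimate, and the bound on \<open>k\<close> plus the
  dimension of the kernel yields the first by \<open>gform_sylvester\<close>.\<close>

lemma maslov_estimate:
  assumes q: "q \<le> b" and eta: "\<And>t. t \<in> {t0..q} \<Longrightarrow> \<eta> t = \<gamma> t"
    and mu: "is_maslov_index (symp_form A g (\<eta> t0)) (lag_curve A g \<eta> t0 q t0) \<mu>"
    and c: "t0 < c" "c < t1" "t1 \<le> q"
    and early: "\<And>t. t \<in> {t0<..c} \<Longrightarrow> \<not> conjugate_instant A g \<eta> t0 q t"
    and noconj: "\<And>t. t \<in> {t0..t1} \<Longrightarrow> \<not> conjugate_along A g \<gamma> {a..b} a t"
  shows "int (mul A g \<eta> t0 q t1) \<le> int (metric_index A g) - \<mu> c t1 (lag_curve A g \<eta> t0 q)"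
    and "\<mu> c t1 (lag_curve A g \<eta> t0 q) \<ge> - int (metric_coindex A g)"
proof -
  have tq: "t0 < q" using c by simp
  note lag = lag_curve_eq[OF tq q eta]
  interpret T: transverse_lagrangian "g (chart0 t0) (pos (chart0 t0) t0)" jac \<Psi> a b t0 form t1
  proof
    show "t0 \<le> t1" "t1 \<le> b" using c q by auto
    show "J.ell t \<inter> J.ell a = {0}" if "t \<in> {t0..t1}" for t
      using conjugate_of_intersection[of t] noconj[OF that] that t0 c q by fastforce
  qed
  have "J.ell t \<inter> J.ell t0 = {0}" if "t \<in> {t0<..c}" for t
    using early[OF that] that c lag[of t] lag[of t0] unfolding conjugate_instant_def by auto
  moreover have "is_maslov_index J.om (J.ell t0) \<mu>"
    using mu lag[of t0] eta[of t0] tq by (simp add: symp_form_eq)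
  ultimately obtain k where k: "\<mu> c t1 (lag_curve A g \<eta> t0 q) = int k - int (pos_index UNIV form)"
    "k + dim {w. J.Y t1 w = 0} \<le> CARD('n)"
    using T.maslov_bound[OF _ c(1,2), of \<mu> "lag_curve A g \<eta> t0 q"] lag c by auto
  note i = metric_index_eq[OF chart0(1) pos_img[OF chart0(2)], of t0, folded form_gform]
  show "\<mu> c t1 (lag_curve A g \<eta> t0 q) \<ge> - int (metric_coindex A g)" using k(1) i(2) by simp
  have "mul A g \<eta> t0 q t1 \<le> dim {w. J.Y t1 w = 0}" by (rule mul_le[OF tq q eta]) (use c in auto)
  then show "int (mul A g \<eta> t0 q t1) \<le> int (metric_index A g) - \<mu> c t1 (lag_curve A g \<eta> t0 q)"
    using k i gform_sylvester[OF chart0(1) pos_img[OF chart0(2)], of t0, folded form_gform] by simp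
qed

end

end

theorem corollary4p10:
  fixes A :: "('m::{t2_space, second_countable_topology}, 'n::finite) chart set"
    and g :: "('m, 'n) metric"
    and \<gamma> \<gamma>' :: "real \<Rightarrow> 'm"
    and a b \<epsilon> t0 a' :: real
    and \<mu> :: "real \<Rightarrow> real \<Rightarrow> (real \<Rightarrow> ((real ^ 'n) \<times> (real ^ 'n)) set) \<Rightarrow> int"
  assumes "smooth_atlas A" and "semi_riemannian A g"
    and "geodesic A g \<gamma> {a..b}"
    and "is_maslov_index (symp_form A g (\<gamma> a)) (lag_curve A g \<gamma> a b a) \<mu>"
    and "\<epsilon> > 0" and "\<forall>t\<in>{a<..a + \<epsilon>}. \<not> conjugate_instant A g \<gamma> a b t"
    and "conjugate_instant A g \<gamma> a b t0"
    and "int (mul A g \<gamma> a b t0) > int (metric_index A g) - \<mu> (a + \<epsilon>) t0 (lag_curve A g \<gamma> a b)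
         \<or> \<mu> (a + \<epsilon>) t0 (lag_curve A g \<gamma> a b) < - int (metric_coindex A g)"
    and "a' < a" and "geodesic A g \<gamma>' {a'..b}" and "\<forall>t\<in>{a..b}. \<gamma>' t = \<gamma> t"
  shows "\<exists>t'\<in>{a..t0}. conjugate_along A g \<gamma>' {a'..b} a' t'"
proof (rule ccontr)
  assume no: "\<not> (\<exists>t'\<in>{a..t0}. conjugate_along A g \<gamma>' {a'..b} a' t')"
  have at0: "a < t0" "t0 \<le> b" using assms(7) by (auto simp: conjugate_instant_def)
  \<comment> \<open>\<open>t0\<close> is conjugate, while no instant after \<open>a\<close> up to
    \<open>a + \<epsilon>\<close> is.\<close>
  have c: "a < a + \<epsilon>" "a + \<epsilon> < t0" using assms(5-7) at0 by force+
  interpret curve_along A g \<gamma>' a' b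
    by unfold_locales (use assms at0 in \<open>auto simp: geodesic_def\<close>)
  have "a \<in> {a'..b}" using assms(9) at0 by simp
  \<comment> \<open>The frame runs along the whole extension but is normalised at \<open>a\<close>,
    where the initial data of the curve of Lagrangians live.\<close>
  from parallel_frame_exists[OF this] obtain F where "parallel_frame A g \<gamma>' a' b F a" by blast
  then interpret parallel_frame A g \<gamma>' a' b F a .
  obtain \<Psi> where \<Psi>: "jacobi_system (g (chart0 a) (pos (chart0 a) a)) jac \<Psi> a' b a form"
    using jacobi_system_exists by blast
  have "\<gamma> t = \<gamma>' t" if "t \<in> {a..b}" for t using assms(11) that by simp
  note e = maslov_estimate[OF \<Psi> order_refl this assms(4) c at0(2)]
  show False using e assms(6,8) no by fastforce
qed

end
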